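(* Let $p\in(0,\infty)$, let $g$ be holomorphic on the open unit disk $\mathbb{D}$, let $d\mu_{p,g}(z)=(1-|z|^2)^p|g'(z)|^2\,dm(z)$ and $\|g\|_{\mathcal{H}^\infty}=\sup_{z\in\mathbb{D}}|g(z)|$. Then: (i) $\mathsf{V}_g$ is bounded on $\mathcal{Q}_p$ if and only if $\|\mu_{p,g}\|_{\mathcal{LCM}_p}<\infty$; and $\mathsf{V}_g$ is compact on $\mathcal{Q}_p$ if and only if $$\lim_{|I|\to0}|I|^{-p}\left(\log\frac{2}{|I|}\right)^2\mu_{p,g}(S(I))=0.$$ (ii) $\mathsf{U}_g$ is bounded on $\mathcal{Q}_p$ if and only if $\|g\|_{\mathcal{H}^\infty}<\infty$; and $\mathsf{U}_g$ is compact on $\mathcal{Q}_p$ if and only if $g=0$. (iii) $\mathsf{M}_g$ is bounded on $\mathcal{Q}_p$ if and only if $\|\mu_{p,g}\|_{\mathcal{LCM}_p}<\infty$ and $\|g\|_{\mathcal{H}^\infty}<\infty$; and $\mathsf{M}_g$ is compact on $\mathcal{Q}_p$ if and only if $g=0$.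
   Context: $\mathbb{D}=\{z\in\mathbb{C}:|z|<1\}$, $\mathbb{T}=\{z\in\mathbb{C}:|z|=1\}$, and $dm$ is Lebesgue area measure on $\mathbb{C}$. For $w\in\mathbb{D}$, $\sigma_w(z)=(w-z)/(1-\bar{w}z)$. For $p\in(0,\infty)$, $\mathcal{Q}_p$ is the space of all holomorphic functions $f$ on $\mathbb{D}$ with $$\|f\|_{\mathcal{Q}_p}=|f(0)|+\sup_{w\in\mathbb{D}}\sqrt{\int_{\mathbb{D}}|f'(z)|^2(1-|\sigma_w(z)|^2)^p\,dm(z)}<\infty.$$ For a subarc $I$ of $\mathbb{T}$, $|I|=(2\pi)^{-1}\int_I|d\xi|$ is its normalized length (so $|I|\le 1$), and $S(I)=\{r\xi\in\mathbb{D}: r\in[1-|I|,1),\ \xi\in I\}$ is the associated Carleson square. For a nonnegative Borel measure $\mu$ on $\mathbb{D}$, $$\|\mu\|_{\mathcal{LCM}_p}=\sup_{S(I)\subseteq\mathbb{D}}\sqrt{\frac{\mu(S(I))}{|I|^p\left(\log\frac{2}{|I|}\right)^{-2}}},$$ the supremum being over all subarcs $I$ of $\mathbb{T}$ (of positive length); $\lim_{|I|\to0}$ is a limit uniform over all subarcs $I$ as their length tends to $0$. For $g$ holomorphic on $\mathbb{D}$, the following operators act on holomorphic functions $f$ on $\mathbb{D}$, for $z\in\mathbb{D}$: $$\mathsf{V}_gf(z)=\int_0^z g'(w)f(w)\,dw,\qquad \mathsf{U}_gf(z)=\int_0^z g(w)f'(w)\,dw,\qquad \mathsf{M}_gf(z)=f(z)g(z).$$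 "Bounded (compact) on $\mathcal{Q}_p$" means that the operator maps $\mathcal{Q}_p$ into $\mathcal{Q}_p$ and is bounded (compact) as a linear operator on $(\mathcal{Q}_p,\|\cdot\|_{\mathcal{Q}_p})$. *)

theory Defs
  imports "HOL-Complex_Analysis.Complex_Analysis"
begin

abbreviation unit_disc :: "complex set" where
  "unit_disc \<equiv> ball 0 1"

definition ennreal_sqrt :: "ennreal \<Rightarrow> ennreal" where
  "ennreal_sqrt x = (if x = top then top else ennreal (sqrt (enn2real x)))"

definition disc_aut :: "complex \<Rightarrow> complex \<Rightarrow> complex" where
  "disc_aut w z = (w - z) / (1 - cnj w * z)"

definition Qp_enorm :: "real \<Rightarrow> (complex \<Rightarrow> complex) \<Rightarrow> ennreal" where
  "Qp_enorm p f = ennreal (cmod (f 0)) +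
     (SUP w\<in>unit_disc. ennreal_sqrt
        (\<integral>\<^sup>+z\<in>unit_disc. ennreal ((cmod (deriv f z))\<^sup>2 * (1 - (cmod (disc_aut w z))\<^sup>2) powr p) \<partial>lborel))"

text \<open>A function on the disc is represented by the function on the whole plane that extends it
  by zero; with this convention distinct elements of \<open>Qp p\<close> are distinct functions on the disc.\<close>

definition Qp :: "real \<Rightarrow> (complex \<Rightarrow> complex) set" where
  "Qp p = {f. f holomorphic_on unit_disc \<and> (\<forall>z. z \<notin> unit_disc \<longrightarrow> f z = 0) \<and> Qp_enorm p f < \<infinity>}"

definition Qp_norm :: "real \<Rightarrow> (complex \<Rightarrow> complex) \<Rightarrow> real" where
  "Qp_norm p f = enn2real (Qp_enorm p f)"

definition Qp_dist :: "real \<Rightarrow> (complex \<Rightarrow> complex) \<Rightarrow> (complex \<Rightarrow> complex) \<Rightarrow> real" where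
  "Qp_dist p f h = Qp_norm p (\<lambda>z. f z - h z)"

abbreviation Qp_topology :: "real \<Rightarrow> (complex \<Rightarrow> complex) topology" where
  "Qp_topology p \<equiv> Metric_space.mtopology (Qp p) (Qp_dist p)"

definition bounded_on_Qp :: "real \<Rightarrow> ((complex \<Rightarrow> complex) \<Rightarrow> (complex \<Rightarrow> complex)) \<Rightarrow> bool" where
  "bounded_on_Qp p T \<longleftrightarrow>
     T \<in> Qp p \<rightarrow> Qp p \<and> (\<exists>C. \<forall>f\<in>Qp p. Qp_norm p (T f) \<le> C * Qp_norm p f)"

definition compact_on_Qp :: "real \<Rightarrow> ((complex \<Rightarrow> complex) \<Rightarrow> (complex \<Rightarrow> complex)) \<Rightarrow> bool" where
  "compact_on_Qp p T \<longleftrightarrow>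
     T \<in> Qp p \<rightarrow> Qp p \<and>
     (\<forall>B\<subseteq>Qp p. (\<exists>r. \<forall>f\<in>B. Qp_norm p f \<le> r) \<longrightarrow>
        compactin (Qp_topology p) (Qp_topology p closure_of (T ` B)))"

definition V_op :: "(complex \<Rightarrow> complex) \<Rightarrow> (complex \<Rightarrow> complex) \<Rightarrow> complex \<Rightarrow> complex" where
  "V_op g f z = (if z \<in> unit_disc then contour_integral (linepath 0 z) (\<lambda>w. deriv g w * f w) else 0)"

definition U_op :: "(complex \<Rightarrow> complex) \<Rightarrow> (complex \<Rightarrow> complex) \<Rightarrow> complex \<Rightarrow> complex" where
  "U_op g f z = (if z \<in> unit_disc then contour_integral (linepath 0 z) (\<lambda>w. g w * deriv f w) else 0)"

definition M_op :: "(complex \<Rightarrow> complex) \<Rightarrow> (complex \<Rightarrow> complex) \<Rightarrow> complex \<Rightarrow> complex" where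
  "M_op g f z = (if z \<in> unit_disc then f z * g z else 0)"

definition arc_length :: "complex set \<Rightarrow> real" where
  "arc_length I = measure lborel {t \<in> {0..<2 * pi}. cis t \<in> I} / (2 * pi)"

text \<open>Arcs may be open, half-open or closed, and include the whole circle; degenerate ones are
  excluded by the condition on the length.\<close>

definition subarcs :: "complex set set" where
  "subarcs = {I. (\<exists>J::real set. is_interval J \<and> I = cis ` J) \<and> 0 < arc_length I}"

definition carleson_square :: "complex set \<Rightarrow> complex set" where
  "carleson_square I =
     {z \<in> unit_disc. \<exists>r \<xi>. z = of_real r * \<xi> \<and> r \<in> {1 - arc_length I..<1} \<and> \<xi> \<in> I}"

definition LCM_norm :: "real \<Rightarrow> complex measure \<Rightarrow> ennreal" where
  "LCM_norm p \<mu> =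
     (SUP I\<in>subarcs. ennreal_sqrt
        (emeasure \<mu> (carleson_square I) /
           ennreal (arc_length I powr p * (ln (2 / arc_length I)) powi (-2))))"

definition mu_measure :: "real \<Rightarrow> (complex \<Rightarrow> complex) \<Rightarrow> complex measure" where
  "mu_measure p g =
     density (restrict_space lborel unit_disc)
       (\<lambda>z. ennreal ((1 - (cmod z)\<^sup>2) powr p * (cmod (deriv g z))\<^sup>2))"

text \<open>The filter on arcs describing \<open>\<bar>I\<bar> \<rightarrow> 0\<close>, uniformly over all arcs.\<close>

definition small_arcs :: "complex set filter" where
  "small_arcs = inf (filtercomap arc_length (at_right 0)) (principal subarcs)"

definition Hinf_norm :: "(complex \<Rightarrow> complex) \<Rightarrow> ennreal" where
  "Hinf_norm g = (SUP z\<in>unit_disc. ennreal (cmod (g z)))"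

text \<open>\<open>Metric_space_Qp\<close>, proved below, justifies the use of \<open>Metric_space.mtopology\<close> in
  \<open>Qp_topology\<close>.\<close>

lemma ennreal_sqrt_le_iff:
  assumes "0 \<le> A"
  shows "ennreal_sqrt x \<le> ennreal A \<longleftrightarrow> x \<le> ennreal (A\<^sup>2)"
proof (cases x)
  case (real r)
  have "sqrt r \<le> A \<longleftrightarrow> r \<le> A\<^sup>2"
    using assms real by (metis real_le_lsqrt real_le_rsqrt real_sqrt_ge_zero real_sqrt_le_iff
        real_sqrt_pow2 real_sqrt_unique sqrt_le_D)
  with real assms show ?thesis by (simp add: ennreal_sqrt_def)
qed (simp add: ennreal_sqrt_def top_unique)

definition Qp_energy :: "real \<Rightarrow> (complex \<Rightarrow> complex) \<Rightarrow> complex \<Rightarrow> ennreal" where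
  "Qp_energy p f w =
     (\<integral>\<^sup>+z\<in>unit_disc. ennreal ((cmod (deriv f z))\<^sup>2 * (1 - (cmod (disc_aut w z))\<^sup>2) powr p) \<partial>lborel)"

lemma disc_aut_denominator:
  assumes "w \<in> unit_disc" "z \<in> unit_disc" shows "1 - cnj w * z \<noteq> 0"
proof
  assume "1 - cnj w * z = 0"
  then have "cmod w * cmod z = 1"
    by (metis complex_mod_cnj eq_iff_diff_eq_0 norm_mult norm_one)
  moreover have "cmod w * cmod z < 1 * 1"
    using assms by (intro mult_strict_mono') auto
  ultimately show False by simp
qed

lemma disc_aut_lt_1:
  assumes "w \<in> unit_disc" "z \<in> unit_disc" shows "cmod (disc_aut w z) < 1"
proof -
  have "norm (disc_aut w z) < 1 \<longleftrightarrow> cmod (w - z) < cmod (1 - cnj w * z)"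
    using disc_aut_denominator[OF assms] by (simp add: disc_aut_def norm_divide divide_less_eq)
  also have "\<dots> \<longleftrightarrow> (cmod (w - z))\<^sup>2 < (cmod (1 - cnj w * z))\<^sup>2"
    by (metis norm_ge_zero power2_less_imp_less power_strict_mono zero_less_numeral)
  also have "(cmod (1 - cnj w * z))\<^sup>2 - (cmod (w - z))\<^sup>2 = (1 - (cmod w)\<^sup>2) * (1 - (cmod z)\<^sup>2)"
    unfolding cmod_power2 by (simp add: algebra_simps power2_eq_square)
  then have "(cmod (w - z))\<^sup>2 < (cmod (1 - cnj w * z))\<^sup>2 \<longleftrightarrow> 0 < (1 - (cmod w)\<^sup>2) * (1 - (cmod z)\<^sup>2)"
    by linarith
  also have "\<dots>"
    using assms by (intro mult_pos_pos) (auto simp: power_less_one_iff)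
  finally show ?thesis by simp
qed

lemma Qp_integrand_measurable:
  assumes "f holomorphic_on unit_disc" "w \<in> unit_disc"
  shows "(\<lambda>z. ennreal ((cmod (deriv f z))\<^sup>2 * (1 - (cmod (disc_aut w z))\<^sup>2) powr p) * indicator unit_disc z)
           \<in> borel_measurable lborel"
proof -
  have c1: "continuous_on unit_disc (deriv f)"
    using assms(1) by (intro holomorphic_on_imp_continuous_on holomorphic_deriv) auto
  have c2: "continuous_on unit_disc (disc_aut w)"
    unfolding disc_aut_def using disc_aut_denominator[OF assms(2)]
    by (intro continuous_intros) auto
  have "1 - (cmod (disc_aut w z))\<^sup>2 \<noteq> 0" if "z \<in> unit_disc" for z
    using disc_aut_lt_1[OF assms(2) that] by (simp add: abs_square_eq_1)
  then have "continuous_on unit_disc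
      (\<lambda>z. (cmod (deriv f z))\<^sup>2 * (1 - (cmod (disc_aut w z))\<^sup>2) powr p)"
    by (intro continuous_intros c1 c2) auto
  then have "(\<lambda>z. indicator unit_disc z *\<^sub>R
      ((cmod (deriv f z))\<^sup>2 * (1 - (cmod (disc_aut w z))\<^sup>2) powr p)) \<in> borel_measurable borel"
    by (intro borel_measurable_continuous_on_indicator) auto
  then have "(\<lambda>z. ennreal (indicator unit_disc z *\<^sub>R
      ((cmod (deriv f z))\<^sup>2 * (1 - (cmod (disc_aut w z))\<^sup>2) powr p))) \<in> borel_measurable lborel"
    by simp
  also have "(\<lambda>z. ennreal (indicator unit_disc z *\<^sub>R
      ((cmod (deriv f z))\<^sup>2 * (1 - (cmod (disc_aut w z))\<^sup>2) powr p))) =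
     (\<lambda>z. ennreal ((cmod (deriv f z))\<^sup>2 * (1 - (cmod (disc_aut w z))\<^sup>2) powr p) * indicator unit_disc z)"
    by (auto simp: fun_eq_iff split: split_indicator)
  finally show ?thesis .
qed

lemma square_sum_le_weighted:
  fixes a b A B :: real
  assumes "0 < A" "0 < B"
  shows "(a + b)\<^sup>2 \<le> (A + B) / A * a\<^sup>2 + (A + B) / B * b\<^sup>2"
proof -
  have "(A + B) / A * a\<^sup>2 + (A + B) / B * b\<^sup>2 - (a + b)\<^sup>2 = (B * a - A * b)\<^sup>2 / (A * B)"
    using assms by (simp add: field_simps power2_eq_square)
  also have "\<dots> \<ge> 0" using assms by simp
  finally show ?thesis by linarith
qed

lemma Qp_energy_triangle:
  assumes f: "f holomorphic_on unit_disc" and h: "h holomorphic_on unit_disc"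
    and w: "w \<in> unit_disc" and A: "0 < A" and B: "0 < B"
    and EA: "Qp_energy p f w \<le> ennreal (A\<^sup>2)" and EB: "Qp_energy p h w \<le> ennreal (B\<^sup>2)"
  shows "Qp_energy p (\<lambda>z. f z - h z) w \<le> ennreal ((A + B)\<^sup>2)"
proof -
  let ?W = "\<lambda>z. (1 - (cmod (disc_aut w z))\<^sup>2) powr p"
  have pw: "ennreal ((cmod (deriv (\<lambda>z. f z - h z) z))\<^sup>2 * ?W z) * indicator unit_disc z \<le>
      ennreal ((A + B) / A) * (ennreal ((cmod (deriv f z))\<^sup>2 * ?W z) * indicator unit_disc z) +
      ennreal ((A + B) / B) * (ennreal ((cmod (deriv h z))\<^sup>2 * ?W z) * indicator unit_disc z)" for z
  proof (cases "z \<in> unit_disc")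
    case True
    have "deriv (\<lambda>z. f z - h z) z = deriv f z - deriv h z"
      using f h True by (intro deriv_diff) (auto intro: holomorphic_on_imp_differentiable_at)
    then have "(cmod (deriv (\<lambda>z. f z - h z) z))\<^sup>2 \<le> (cmod (deriv f z) + cmod (deriv h z))\<^sup>2"
      by (simp add: norm_triangle_ineq4 power_mono)
    also have "\<dots> \<le> (A + B) / A * (cmod (deriv f z))\<^sup>2 + (A + B) / B * (cmod (deriv h z))\<^sup>2"
      by (rule square_sum_le_weighted[OF A B])
    finally have "(cmod (deriv (\<lambda>z. f z - h z) z))\<^sup>2 * ?W z \<le>
        ((A + B) / A * (cmod (deriv f z))\<^sup>2 + (A + B) / B * (cmod (deriv h z))\<^sup>2) * ?W z"
      by (rule mult_right_mono) simp
    also have "\<dots> = (A + B) / A * ((cmod (deriv f z))\<^sup>2 * ?W z) + (A + B) / B * ((cmod (deriv h z))\<^sup>2 * ?W z)"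
      by (simp add: algebra_simps)
    finally show ?thesis using True A B
      by (simp flip: ennreal_mult ennreal_plus)
  qed simp
  have "Qp_energy p (\<lambda>z. f z - h z) w \<le>
      ennreal ((A + B) / A) * Qp_energy p f w + ennreal ((A + B) / B) * Qp_energy p h w"
    unfolding Qp_energy_def
    using Qp_integrand_measurable[OF f w] Qp_integrand_measurable[OF h w]
    by (subst (1 2) nn_integral_cmult[symmetric])
       (auto simp flip: nn_integral_add intro!: nn_integral_mono pw)
  also have "\<dots> \<le> ennreal ((A + B) / A) * ennreal (A\<^sup>2) + ennreal ((A + B) / B) * ennreal (B\<^sup>2)"
    by (intro add_mono mult_left_mono EA EB) auto
  also have "\<dots> = ennreal ((A + B) / A * A\<^sup>2 + (A + B) / B * B\<^sup>2)"
    using A B by (simp flip: ennreal_mult ennreal_plus)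
  also have "(A + B) / A * A\<^sup>2 + (A + B) / B * B\<^sup>2 = (A + B)\<^sup>2"
    using A B by (simp add: field_simps power2_eq_square)
  finally show ?thesis .
qed

lemma Qp_enorm_altdef:
  "Qp_enorm p f = ennreal (cmod (f 0)) + (SUP w\<in>unit_disc. ennreal_sqrt (Qp_energy p f w))"
  by (simp add: Qp_enorm_def Qp_energy_def)

lemma Qp_enorm_diff_le:
  assumes f: "f holomorphic_on unit_disc" and h: "h holomorphic_on unit_disc"
  shows "Qp_enorm p (\<lambda>z. f z - h z) \<le> Qp_enorm p f + Qp_enorm p h"
proof -
  let ?S = "\<lambda>f. SUP w\<in>unit_disc. ennreal_sqrt (Qp_energy p f w)"
  have S: "?S (\<lambda>z. f z - h z) \<le> ?S f + ?S h"
  proof (cases "?S f = top \<or> ?S h = top")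
    case False
    then obtain a b where a: "0 \<le> a" "?S f = ennreal a" and b: "0 \<le> b" "?S h = ennreal b"
      by (metis ennreal_cases)
    show ?thesis
    proof (rule ennreal_le_epsilon)
      fix e :: real assume e: "0 < e"
      show "?S (\<lambda>z. f z - h z) \<le> ?S f + ?S h + ennreal e"
      proof (rule SUP_least)
        fix w :: complex assume w: "w \<in> unit_disc"
        have "ennreal_sqrt (Qp_energy p f w) \<le> ennreal a"
          unfolding a(2)[symmetric] by (rule SUP_upper[OF w])
        also have "\<dots> \<le> ennreal (a + e/2)" using e by (intro ennreal_leI) auto
        finally have 1: "Qp_energy p f w \<le> ennreal ((a + e/2)\<^sup>2)"
          using a e by (subst (asm) ennreal_sqrt_le_iff) auto
        have "ennreal_sqrt (Qp_energy p h w) \<le> ennreal b"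
          unfolding b(2)[symmetric] by (rule SUP_upper[OF w])
        also have "\<dots> \<le> ennreal (b + e/2)" using e by (intro ennreal_leI) auto
        finally have 2: "Qp_energy p h w \<le> ennreal ((b + e/2)\<^sup>2)"
          using b e by (subst (asm) ennreal_sqrt_le_iff) auto
        have "Qp_energy p (\<lambda>z. f z - h z) w \<le> ennreal ((a + e/2 + (b + e/2))\<^sup>2)"
          using a b e by (intro Qp_energy_triangle[OF f h w _ _ 1 2]) auto
        then have "ennreal_sqrt (Qp_energy p (\<lambda>z. f z - h z) w) \<le> ennreal (a + e/2 + (b + e/2))"
          using a b e by (subst ennreal_sqrt_le_iff) auto
        also have "a + e/2 + (b + e/2) = a + b + e" by simp
        finally show "ennreal_sqrt (Qp_energy p (\<lambda>z. f z - h z) w) \<le> ?S f + ?S h + ennreal e"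
          using a b e by simp
      qed
    qed
  next
    case True
    then have "?S f + ?S h = top" by (simp only: ennreal_add_eq_top)
    then show ?thesis by (simp only: top_greatest)
  qed
  have "ennreal (cmod (f 0 - h 0)) \<le> ennreal (cmod (f 0)) + ennreal (cmod (h 0))"
    by (simp add: norm_triangle_ineq4 flip: ennreal_plus)
  from add_mono[OF this S] show ?thesis
    unfolding Qp_enorm_altdef by (simp add: ac_simps)
qed

lemma Qp_enorm_minus_commute:
  "Qp_enorm p (\<lambda>z. f z - h z) = Qp_enorm p (\<lambda>z. h z - f z)"
proof -
  have "cmod (deriv (\<lambda>z. f z - h z) z) = cmod (deriv (\<lambda>z. h z - f z) z)" for z
  proof (cases "(\<lambda>z. f z - h z) field_differentiable at z")
    case True
    then have "((\<lambda>z. - (f z - h z)) has_field_derivative - deriv (\<lambda>z. f z - h z) z) (at z)"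
      by (intro DERIV_minus) (simp add: DERIV_deriv_iff_field_differentiable)
    then have "deriv (\<lambda>z. h z - f z) z = - deriv (\<lambda>z. f z - h z) z"
      by (intro DERIV_imp_deriv) simp
    then show ?thesis by simp
  next
    case False
    moreover have "\<not> (\<lambda>z. h z - f z) field_differentiable at z"
    proof
      assume "(\<lambda>z. h z - f z) field_differentiable at z"
      from field_differentiable_minus[OF this] False show False by (simp only: minus_diff_eq)
    qed
    ultimately show ?thesis by (simp add: deriv_def field_differentiable_def)
  qed
  then have "Qp_energy p (\<lambda>z. f z - h z) w = Qp_energy p (\<lambda>z. h z - f z) w" for w
    unfolding Qp_energy_def by (simp only:)
  then show ?thesis by (simp only: Qp_enorm_altdef norm_minus_commute[of "f 0"])
qed

lemma Qp_enorm_eq_0D: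
  assumes f: "f holomorphic_on unit_disc" and 0: "Qp_enorm p f = 0" and z: "z \<in> unit_disc"
  shows "f z = 0"
proof -
  have "ennreal_sqrt (Qp_energy p f 0) \<le> 0"
    using 0 by (auto simp: Qp_enorm_altdef SUP_eq_iff intro: order.trans[OF SUP_upper[of 0]])
  then have "Qp_energy p f 0 = 0"
    using ennreal_sqrt_le_iff[of 0 "Qp_energy p f 0"] by simp
  then have "AE z in lborel. ennreal ((cmod (deriv f z))\<^sup>2 * (1 - (cmod (disc_aut 0 z))\<^sup>2) powr p)
      * indicator unit_disc z = 0"
    unfolding Qp_energy_def
    by (subst (asm) nn_integral_0_iff_AE) (use Qp_integrand_measurable[OF f, of 0 p] in auto)
  then have AE: "AE z in lborel. z \<in> unit_disc \<longrightarrow> deriv f z = 0"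
  proof (rule AE_mp, intro AE_I2 impI)
    fix z assume *: "ennreal ((cmod (deriv f z))\<^sup>2 * (1 - (cmod (disc_aut 0 z))\<^sup>2) powr p)
      * indicator unit_disc z = 0" "z \<in> unit_disc"
    have "1 - (cmod (disc_aut 0 z))\<^sup>2 > 0"
      using disc_aut_lt_1[of 0 z] *(2) by (simp add: power_less_one_iff)
    then have "0 < (1 - (cmod (disc_aut 0 z))\<^sup>2) powr p" by simp
    with * show "deriv f z = 0"
      by (auto simp: ennreal_eq_0_iff mult_le_0_iff)
  qed
  have cont: "continuous_on unit_disc (deriv f)"
    using f by (intro holomorphic_on_imp_continuous_on holomorphic_deriv) auto
  have deriv0: "deriv f z = 0" if "z \<in> unit_disc" for z
  proof (rule ccontr)
    assume "deriv f z \<noteq> 0"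
    let ?U = "{z \<in> unit_disc. deriv f z \<in> - {0}}"
    have eq: "?U = unit_disc \<inter> deriv f -` (- {0})" by auto
    have "open ?U"
      unfolding eq by (rule continuous_open_preimage[OF cont]) auto
    moreover have "z \<in> ?U" using that \<open>deriv f z \<noteq> 0\<close> by simp
    ultimately have "\<not> negligible ?U" by (intro open_not_negligible) auto
    moreover have "?U \<in> null_sets lebesgue"
    proof -
      have "AE z in lborel. z \<notin> ?U" using AE by auto
      then have "AE z in lebesgue. z \<notin> ?U" by (simp add: AE_completion_iff)
      then show ?thesis using \<open>open ?U\<close> by (subst AE_iff_null_sets) auto
    qed
    ultimately show False by (simp add: negligible_iff_null_sets)
  qed
  have "\<exists>c. \<forall>z\<in>unit_disc. f z = c"
  proof (rule has_field_derivative_zero_constant)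
    fix z assume "z \<in> unit_disc"
    then show "(f has_field_derivative 0) (at z within unit_disc)"
      using holomorphic_derivI[OF f open_ball, of z] deriv0[of z] by (simp only:)
  qed (rule convex_ball)
  moreover have "f 0 = 0" using 0 by (auto simp: Qp_enorm_altdef)
  ultimately show ?thesis using z by (metis centre_in_ball zero_less_one)
qed

lemma Metric_space_Qp: "Metric_space (Qp p) (Qp_dist p)"
proof
  fix f g h :: "complex \<Rightarrow> complex"
  show "0 \<le> Qp_dist p f g" by (simp add: Qp_dist_def Qp_norm_def)
next
  fix f g :: "complex \<Rightarrow> complex"
  show "Qp_dist p f g = Qp_dist p g f"
    unfolding Qp_dist_def Qp_norm_def by (subst Qp_enorm_minus_commute[of p f g]) (rule refl)
next
  fix f g assume fg: "f \<in> Qp p" "g \<in> Qp p"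
  then have hol: "f holomorphic_on unit_disc" "g holomorphic_on unit_disc"
    and fin: "Qp_enorm p f < top" "Qp_enorm p g < top" by (auto simp: Qp_def)
  show "Qp_dist p f g = 0 \<longleftrightarrow> f = g"
  proof
    assume "Qp_dist p f g = 0"
    moreover have "Qp_enorm p (\<lambda>z. f z - g z) < top"
      using Qp_enorm_diff_le[OF hol] fin by (metis ennreal_add_less_top order.strict_trans1)
    ultimately have "Qp_enorm p (\<lambda>z. f z - g z) = 0"
      by (auto simp: Qp_dist_def Qp_norm_def enn2real_eq_0_iff)
    then have "f z = g z" if "z \<in> unit_disc" for z
      using Qp_enorm_eq_0D[of "\<lambda>z. f z - g z" p z] hol that by (auto intro: holomorphic_intros)
    moreover have "f z = g z" if "z \<notin> unit_disc" for z
      using fg that by (auto simp: Qp_def)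
    ultimately show "f = g" by blast
  next
    assume "f = g"
    have "Qp_energy p (\<lambda>z. 0) w = 0" for w by (simp add: Qp_energy_def)
    then have "Qp_enorm p (\<lambda>z. 0) = 0" by (simp add: Qp_enorm_altdef ennreal_sqrt_def)
    with \<open>f = g\<close> show "Qp_dist p f g = 0" by (simp add: Qp_dist_def Qp_norm_def)
  qed
next
  fix f g h assume fgh: "f \<in> Qp p" "g \<in> Qp p" "h \<in> Qp p"
  then have hol: "f holomorphic_on unit_disc" "g holomorphic_on unit_disc" "h holomorphic_on unit_disc"
    and fin: "Qp_enorm p f < top" "Qp_enorm p g < top" "Qp_enorm p h < top" by (auto simp: Qp_def)
  have *: "Qp_enorm p (\<lambda>z. f z - g z) < top" "Qp_enorm p (\<lambda>z. h z - g z) < top"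
    using Qp_enorm_diff_le hol fin by (metis ennreal_add_less_top order.strict_trans1)+
  have "Qp_enorm p (\<lambda>z. (f z - g z) - (h z - g z)) \<le>
      Qp_enorm p (\<lambda>z. f z - g z) + Qp_enorm p (\<lambda>z. h z - g z)"
    using hol by (intro Qp_enorm_diff_le) (auto intro: holomorphic_intros)
  then have "Qp_norm p (\<lambda>z. f z - h z) \<le> Qp_norm p (\<lambda>z. f z - g z) + Qp_norm p (\<lambda>z. h z - g z)"
    unfolding Qp_norm_def using *
    by (subst enn2real_plus[symmetric]) (auto intro!: enn2real_mono)
  then show "Qp_dist p f h \<le> Qp_dist p f g + Qp_dist p g h"
    by (simp add: Qp_dist_def Qp_norm_def Qp_enorm_minus_commute[of p g h])
qed

end

theory Submission
  imports Defs
begin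

text \<open>
  Write \<open>E f w = Qp_energy p f w\<close> for the integral inside the supremum of the norm and
  \<open>\<sigma>\<^sub>w = disc_aut w\<close>. The operators are understood through their derivatives,
  \<open>(V\<^sub>g f)' = g' f\<close>, \<open>(U\<^sub>g f)' = g f'\<close> and \<open>(M\<^sub>g f)' = g' f + g f'\<close>, so that \<open>E (V\<^sub>g f) w\<close> is the
  integral of \<open>\<bar>f\<bar>\<^sup>2\<close> times the \<open>p\<close>-th power of the Poisson-type kernel
  \<open>(1 - \<bar>w\<bar>\<^sup>2) / \<bar>1 - cnj w * z\<bar>\<^sup>2\<close> against the measure \<open>\<mu>\<close> attached to \<open>g\<close>. The statements about
  \<open>V\<^sub>g\<close> are therefore about the embedding of the space into \<open>L\<^sup>2\<close> spaces of \<open>\<mu>\<close>, uniformly in \<open>w\<close>.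

  The sufficiency of the Carleson condition is \<open>log_carleson_embedding\<close>. Split \<open>f = f w + (f - f w)\<close>.
  The constant grows at most like \<open>ln (2 / (1 - \<bar>w\<bar>))\<close> (\<open>growth_estimate\<close>), and the square of this
  logarithm is exactly what the Carleson condition gains when the kernel is integrated
  (\<open>log_carleson_poisson\<close>). The remainder vanishes at \<open>w\<close>; after the substitution \<open>\<sigma>\<^sub>w\<close>
  its energy at \<open>w\<close> becomes the energy at \<open>0\<close> (\<open>Qp_energy_conformal\<close>), and for
  functions vanishing at \<open>0\<close> the energy at \<open>0\<close> dominates \<open>L\<^sup>2(M)\<close> as soon as
  \<open>\<integral> \<bar>1 - cnj a * z\<bar> powr (-p) dM\<close> is bounded in \<open>a\<close> (\<open>dirichlet_embedding\<close>). This last fact is a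
  duality argument: the monomials are orthogonal for radial weights, so the energy is a weighted
  sum of \<open>\<bar>a\<^sub>n\<bar>\<^sup>2\<close> comparable to the one whose reproducing kernel is \<open>(1 - z * cnj u) powr (-p)\<close>,
  and Schur's test bounds the integral operator with that kernel. That the kernel condition holds
  for a logarithmic Carleson measure is a sum over dyadic shells whose terms decay like
  \<open>1 / k\<^sup>2\<close> (\<open>log_carleson_kernel\<close>), and the condition survives the substitution
  (\<open>poisson_kernel_transform\<close>).

  All necessity statements come from one family of functions, the squared logarithms
  \<open>test_fn w = (ln 100 - Ln (1 - cnj w * z))\<^sup>2 / log_size w\<close>. Their norms are bounded (\<open>test_fn_Qp\<close>,
  because the energy of \<open>Ln (1 - cnj w * z)\<close> is bounded, \<open>log_kernel\<close>), on the Carleson square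
  over an arc of length \<open>1 - \<bar>w\<bar>\<close> containing \<open>w / \<bar>w\<bar>\<close> they are at least a multiple of the logarithm (\<open>norm_test_fn_ge\<close>), at \<open>w\<close> the value
  is \<open>log_size w\<close> and the derivative has modulus \<open>2 * \<bar>w\<bar> / (1 - \<bar>w\<bar>\<^sup>2)\<close>, and they tend to \<open>0\<close>
  locally uniformly as \<open>\<bar>w\<bar> \<rightarrow> 1\<close>. Applying \<open>V\<^sub>g\<close> gives the Carleson condition (\<open>V_op_lower\<close>); applying
  \<open>U\<^sub>g\<close> or \<open>M\<^sub>g\<close> and comparing with the Bloch and growth estimates bounds \<open>\<bar>g w\<bar>\<close> by the norm of the
  image (\<open>U_op_lower\<close>, \<open>M_op_lower\<close>). For a compact operator the images of these functions tend to
  \<open>0\<close> in norm (\<open>compact_test_fn_null\<close>), so the same inequalities give the vanishing condition for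
  \<open>V\<^sub>g\<close>, and for \<open>U\<^sub>g\<close> and \<open>M\<^sub>g\<close> they show that \<open>g\<close> tends to \<open>0\<close> at the unit circle, whence \<open>g = 0\<close>
  by the maximum principle.

  Conversely, under the vanishing condition the part of the measure outside a large disc satisfies
  the Carleson condition with a small constant (\<open>vanishing_outer_part\<close>), while inside that disc
  bounded sequences have uniformly convergent subsequences by Montel's theorem
  (\<open>Qp_bounded_sequence_subseq\<close>); together this makes \<open>V\<^sub>g\<close> compact. Finally
  \<open>M\<^sub>g f = V\<^sub>g f + U\<^sub>g f\<close> up to a constant, so boundedness of \<open>M\<^sub>g\<close> reduces to that of \<open>V\<^sub>g\<close> and \<open>U\<^sub>g\<close> once
  \<open>g\<close> is known to be bounded.
\<close>

section \<open>The area formula for holomorphic maps\<close>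

text \<open>
  The transformation formula and its determinants belong to \<^typ>\<open>real^2\<close>; this isometry and its
  inverse carry them to the complex plane.
\<close>

definition vec2c :: "real^2 \<Rightarrow> complex" where
  "vec2c x = Complex (x $ 1) (x $ 2)"

definition c2vec :: "complex \<Rightarrow> real^2" where
  "c2vec z = vector [Re z, Im z]"

lemma vec2c_c2vec [simp]: "vec2c (c2vec z) = z"
  by (simp add: vec2c_def c2vec_def)

lemma c2vec_vec2c [simp]: "c2vec (vec2c x) = x"
  by (simp add: vec2c_def c2vec_def vec_eq_iff forall_2)

lemma bounded_linear_vec2c: "bounded_linear vec2c"
  by (unfold linear_conv_bounded_linear[symmetric])
     (auto intro!: linearI simp: vec2c_def complex_eq_iff)

lemma bounded_linear_c2vec: "bounded_linear c2vec"
  by (unfold linear_conv_bounded_linear[symmetric])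
     (auto intro!: linearI simp: c2vec_def vec_eq_iff forall_2)

lemma vec2c_measurable [measurable]: "vec2c \<in> borel_measurable borel"
  using bounded_linear_vec2c by (intro borel_measurable_continuous_onI linear_continuous_on)

lemma c2vec_measurable [measurable]: "c2vec \<in> borel_measurable borel"
  using bounded_linear_c2vec by (intro borel_measurable_continuous_onI linear_continuous_on)

lemma Basis_real2: "(Basis :: (real^2) set) = {axis 1 1, axis 2 1}"
  by (auto simp: Basis_vec_def) (metis exhaust_2)

lemma axis_real2_distinct: "axis 1 1 \<noteq> (axis 2 1 :: real^2)"
  by (simp add: axis_eq_axis)

lemma lborel_complex_eq_distr_vec2c: "(lborel :: complex measure) = distr lborel borel vec2c"
proof (rule lborel_eqI)
  fix l u :: complex
  assume le: "\<And>b. b \<in> Basis \<Longrightarrow> l \<bullet> b \<le> u \<bullet> b"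
  have lu: "Re l \<le> Re u" "Im l \<le> Im u"
    using le[of 1] le[of \<i>] by (auto simp: Basis_complex_def)
  have eq: "vec2c -` box l u = box (c2vec l) (c2vec u)"
    by (auto simp: vec2c_def c2vec_def in_box_complex_iff mem_box_cart forall_2)
  have "emeasure (distr lborel borel vec2c) (box l u) = emeasure lborel (vec2c -` box l u)"
    by (subst emeasure_distr) auto
  also have "\<dots> = ennreal (\<Prod>b\<in>Basis. (c2vec u - c2vec l) \<bullet> b)"
    unfolding eq by (rule emeasure_lborel_box)
       (use lu in \<open>auto simp: Basis_real2 c2vec_def inner_axis\<close>)
  also have "(\<Prod>b\<in>Basis. (c2vec u - c2vec l) \<bullet> b) = (\<Prod>b\<in>Basis. (u - l) \<bullet> b)"
    using axis_real2_distinct by (simp add: Basis_real2 Basis_complex_def inner_axis c2vec_def)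
  finally show "emeasure (distr lborel borel vec2c) (box l u) = (\<Prod>b\<in>Basis. (u - l) \<bullet> b)" .
qed simp

text \<open>
  Read as a real linear map of the plane, multiplication by \<open>f' z\<close> has determinant \<open>\<bar>f' z\<bar>\<^sup>2\<close>, so
  this is the area formula for an injective differentiable map.
\<close>

lemma emeasure_image_complex:
  fixes f f' :: "complex \<Rightarrow> complex"
  assumes A: "A \<in> sets borel" and fA: "f ` A \<in> sets borel" and bd: "bounded (f ` A)"
    and inj: "inj_on f A"
    and der: "\<And>z. z \<in> A \<Longrightarrow> (f has_field_derivative f' z) (at z)"
    and f' [measurable]: "f' \<in> borel_measurable borel"
  shows "(\<integral>\<^sup>+z\<in>A. ennreal ((cmod (f' z))\<^sup>2) \<partial>lborel) = emeasure lborel (f ` A)"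
proof -
  define B where "B = vec2c -` A"
  define F where "F = c2vec \<circ> f \<circ> vec2c"
  define F' where "F' = (\<lambda>x h. c2vec (f' (vec2c x) * vec2c h))"
  have B[measurable]: "B \<in> sets borel"
    unfolding B_def using measurable_sets[OF vec2c_measurable A] by simp
  have der_F: "(F has_derivative F' x) (at x within B)" if "x \<in> B" for x
  proof -
    have d: "(f has_derivative (*) (f' (vec2c x))) (at (vec2c x))"
      using der[of "vec2c x"] that unfolding B_def has_field_derivative_def by auto
    have "((c2vec \<circ> (f \<circ> vec2c)) has_derivative (c2vec \<circ> ((*) (f' (vec2c x)) \<circ> vec2c))) (at x)"
      by (intro diff_chain_at d bounded_linear_imp_has_derivative bounded_linear_vec2c bounded_linear_c2vec)
    then show ?thesis unfolding F_def F'_def by (simp add: o_def has_derivative_at_withinI)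
  qed
  have inj_F: "inj_on F B"
    using inj unfolding inj_on_def F_def B_def by (metis c2vec_vec2c comp_apply vec2c_c2vec vimage_eq)
  have det: "\<bar>det (matrix (F' x))\<bar> = (cmod (f' (vec2c x)))\<^sup>2" for x
    unfolding cmod_power2
    by (simp add: det_2 matrix_def F'_def c2vec_def vec2c_def axis_def power2_eq_square)
  have "F ` B = c2vec ` (f ` A)"
  proof -
    have "vec2c ` B = A"
      unfolding B_def by (rule surj_image_vimage_eq[OF surjI[of vec2c c2vec]]) simp
    then show ?thesis unfolding F_def image_comp[symmetric] by simp
  qed
  moreover have "c2vec ` X = vec2c -` X" for X
  proof
    show "vec2c -` X \<subseteq> c2vec ` X"
      by (metis c2vec_vec2c imageI subsetI vimageD)
  qed auto
  ultimately have FB: "F ` B = vec2c -` (f ` A)" by simp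
  have FBm: "F ` B \<in> sets borel"
    unfolding FB using measurable_sets[OF vec2c_measurable fA] by simp
  have "bounded (F ` B)"
    unfolding \<open>F ` B = c2vec ` (f ` A)\<close>
    using bounded_linear_image[OF bd bounded_linear_c2vec] .
  then have lm: "F ` B \<in> lmeasurable"
    using FBm by (intro bounded_set_imp_lmeasurable) auto
  have hi: "((\<lambda>x. (cmod (f' (vec2c x)))\<^sup>2) has_integral (measure lebesgue (F ` B))) B"
    using has_measure_differentiable_image[OF _ der_F inj_F, of "measure lebesgue (F ` B)"] lm B
    unfolding det by simp
  have "(\<integral>\<^sup>+z\<in>A. ennreal ((cmod (f' z))\<^sup>2) \<partial>lborel)
      = (\<integral>\<^sup>+x. ennreal ((cmod (f' (vec2c x)))\<^sup>2) * indicator A (vec2c x) \<partial>lborel)"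
    by (subst lborel_complex_eq_distr_vec2c, subst nn_integral_distr) (use A in auto)
  also have "\<dots> = (\<integral>\<^sup>+x. ennreal ((cmod (f' (vec2c x)))\<^sup>2) * indicator B x \<partial>lborel)"
    by (simp add: B_def indicator_def)
  also have "\<dots> = ennreal (measure lebesgue (F ` B))"
    by (rule nn_integral_has_integral_lebesgue'[OF _ hi]) simp
  also have "\<dots> = emeasure lborel (F ` B)"
  proof -
    have "emeasure lebesgue (F ` B) = ennreal (measure lebesgue (F ` B))"
      by (rule emeasure_eq_ennreal_measure) (use fmeasurableD2[OF lm] in auto)
    moreover have "emeasure lebesgue (F ` B) = emeasure lborel (F ` B)"
      using FBm by simp
    ultimately show ?thesis by simp
  qed
  also have "\<dots> = emeasure lborel (f ` A)"
    unfolding FB using emeasure_distr[OF _ fA, of vec2c lborel]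
    by (simp flip: lborel_complex_eq_distr_vec2c)
  finally show ?thesis .
qed

text \<open>
  The area formula says that the push-forward of \<open>\<bar>f'\<bar>\<^sup>2\<close> times area under the bijection \<open>f\<close> of \<open>D\<close>
  is area on \<open>D\<close>.
\<close>

lemma nn_integral_substitution_complex:
  fixes f f' k :: "complex \<Rightarrow> complex" and F :: "complex \<Rightarrow> ennreal"
  assumes D [measurable]: "D \<in> sets borel" and bd: "bounded D"
    and f [measurable]: "f \<in> borel_measurable borel" and k [measurable]: "k \<in> borel_measurable borel"
    and f' [measurable]: "f' \<in> borel_measurable borel"
    and fD: "\<And>z. z \<in> D \<Longrightarrow> f z \<in> D" and kD: "\<And>z. z \<in> D \<Longrightarrow> k z \<in> D"
    and kf: "\<And>z. z \<in> D \<Longrightarrow> k (f z) = z" and fk: "\<And>z. z \<in> D \<Longrightarrow> f (k z) = z"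
    and der: "\<And>z. z \<in> D \<Longrightarrow> (f has_field_derivative f' z) (at z)"
    and F [measurable]: "F \<in> borel_measurable borel"
  shows "(\<integral>\<^sup>+z\<in>D. F z \<partial>lborel) = (\<integral>\<^sup>+z\<in>D. F (f z) * ennreal ((cmod (f' z))\<^sup>2) \<partial>lborel)"
proof -
  have eq: "density lborel (indicator D) =
      distr (density lborel (\<lambda>z. indicator D z * ennreal ((cmod (f' z))\<^sup>2))) borel f" (is "?M = ?N")
  proof (rule measure_eqI)
    fix B assume "B \<in> sets ?M"
    then have B [measurable]: "B \<in> sets borel" by simp
    define A where "A = {z \<in> D. f z \<in> B}"
    have A [measurable]: "A \<in> sets borel" unfolding A_def by measurable
    have fA: "f ` A = B \<inter> D" unfolding A_def using fD kD fk by (force simp: image_iff)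
    have "emeasure ?N B = (\<integral>\<^sup>+z. indicator D z * ennreal ((cmod (f' z))\<^sup>2) * indicator (f -` B) z \<partial>lborel)"
      by (subst emeasure_distr, simp, simp, subst emeasure_density) (use measurable_sets_borel[OF f B] in auto)
    also have "\<dots> = (\<integral>\<^sup>+z\<in>A. ennreal ((cmod (f' z))\<^sup>2) \<partial>lborel)"
      by (intro nn_integral_cong) (auto simp: A_def split: split_indicator)
    also have "\<dots> = emeasure lborel (f ` A)"
      by (rule emeasure_image_complex[OF A _ _ _ der])
         (auto simp: fA intro: bounded_subset[OF bd] inj_on_inverseI[where g=k] kf, auto simp: A_def intro!: inj_on_inverseI[where g=k] kf)
    also have "\<dots> = emeasure ?M B"
      unfolding fA by (subst emeasure_density) (auto simp: indicator_inter_arith[symmetric] Int_commute)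
    finally show "emeasure ?M B = emeasure ?N B" by simp
  qed simp
  have "(\<integral>\<^sup>+z\<in>D. F z \<partial>lborel) = (\<integral>\<^sup>+z. F z \<partial>?M)"
    by (subst nn_integral_density) (auto simp: mult.commute)
  also have "\<dots> = (\<integral>\<^sup>+z. F (f z) \<partial>density lborel (\<lambda>z. indicator D z * ennreal ((cmod (f' z))\<^sup>2)))"
    unfolding eq by (subst nn_integral_distr) auto
  also have "\<dots> = (\<integral>\<^sup>+z\<in>D. F (f z) * ennreal ((cmod (f' z))\<^sup>2) \<partial>lborel)"
    by (subst nn_integral_density) (auto simp: mult_ac)
  finally show ?thesis .
qed

section \<open>Disc automorphisms and the conformal invariance of the energy\<close>

text \<open>
  The weight of the energy at \<open>w\<close> is the weight at \<open>0\<close> multiplied by a Poisson-type kernel; this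
  identity is the source of all later computations with the energy.
\<close>

lemma disc_aut_compl:
  assumes w: "w \<in> unit_disc" and z: "z \<in> unit_disc"
  shows "1 - (cmod (disc_aut w z))\<^sup>2 = (1 - (cmod w)\<^sup>2) * (1 - (cmod z)\<^sup>2) / (cmod (1 - cnj w * z))\<^sup>2"
proof -
  have "(cmod (1 - cnj w * z))\<^sup>2 - (cmod (w - z))\<^sup>2 = (1 - (cmod w)\<^sup>2) * (1 - (cmod z)\<^sup>2)"
    unfolding cmod_power2 by (simp add: algebra_simps power2_eq_square)
  moreover have "cmod (1 - cnj w * z) \<noteq> 0" using disc_aut_denominator[OF w z] by simp
  ultimately show ?thesis
    by (simp add: disc_aut_def norm_divide power_divide field_simps)
qed

lemma disc_aut_in_disc: "w \<in> unit_disc \<Longrightarrow> z \<in> unit_disc \<Longrightarrow> disc_aut w z \<in> unit_disc"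
  using disc_aut_lt_1 by simp

text \<open>
  The factor \<open>1 - cnj a * z\<close> transforms into a factor of the same kind, based at \<open>\<sigma>\<^sub>w a\<close>. Every kernel
  below is built from such factors, so this governs their behaviour under automorphisms.
\<close>

lemma one_minus_cnj_disc_aut:
  assumes w: "w \<in> unit_disc" and z: "z \<in> unit_disc" and a: "a \<in> unit_disc"
  shows "1 - cnj a * disc_aut w z = (1 - cnj a * w) * (1 - cnj (disc_aut w a) * z) / (1 - cnj w * z)"
proof -
  have "1 - cnj w * z \<noteq> 0" "1 - cnj a * w \<noteq> 0" "1 - cnj w * a \<noteq> 0"
    using w z a disc_aut_denominator by blast+
  then have nz: "1 - cnj w * z \<noteq> 0" "1 - w * cnj a \<noteq> 0" by (auto simp: mult.commute)
  have "(1 - w * cnj a) * (1 - cnj (disc_aut w a) * z) = (1 - w * cnj a) - (cnj w - cnj a) * z"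
    using nz(2) by (simp add: disc_aut_def right_diff_distrib)
  also have "\<dots> = (1 - cnj w * z) - cnj a * (w - z)" by (simp add: algebra_simps)
  finally have "(1 - cnj a * w) * (1 - cnj (disc_aut w a) * z) / (1 - cnj w * z) =
      ((1 - cnj w * z) - cnj a * (w - z)) / (1 - cnj w * z)" by (simp add: mult.commute)
  also have "\<dots> = 1 - cnj a * disc_aut w z"
    using nz(1) unfolding disc_aut_def by (subst diff_divide_distrib) simp
  finally show ?thesis by simp
qed

lemma disc_aut_self [simp]: "disc_aut w w = 0"
  by (simp add: disc_aut_def)

lemma disc_aut_0 [simp]: "disc_aut w 0 = w" "disc_aut 0 z = - z"
  by (simp_all add: disc_aut_def)

lemma disc_aut_involution:
  assumes w: "w \<in> unit_disc" and z: "z \<in> unit_disc"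
  shows "disc_aut w (disc_aut w z) = z"
proof -
  have nz: "1 - cnj w * z \<noteq> 0" "1 - cnj w * w \<noteq> 0"
    using w z disc_aut_denominator by blast+
  have "1 - cnj w * disc_aut w z = (1 - cnj w * w) / (1 - cnj w * z)"
    using one_minus_cnj_disc_aut[OF w z w] by simp
  moreover have "w - disc_aut w z = z * (1 - cnj w * w) / (1 - cnj w * z)"
    using nz by (simp add: disc_aut_def field_simps)
  ultimately show ?thesis
    using nz unfolding disc_aut_def[of w "disc_aut w z"] by simp
qed

lemma disc_aut_has_field_derivative:
  assumes w: "w \<in> unit_disc" and z: "z \<in> unit_disc"
  shows "(disc_aut w has_field_derivative (- (1 - cnj w * w) / (1 - cnj w * z)\<^sup>2)) (at z)"
  unfolding disc_aut_def using disc_aut_denominator[OF w z]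
  by (auto intro!: derivative_eq_intros simp: field_simps power2_eq_square)

lemma disc_aut_holomorphic: "w \<in> unit_disc \<Longrightarrow> disc_aut w holomorphic_on unit_disc"
  unfolding holomorphic_on_open[OF open_ball] using disc_aut_has_field_derivative by blast

lemma disc_aut_measurable [measurable]: "disc_aut w \<in> borel_measurable borel"
  unfolding disc_aut_def by measurable

lemma norm_one_minus_cnj_mult_self:
  "w \<in> unit_disc \<Longrightarrow> cmod (1 - cnj w * w) = 1 - (cmod w)\<^sup>2"
proof -
  assume "w \<in> unit_disc"
  then have "(cmod w)\<^sup>2 < 1" by (simp add: power_less_one_iff)
  moreover have "1 - cnj w * w = of_real (1 - (cmod w)\<^sup>2)"
    using complex_norm_square[of w] by (simp add: mult.commute)
  ultimately show ?thesis by (simp only: norm_of_real abs_of_pos diff_gt_0_iff_gt)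
qed

lemma nn_integral_disc_aut:
  assumes w: "w \<in> unit_disc" and F: "(\<lambda>z. F z * indicator unit_disc z) \<in> borel_measurable borel"
  shows "(\<integral>\<^sup>+z\<in>unit_disc. F z \<partial>lborel) =
    (\<integral>\<^sup>+z\<in>unit_disc. F (disc_aut w z) * ennreal (((1 - (cmod w)\<^sup>2) / (cmod (1 - cnj w * z))\<^sup>2)\<^sup>2) \<partial>lborel)"
proof -
  let ?G = "\<lambda>z. F z * indicator unit_disc z"
  have "(\<integral>\<^sup>+z\<in>unit_disc. F z \<partial>lborel) = (\<integral>\<^sup>+z\<in>unit_disc. ?G z \<partial>lborel)"
    by (intro nn_integral_cong) (auto split: split_indicator)
  also have "\<dots> = (\<integral>\<^sup>+z\<in>unit_disc. ?G (disc_aut w z) *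
     ennreal ((cmod (- (1 - cnj w * w) / (1 - cnj w * z)\<^sup>2))\<^sup>2) \<partial>lborel)"
    by (rule nn_integral_substitution_complex[where k = "disc_aut w"])
       (use w F disc_aut_in_disc disc_aut_has_field_derivative disc_aut_involution in auto)
  also have "\<dots> = (\<integral>\<^sup>+z\<in>unit_disc. F (disc_aut w z) * ennreal (((1 - (cmod w)\<^sup>2) / (cmod (1 - cnj w * z))\<^sup>2)\<^sup>2) \<partial>lborel)"
    using disc_aut_in_disc[OF w] norm_one_minus_cnj_mult_self[OF w]
    by (intro nn_integral_cong)
       (auto split: split_indicator simp: norm_divide norm_power norm_minus_commute)
  finally show ?thesis .
qed

lemma holomorphic_comp_disc_aut:
  assumes "f holomorphic_on unit_disc" "w \<in> unit_disc"
  shows "(\<lambda>z. f (disc_aut w z)) holomorphic_on unit_disc"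
  using holomorphic_on_compose_gen[OF disc_aut_holomorphic[OF assms(2)] assms(1)] assms(2) disc_aut_in_disc
  by (auto simp: o_def image_subset_iff)

lemma deriv_comp_disc_aut:
  assumes f: "f holomorphic_on unit_disc" and w: "w \<in> unit_disc" and z: "z \<in> unit_disc"
  shows "deriv (\<lambda>z. f (disc_aut w z)) z =
    deriv f (disc_aut w z) * (- (1 - cnj w * w) / (1 - cnj w * z)\<^sup>2)"
  by (intro DERIV_imp_deriv DERIV_chain2[OF _ disc_aut_has_field_derivative[OF w z]]
      holomorphic_derivI[OF f open_ball disc_aut_in_disc[OF w z]])

text \<open>
  The substitution \<open>\<sigma>\<^sub>w\<close> absorbs its Jacobian into \<open>\<bar>(f \<circ> \<sigma>\<^sub>w)'\<bar>\<^sup>2\<close> and turns the weight at \<open>w\<close> into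
  the radial one, since \<open>\<sigma>\<^sub>w\<close> is an involution.
\<close>

lemma Qp_energy_conformal:
  assumes f: "f holomorphic_on unit_disc" and w: "w \<in> unit_disc"
  shows "Qp_energy p f w = Qp_energy p (\<lambda>z. f (disc_aut w z)) 0"
proof -
  have "Qp_energy p f w = (\<integral>\<^sup>+z\<in>unit_disc. ennreal ((cmod (deriv f (disc_aut w z)))\<^sup>2 *
      (1 - (cmod (disc_aut w (disc_aut w z)))\<^sup>2) powr p) *
      ennreal (((1 - (cmod w)\<^sup>2) / (cmod (1 - cnj w * z))\<^sup>2)\<^sup>2) \<partial>lborel)"
    unfolding Qp_energy_def
    by (rule nn_integral_disc_aut[OF w]) (use Qp_integrand_measurable[OF f w, of p] in simp)
  also have "\<dots> = Qp_energy p (\<lambda>z. f (disc_aut w z)) 0"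
    unfolding Qp_energy_def
  proof (intro nn_integral_cong)
    fix z
    show "ennreal ((cmod (deriv f (disc_aut w z)))\<^sup>2 * (1 - (cmod (disc_aut w (disc_aut w z)))\<^sup>2) powr p) *
         ennreal (((1 - (cmod w)\<^sup>2) / (cmod (1 - cnj w * z))\<^sup>2)\<^sup>2) * indicator unit_disc z =
         ennreal ((cmod (deriv (\<lambda>z. f (disc_aut w z)) z))\<^sup>2 * (1 - (cmod (disc_aut 0 z))\<^sup>2) powr p) *
         indicator unit_disc z"
    proof (cases "z \<in> unit_disc")
      case z: True
      show ?thesis
        using z disc_aut_involution[OF w z] norm_one_minus_cnj_mult_self[OF w]
        by (simp add: deriv_comp_disc_aut[OF f w z] norm_mult norm_divide norm_power
            power_mult_distrib power_divide norm_minus_commute mult_ac flip: ennreal_mult)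
    qed auto
  qed
  finally show ?thesis .
qed

lemma Qp_energy_0: "Qp_energy p f 0 =
   (\<integral>\<^sup>+z\<in>unit_disc. ennreal ((cmod (deriv f z))\<^sup>2 * (1 - (cmod z)\<^sup>2) powr p) \<partial>lborel)"
  by (simp add: Qp_energy_def)

lemma nn_integral_disc_rotation:
  assumes c: "cmod c = 1" and F: "F \<in> borel_measurable borel"
  shows "(\<integral>\<^sup>+z\<in>unit_disc. F (c * z) \<partial>lborel) = (\<integral>\<^sup>+z\<in>unit_disc. F z \<partial>lborel)"
proof -
  have cc: "c * cnj c = 1" using c by (simp add: complex_norm_square[symmetric])
  have "(\<integral>\<^sup>+z\<in>unit_disc. F z \<partial>lborel) = (\<integral>\<^sup>+z\<in>unit_disc. F (c * z) * ennreal ((cmod c)\<^sup>2) \<partial>lborel)"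
    by (rule nn_integral_substitution_complex[where k = "\<lambda>z. cnj c * z" and f' = "\<lambda>_. c"])
       (use c F cc in \<open>auto simp: norm_mult mult.assoc[symmetric] mult.commute[of "cnj c" c] intro!: derivative_eq_intros\<close>)
  then show ?thesis using c by simp
qed

text \<open>
  The map \<open>z \<mapsto> \<bar>z\<bar>\<^sup>2\<close> sends area on the disc to \<open>\<pi>\<close> times length on the unit interval: both measures
  give \<open>\<pi> * (1 - x)\<close> to the part above \<open>x\<close>.
\<close>

lemma nn_integral_disc_radial:
  assumes \<psi> [measurable]: "\<psi> \<in> borel_measurable borel"
  shows "(\<integral>\<^sup>+z\<in>unit_disc. \<psi> ((cmod z)\<^sup>2) \<partial>lborel) = ennreal pi * (\<integral>\<^sup>+t\<in>{0..1}. \<psi> t \<partial>lborel)"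
proof -
  have vol: "emeasure lborel (cball (0::complex) r) = ennreal (pi * r\<^sup>2)"
      "emeasure lborel (ball (0::complex) r) = ennreal (pi * r\<^sup>2)" if "0 \<le> r" for r
    using that by (simp_all add: emeasure_ball emeasure_cball unit_ball_vol_2)
  have "distr (density lborel (indicator unit_disc)) borel (\<lambda>z. (cmod z)\<^sup>2) =
      density lborel (\<lambda>t. ennreal pi * indicator {0..1} t)" (is "?M = ?N")
  proof (rule measure_eqI_lessThan)
    show "emeasure ?M {x<..} = emeasure ?N {x<..}" for x
    proof -
      have "emeasure ?M {x<..} = (\<integral>\<^sup>+z. indicator unit_disc z * indicator ((\<lambda>z. (cmod z)\<^sup>2) -` {x<..}) z \<partial>lborel)"
        by (subst emeasure_distr, simp, simp, subst emeasure_density) (auto intro!: measurable_sets_borel[of _ borel] borel_measurable_indicator)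
      also have "\<dots> = (\<integral>\<^sup>+z. indicator {z\<in>unit_disc. (cmod z)\<^sup>2 > x} z \<partial>lborel)"
        by (intro nn_integral_cong) (auto split: split_indicator)
      also have "\<dots> = emeasure lborel {z\<in>unit_disc. (cmod z)\<^sup>2 > x}"
        by (rule nn_integral_indicator) measurable
      also have "\<dots> = ennreal pi * emeasure lborel ({0..1} \<inter> {x<..})"
      proof -
        consider "x < 0" | "0 \<le> x" "x < 1" | "x \<ge> 1" by linarith
        then show ?thesis
        proof cases
          case 1
          then have "{z\<in>unit_disc. (cmod z)\<^sup>2 > x} = ball 0 1" "{0..1} \<inter> {x<..} = {0..1}"
            by (auto intro: less_le_trans)
          then show ?thesis using vol(2)[of 1] by simp
        next
          case 2
          have *: "sqrt x < cmod z \<longleftrightarrow> x < (cmod z)\<^sup>2" for z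
            using 2 by (metis norm_ge_zero real_sqrt_less_iff real_sqrt_unique)
          have "{z\<in>unit_disc. (cmod z)\<^sup>2 > x} = ball 0 1 - cball 0 (sqrt x)"
            by (auto simp: *[symmetric] not_le)
          moreover have "emeasure lborel (ball (0::complex) 1 - cball 0 (sqrt x)) =
              emeasure lborel (ball (0::complex) 1) - emeasure lborel (cball (0::complex) (sqrt x))"
            using 2 order.strict_trans1[OF _ real_sqrt_lt_1_iff[THEN iffD2, of x]]
            by (intro emeasure_Diff) (auto simp: vol)
          moreover have "\<dots> = ennreal (pi * (1 - x))"
            using 2 by (simp add: vol ennreal_minus algebra_simps)
          moreover have "{0..1} \<inter> {x<..} = {x<..1}" using 2 by auto
          ultimately show ?thesis using 2 by (simp add: ennreal_mult)
        next
          case 3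
          have "{z\<in>unit_disc. (cmod z)\<^sup>2 > x} = {}"
            using 3 abs_square_less_1[of "cmod z" for z] by force
          moreover have "{0..1} \<inter> {x<..} = {}" using 3 by auto
          ultimately show ?thesis by (simp only: emeasure_empty mult_zero_right)
        qed
      qed
      also have "\<dots> = emeasure ?N {x<..}"
        by (subst emeasure_density) (auto simp: mult.assoc nn_integral_cmult indicator_inter_arith[symmetric])
      finally show ?thesis .
    qed
    have "emeasure ?N {x<..} < \<infinity>" for x
    proof -
      have "emeasure ?N {x<..} \<le> emeasure ?N UNIV" by (rule emeasure_mono) auto
      also have "\<dots> = ennreal pi"
        by (subst emeasure_density) (auto simp: nn_integral_cmult)
      finally show ?thesis using order.strict_trans1 ennreal_less_top by fastforce
    qed
    with \<open>\<And>x. emeasure ?M {x<..} = emeasure ?N {x<..}\<close> show "emeasure ?M {x<..} < \<infinity>" for x by simp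
  qed auto
  then have "(\<integral>\<^sup>+t. \<psi> t \<partial>?M) = (\<integral>\<^sup>+t. \<psi> t \<partial>?N)" by simp
  moreover have "(\<integral>\<^sup>+t. \<psi> t \<partial>?M) = (\<integral>\<^sup>+z\<in>unit_disc. \<psi> ((cmod z)\<^sup>2) \<partial>lborel)"
    by (subst nn_integral_distr, simp, simp, subst nn_integral_density)
       (auto simp: mult.commute intro!: borel_measurable_indicator)
  moreover have "(\<integral>\<^sup>+t. \<psi> t \<partial>?N) = ennreal pi * (\<integral>\<^sup>+t\<in>{0..1}. \<psi> t \<partial>lborel)"
    by (subst nn_integral_density, simp, simp, subst nn_integral_cmult[symmetric]) (auto simp: mult_ac)
  ultimately show ?thesis by simp
qed

section \<open>Orthogonality of monomials for radial weights\<close>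

lemma unit_disc_borel [measurable]: "unit_disc \<in> sets borel"
  by simp

lemma cnj_borel_measurable [measurable]: "cnj \<in> borel_measurable borel"
  by (intro borel_measurable_continuous_onI continuous_intros)

text \<open>
  The measure is invariant under rotations, and the rotation by the angle \<open>\<pi> / (j - k)\<close> changes the
  sign of the integrand.
\<close>

lemma rotation_orthogonality:
  fixes \<phi> :: "real \<Rightarrow> real"
  assumes \<phi> [measurable]: "\<phi> \<in> borel_measurable borel" and jk: "j \<noteq> k"
  defines "N \<equiv> density lborel (\<lambda>z::complex. ennreal (\<phi> (cmod z)) * indicator unit_disc z)"
  shows "(\<integral>z. z ^ j * cnj z ^ k \<partial>N) = 0"
proof -
  define c where "c = cis (pi / (real j - real k))"
  have c1: "cmod c = 1" by (simp add: c_def)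
  have "c ^ j = cis (real j * (pi / (real j - real k)))"
    by (simp only: c_def Complex.DeMoivre)
  moreover have "cnj c ^ k = cis (- (real k * (pi / (real j - real k))))"
    by (simp only: c_def cis_cnj Complex.DeMoivre mult_minus_right)
  ultimately have "c ^ j * cnj c ^ k =
      cis (real j * (pi / (real j - real k)) - real k * (pi / (real j - real k)))"
    by (simp only: cis_mult diff_conv_add_uminus)
  also have "real j * (pi / (real j - real k)) - real k * (pi / (real j - real k)) = pi"
    using jk by (simp add: left_diff_distrib[symmetric] diff_divide_distrib[symmetric])
  finally have cjk: "c ^ j * cnj c ^ k = -1" by simp
  have inv: "distr N borel ((*) c) = N"
  proof (rule measure_eqI)
    fix B assume "B \<in> sets (distr N borel ((*) c))"
    then have B [measurable]: "B \<in> sets borel" by simp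
    have [measurable]: "(*) c -` B \<in> sets borel"
      by (rule measurable_sets_borel[OF _ B]) simp
    have "emeasure (distr N borel ((*) c)) B =
      (\<integral>\<^sup>+z\<in>unit_disc. ennreal (\<phi> (cmod (c * z))) * indicator B (c * z) \<partial>lborel)"
      by (subst emeasure_distr, simp add: N_def, simp, unfold N_def, subst emeasure_density)
         (auto intro!: nn_integral_cong simp: norm_mult c1 split: split_indicator)
    also have "\<dots> = (\<integral>\<^sup>+z\<in>unit_disc. ennreal (\<phi> (cmod z)) * indicator B z \<partial>lborel)"
      by (rule nn_integral_disc_rotation[OF c1]) measurable
    also have "\<dots> = emeasure N B"
      unfolding N_def by (subst emeasure_density) (auto intro!: nn_integral_cong split: split_indicator)
    finally show "emeasure (distr N borel ((*) c)) B = emeasure N B" .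
  qed (simp add: N_def)
  have "(\<integral>z. z ^ j * cnj z ^ k \<partial>N) = (\<integral>z. z ^ j * cnj z ^ k \<partial>distr N borel ((*) c))"
    by (simp only: inv)
  also have "\<dots> = (\<integral>z. (c * z) ^ j * cnj (c * z) ^ k \<partial>N)"
    by (rule integral_distr) (simp_all add: N_def)
  also have "\<dots> = (\<integral>z. (c ^ j * cnj c ^ k) * (z ^ j * cnj z ^ k) \<partial>N)"
    by (simp add: power_mult_distrib mult_ac)
  also have "\<dots> = - (\<integral>z. z ^ j * cnj z ^ k \<partial>N)"
    by (simp only: cjk integral_minus mult_minus_left mult_1)
  finally show ?thesis by (simp add: equation_minus_iff)
qed

lemma nn_integral_norm_polynomial_sq:
  fixes \<phi> :: "real \<Rightarrow> real" and a :: "nat \<Rightarrow> complex"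
  assumes \<phi> [measurable]: "\<phi> \<in> borel_measurable borel"
    and nonneg: "\<And>r. 0 \<le> \<phi> r" and le1: "\<And>r. 0 \<le> r \<Longrightarrow> r < 1 \<Longrightarrow> \<phi> r \<le> 1"
  shows "(\<integral>\<^sup>+z\<in>unit_disc. ennreal ((cmod (\<Sum>n<m. a n * z ^ n))\<^sup>2 * \<phi> (cmod z)) \<partial>lborel) =
    (\<Sum>n<m. ennreal ((cmod (a n))\<^sup>2) * (\<integral>\<^sup>+z\<in>unit_disc. ennreal (((cmod z)\<^sup>2) ^ n * \<phi> (cmod z)) \<partial>lborel))"
proof -
  define N where "N = density lborel (\<lambda>z::complex. ennreal (\<phi> (cmod z)) * indicator unit_disc z)"
  have sets_N [measurable_cong]: "sets N = sets borel" by (simp add: N_def)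
  have N: "(\<integral>\<^sup>+z. ennreal (F z) \<partial>N) = (\<integral>\<^sup>+z\<in>unit_disc. ennreal (F z * \<phi> (cmod z)) \<partial>lborel)"
    if [measurable]: "F \<in> borel_measurable borel" and "\<And>z. 0 \<le> F z" for F
    unfolding N_def using that nonneg
    by (subst nn_integral_density, measurable) (auto intro!: nn_integral_cong simp: ennreal_mult mult_ac)
  have "emeasure N UNIV \<le> (\<integral>\<^sup>+z. indicator (ball 0 1) z \<partial>(lborel :: complex measure))"
    unfolding N_def using le1
    by (subst emeasure_density, measurable) (intro nn_integral_mono, auto split: split_indicator)
  also have "\<dots> = emeasure lborel (ball (0::complex) 1)" by simp
  also have "\<dots> < \<infinity>" by (simp add: emeasure_ball)
  finally interpret N: finite_measure N
    by (intro finite_measureI) (simp add: N_def space_density)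
  have AE: "AE z in N. cmod z < 1"
    unfolding N_def by (subst AE_density) (auto split: split_indicator simp: indicator_def)
  have int: "integrable N (\<lambda>z. z ^ j * cnj z ^ k)" for j k
  proof (rule N.integrable_const_bound[where B = 1])
    show "AE z in N. cmod (z ^ j * cnj z ^ k) \<le> 1"
      using AE by eventually_elim (auto simp: norm_mult norm_power intro!: mult_le_one power_le_one)
  qed measurable
  have sq: "complex_of_real ((cmod w)\<^sup>2) = w * cnj w" for w
    using complex_norm_square[of w] by simp
  have mom_int: "integrable N (\<lambda>z. ((cmod z)\<^sup>2) ^ n)" for n
  proof (rule N.integrable_const_bound[where B = 1])
    show "AE z in N. norm (((cmod z)\<^sup>2) ^ n) \<le> 1"
      using AE by eventually_elim (auto intro!: power_le_one)
  qed measurable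
  have mom: "(\<integral>z. z ^ n * cnj z ^ n \<partial>N) = of_real (\<integral>z. ((cmod z)\<^sup>2) ^ n \<partial>N)" for n
    by (subst integral_complex_of_real[symmetric], rule Bochner_Integration.integral_cong)
       (simp_all only: of_real_power[of _ n] sq power_mult_distrib)
  have expand: "complex_of_real ((cmod (\<Sum>n<m. a n * z ^ n))\<^sup>2) =
      (\<Sum>j<m. \<Sum>k<m. (a j * cnj (a k)) * (z ^ j * cnj z ^ k))" for z
    unfolding sq by (simp add: sum_product mult_ac)
  have "complex_of_real (\<integral>z. (cmod (\<Sum>n<m. a n * z ^ n))\<^sup>2 \<partial>N) =
      (\<integral>z. (\<Sum>j<m. \<Sum>k<m. (a j * cnj (a k)) * (z ^ j * cnj z ^ k)) \<partial>N)"
    by (simp only: expand integral_complex_of_real[symmetric])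
  also have "\<dots> = (\<Sum>j<m. \<Sum>k<m. (a j * cnj (a k)) * (\<integral>z. z ^ j * cnj z ^ k \<partial>N))"
  proof (subst Bochner_Integration.integral_sum)
    show "(\<Sum>j<m. \<integral>z. (\<Sum>k<m. (a j * cnj (a k)) * (z ^ j * cnj z ^ k)) \<partial>N) =
        (\<Sum>j<m. \<Sum>k<m. (a j * cnj (a k)) * (\<integral>z. z ^ j * cnj z ^ k \<partial>N))"
      by (subst Bochner_Integration.integral_sum, intro integrable_mult_right int)
         (simp only: integral_mult_right_zero)
  qed (intro Bochner_Integration.integrable_sum integrable_mult_right int)
  also have "\<dots> = (\<Sum>j<m. \<Sum>k<m. if k = j then of_real ((cmod (a j))\<^sup>2 * (\<integral>z. ((cmod z)\<^sup>2) ^ j \<partial>N)) else 0)"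
    using rotation_orthogonality[OF \<phi>, folded N_def] mom sq
    by (intro sum.cong refl) (simp)
  also have "\<dots> = of_real (\<Sum>j<m. (cmod (a j))\<^sup>2 * (\<integral>z. ((cmod z)\<^sup>2) ^ j \<partial>N))"
    by simp
  finally have real_eq: "(\<integral>z. (cmod (\<Sum>n<m. a n * z ^ n))\<^sup>2 \<partial>N) =
     (\<Sum>j<m. (cmod (a j))\<^sup>2 * (\<integral>z. ((cmod z)\<^sup>2) ^ j \<partial>N))"
    by (simp only: of_real_eq_iff)
  have P_int: "integrable N (\<lambda>z. (cmod (\<Sum>n<m. a n * z ^ n))\<^sup>2)"
  proof (rule N.integrable_const_bound[where B = "(\<Sum>n<m. cmod (a n))\<^sup>2"])
    show "AE z in N. norm ((cmod (\<Sum>n<m. a n * z ^ n))\<^sup>2) \<le> (\<Sum>n<m. cmod (a n))\<^sup>2"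
      using AE
      by eventually_elim
         (auto simp: norm_mult norm_power intro!: power_mono sum_norm_le mult_left_le power_le_one)
  qed measurable
  have "(\<integral>\<^sup>+z\<in>unit_disc. ennreal ((cmod (\<Sum>n<m. a n * z ^ n))\<^sup>2 * \<phi> (cmod z)) \<partial>lborel)
      = (\<integral>\<^sup>+z. ennreal ((cmod (\<Sum>n<m. a n * z ^ n))\<^sup>2) \<partial>N)"
    by (subst N) auto
  also have "\<dots> = ennreal (\<Sum>j<m. (cmod (a j))\<^sup>2 * (\<integral>z. ((cmod z)\<^sup>2) ^ j \<partial>N))"
    using P_int by (subst nn_integral_eq_integral) (auto simp: real_eq)
  also have "\<dots> = (\<Sum>j<m. ennreal ((cmod (a j))\<^sup>2) * (\<integral>\<^sup>+z. ennreal (((cmod z)\<^sup>2) ^ j) \<partial>N))"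
    using mom_int
    by (subst sum_ennreal[symmetric]) (auto intro!: sum.cong simp: ennreal_mult nn_integral_eq_integral)
  also have "\<dots> = (\<Sum>n<m. ennreal ((cmod (a n))\<^sup>2) * (\<integral>\<^sup>+z\<in>unit_disc. ennreal (((cmod z)\<^sup>2) ^ n * \<phi> (cmod z)) \<partial>lborel))"
    by (subst N) auto
  finally show ?thesis .
qed

definition taylor_coeff :: "(complex \<Rightarrow> complex) \<Rightarrow> nat \<Rightarrow> complex" where
  "taylor_coeff f n = (deriv ^^ n) f 0 / fact n"

lemma taylor_sums:
  "f holomorphic_on unit_disc \<Longrightarrow> z \<in> unit_disc \<Longrightarrow> (\<lambda>n. taylor_coeff f n * z ^ n) sums f z"
  using holomorphic_power_series[of f 0 1 z] by (simp add: taylor_coeff_def)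

lemma taylor_summable_norm:
  assumes f: "f holomorphic_on unit_disc" and r: "0 \<le> r" "r < 1"
  shows "summable (\<lambda>n. cmod (taylor_coeff f n) * r ^ n)"
proof -
  obtain s where s: "r < s" "s < 1" using r dense by blast
  have "summable (\<lambda>n. taylor_coeff f n * (of_real s) ^ n)"
    using taylor_sums[OF f, of "of_real s"] r s by (auto simp: sums_iff)
  from powser_insidea[OF this, of "of_real r"] s r show ?thesis
    by (simp add: norm_mult norm_power)
qed

lemma nn_integral_disc_exhaust:
  fixes F :: "complex \<Rightarrow> ennreal"
  assumes M: "sets M = sets borel"
    and F: "(\<lambda>z. F z * indicator unit_disc z) \<in> borel_measurable borel"
    and le: "\<And>\<rho>. 0 \<le> \<rho> \<Longrightarrow> \<rho> < 1 \<Longrightarrow> (\<integral>\<^sup>+z\<in>cball 0 \<rho>. F z \<partial>M) \<le> C"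
  shows "(\<integral>\<^sup>+z\<in>unit_disc. F z \<partial>M) \<le> C"
proof -
  define \<rho> where "\<rho> = (\<lambda>k. 1 - 1 / real (k + 2))"
  have \<rho>: "0 \<le> \<rho> k" "\<rho> k < 1" for k by (simp_all add: \<rho>_def field_simps)
  have \<rho>_lim: "\<rho> \<longlonglongrightarrow> 1"
    using tendsto_diff[OF tendsto_const[of "1::real"] LIMSEQ_ignore_initial_segment[OF lim_inverse_n', of 2]]
    by (simp add: \<rho>_def inverse_eq_divide)
  have \<rho>_mono: "\<rho> k \<le> \<rho> l" if "k \<le> l" for k l using that by (simp add: \<rho>_def field_simps)
  have eq: "F z * indicator (cball 0 (\<rho> k)) z = F z * indicator unit_disc z * indicator (cball 0 (\<rho> k)) z" for z k
    using \<rho>(2)[of k] by (auto split: split_indicator)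
  have "(\<lambda>k. \<integral>\<^sup>+z\<in>cball 0 (\<rho> k). F z \<partial>M) \<longlonglongrightarrow> (\<integral>\<^sup>+z\<in>unit_disc. F z \<partial>M)"
  proof (rule nn_integral_LIMSEQ)
    show "incseq (\<lambda>k z. F z * indicator (cball 0 (\<rho> k)) z)"
      using \<rho>_mono by (intro monoI le_funI) (auto split: split_indicator dest: order.trans)
    show "(\<lambda>z. F z * indicator (cball 0 (\<rho> k)) z) \<in> borel_measurable M" for k
    proof -
      have "(\<lambda>z. F z * indicator unit_disc z) \<in> borel_measurable M"
        using F by (simp only: measurable_cong_sets[OF M refl])
      then show ?thesis
        unfolding eq by (rule borel_measurable_times_ennreal) (rule borel_measurable_indicator, simp add: M)
    qed
    fix z
    show "(\<lambda>k. F z * indicator (cball 0 (\<rho> k)) z) \<longlonglongrightarrow> F z * indicator unit_disc z"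
    proof (cases "z \<in> unit_disc")
      case True
      then have "eventually (\<lambda>k. \<rho> k > cmod z) sequentially"
        by (intro order_tendstoD(1)[OF \<rho>_lim]) simp
      then have "eventually (\<lambda>k. F z * indicator (cball 0 (\<rho> k)) z = F z * indicator unit_disc z) sequentially"
      proof eventually_elim
        case (elim k)
        then show ?case using True by (simp add: indicator_def less_imp_le)
      qed
      then show ?thesis by (rule tendsto_eventually)
    next
      case False
      then have "z \<notin> cball 0 (\<rho> k)" for k using \<rho>(2)[of k] by auto
      with False show ?thesis by simp
    qed
  qed
  then show ?thesis by (rule LIMSEQ_le_const2) (use le[OF \<rho>] in blast)
qed

text \<open>
  On a disc of radius \<open>\<rho> < 1\<close> the Taylor polynomials converge boundedly, so there the polynomial
  identity passes to the limit; the inequality for the whole disc follows by exhaustion.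
\<close>

lemma bessel_disc_weighted:
  fixes \<phi> :: "real \<Rightarrow> real"
  assumes H: "H holomorphic_on unit_disc"
    and \<phi> [measurable]: "\<phi> \<in> borel_measurable borel"
    and nonneg: "\<And>r. 0 \<le> \<phi> r" and le1: "\<And>r. 0 \<le> r \<Longrightarrow> r < 1 \<Longrightarrow> \<phi> r \<le> 1"
  shows "(\<Sum>n<m. ennreal ((cmod (taylor_coeff H n))\<^sup>2) *
      (\<integral>\<^sup>+z\<in>unit_disc. ennreal (((cmod z)\<^sup>2) ^ n * \<phi> (cmod z)) \<partial>lborel))
    \<le> (\<integral>\<^sup>+z\<in>unit_disc. ennreal ((cmod (H z))\<^sup>2 * \<phi> (cmod z)) \<partial>lborel)"
proof -
  define c where "c = taylor_coeff H"
  define T where "T = (\<lambda>m z. \<Sum>n<m. c n * z ^ n)"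
  have H_meas [measurable]: "(\<lambda>z. indicator unit_disc z *\<^sub>R H z) \<in> borel_measurable borel"
    by (intro borel_measurable_continuous_on_indicator holomorphic_on_imp_continuous_on H) auto
  have trunc: "(\<Sum>n<m. ennreal ((cmod (c n))\<^sup>2) *
      (\<integral>\<^sup>+z\<in>unit_disc. ennreal (((cmod z)\<^sup>2) ^ n * (\<phi> (cmod z) * indicator {..\<rho>} (cmod z))) \<partial>lborel))
    \<le> (\<integral>\<^sup>+z\<in>unit_disc. ennreal ((cmod (H z))\<^sup>2 * \<phi> (cmod z)) \<partial>lborel)"
    if \<rho>: "0 \<le> \<rho>" "\<rho> < 1" for \<rho>
  proof -
    define \<psi> where "\<psi> = (\<lambda>r. \<phi> r * indicator {..\<rho>} r)"
    have \<psi> [measurable]: "\<psi> \<in> borel_measurable borel" unfolding \<psi>_def by measurable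
    have \<psi>0: "0 \<le> \<psi> r" for r using nonneg by (auto simp: \<psi>_def)
    have \<psi>1: "\<psi> r \<le> 1" if "0 \<le> r" "r < 1" for r
      using le1[OF that] by (auto simp: \<psi>_def split: split_indicator)
    define S where "S = (\<lambda>m. \<Sum>n<m. ennreal ((cmod (c n))\<^sup>2) *
      (\<integral>\<^sup>+z\<in>unit_disc. ennreal (((cmod z)\<^sup>2) ^ n * \<psi> (cmod z)) \<partial>lborel))"
    have S: "S m = (\<integral>\<^sup>+z\<in>unit_disc. ennreal ((cmod (T m z))\<^sup>2 * \<psi> (cmod z)) \<partial>lborel)" for m
      unfolding S_def T_def by (rule nn_integral_norm_polynomial_sq[symmetric, OF \<psi> \<psi>0 \<psi>1])
    define B where "B = (\<Sum>n. cmod (c n) * \<rho> ^ n)"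
    have sm: "summable (\<lambda>n. cmod (c n) * \<rho> ^ n)"
      unfolding c_def by (rule taylor_summable_norm[OF H \<rho>])
    have TB: "cmod (T m z) \<le> B" if "cmod z \<le> \<rho>" for m z
    proof -
      have "cmod (T m z) \<le> (\<Sum>n<m. cmod (c n) * \<rho> ^ n)"
        unfolding T_def using that \<rho>
        by (intro sum_norm_le) (auto simp: norm_mult norm_power intro!: mult_left_mono power_mono)
      also have "\<dots> \<le> B" unfolding B_def using \<rho> by (intro sum_le_suminf sm) auto
      finally show ?thesis .
    qed
    have "(\<lambda>m. \<integral>\<^sup>+z\<in>unit_disc. ennreal ((cmod (T m z))\<^sup>2 * \<psi> (cmod z)) \<partial>lborel) \<longlonglongrightarrow>
        (\<integral>\<^sup>+z\<in>unit_disc. ennreal ((cmod (H z))\<^sup>2 * \<psi> (cmod z)) \<partial>lborel)"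
    proof (rule nn_integral_dominated_convergence[where w = "\<lambda>z. ennreal (B\<^sup>2) * indicator unit_disc z"])
      show "(\<lambda>z. ennreal ((cmod (T m z))\<^sup>2 * \<psi> (cmod z)) * indicator unit_disc z) \<in> borel_measurable lborel" for m
        unfolding T_def by measurable
      have "(\<lambda>z. ennreal ((cmod (indicator unit_disc z *\<^sub>R H z))\<^sup>2 * \<psi> (cmod z)) * indicator unit_disc z)
           \<in> borel_measurable lborel" by measurable
      also have "(\<lambda>z. ennreal ((cmod (indicator unit_disc z *\<^sub>R H z))\<^sup>2 * \<psi> (cmod z)) * indicator unit_disc z) =
          (\<lambda>z. ennreal ((cmod (H z))\<^sup>2 * \<psi> (cmod z)) * indicator unit_disc z)"
        by (auto simp: fun_eq_iff split: split_indicator)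
      finally show "(\<lambda>z. ennreal ((cmod (H z))\<^sup>2 * \<psi> (cmod z)) * indicator unit_disc z) \<in> borel_measurable lborel" .
      show "AE z in lborel. ennreal ((cmod (T m z))\<^sup>2 * \<psi> (cmod z)) * indicator unit_disc z \<le> ennreal (B\<^sup>2) * indicator unit_disc z" for m
      proof (rule AE_I2)
        fix z
        have "(cmod (T m z))\<^sup>2 * \<psi> (cmod z) \<le> B\<^sup>2" if "cmod z < 1"
        proof (cases "cmod z \<le> \<rho>")
          case True
          then show ?thesis
            using mult_mono[OF power_mono[OF TB[OF True, of m], of 2] \<psi>1[of "cmod z"]] that \<psi>0 by simp
        qed (simp add: \<psi>_def)
        then show "ennreal ((cmod (T m z))\<^sup>2 * \<psi> (cmod z)) * indicator unit_disc z \<le> ennreal (B\<^sup>2) * indicator unit_disc z"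
          by (auto split: split_indicator intro: ennreal_leI)
      qed
      show "AE z in lborel. (\<lambda>m. ennreal ((cmod (T m z))\<^sup>2 * \<psi> (cmod z)) * indicator unit_disc z) \<longlonglongrightarrow>
          ennreal ((cmod (H z))\<^sup>2 * \<psi> (cmod z)) * indicator unit_disc z"
      proof (rule AE_I2)
        fix z
        show "(\<lambda>m. ennreal ((cmod (T m z))\<^sup>2 * \<psi> (cmod z)) * indicator unit_disc z) \<longlonglongrightarrow>
          ennreal ((cmod (H z))\<^sup>2 * \<psi> (cmod z)) * indicator unit_disc z"
        proof (cases "z \<in> unit_disc")
          case True
          have "(\<lambda>m. T m z) \<longlonglongrightarrow> H z"
            using taylor_sums[OF H True] unfolding T_def c_def sums_def .
          then show ?thesis using True by (auto intro!: tendsto_intros)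
        qed simp
      qed
      have "(\<integral>\<^sup>+z. ennreal (B\<^sup>2) * indicator unit_disc z \<partial>lborel) = ennreal (B\<^sup>2) * emeasure lborel (unit_disc)"
        by (rule nn_integral_cmult_indicator) simp
      also have "\<dots> < \<infinity>" by (simp add: emeasure_ball ennreal_mult_less_top)
      finally show "(\<integral>\<^sup>+z. ennreal (B\<^sup>2) * indicator unit_disc z \<partial>lborel) < \<infinity>" .
    qed simp
    then have "S \<longlonglongrightarrow> (\<integral>\<^sup>+z\<in>unit_disc. ennreal ((cmod (H z))\<^sup>2 * \<psi> (cmod z)) \<partial>lborel)"
      unfolding S .
    moreover have "incseq S" unfolding S_def by (intro incseq_SucI) simp
    ultimately have "S m \<le> (\<integral>\<^sup>+z\<in>unit_disc. ennreal ((cmod (H z))\<^sup>2 * \<psi> (cmod z)) \<partial>lborel)"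
      by (intro incseq_le)
    also have "\<dots> \<le> (\<integral>\<^sup>+z\<in>unit_disc. ennreal ((cmod (H z))\<^sup>2 * \<phi> (cmod z)) \<partial>lborel)"
      using nonneg by (intro nn_integral_mono) (auto simp: \<psi>_def split: split_indicator)
    finally show ?thesis unfolding S_def \<psi>_def .
  qed
  let ?F = "\<lambda>n z. ennreal (((cmod z)\<^sup>2) ^ n * \<phi> (cmod z))"
  let ?G = "\<lambda>z. \<Sum>n<m. ennreal ((cmod (c n))\<^sup>2) * ?F n z"
  have sum_eq: "(\<Sum>n<m. ennreal ((cmod (c n))\<^sup>2) * (\<integral>\<^sup>+z. ?F n z * indicator S z \<partial>lborel)) =
      (\<integral>\<^sup>+z. ?G z * indicator S z \<partial>lborel)" if S [measurable]: "S \<in> sets borel" for S :: "complex set"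
  proof -
    have "(\<integral>\<^sup>+z. ?G z * indicator S z \<partial>lborel) =
        (\<integral>\<^sup>+z. (\<Sum>n<m. ennreal ((cmod (c n))\<^sup>2) * (?F n z * indicator S z)) \<partial>lborel)"
      by (simp only: sum_distrib_right mult.assoc)
    also have "\<dots> = (\<Sum>n<m. \<integral>\<^sup>+z. ennreal ((cmod (c n))\<^sup>2) * (?F n z * indicator S z) \<partial>lborel)"
      by (rule nn_integral_sum) measurable
    also have "\<dots> = (\<Sum>n<m. ennreal ((cmod (c n))\<^sup>2) * (\<integral>\<^sup>+z. ?F n z * indicator S z \<partial>lborel))"
      by (intro sum.cong refl nn_integral_cmult) measurable
    finally show ?thesis by simp
  qed
  have "(\<integral>\<^sup>+z\<in>unit_disc. ?G z \<partial>lborel) \<le> (\<integral>\<^sup>+z\<in>unit_disc. ennreal ((cmod (H z))\<^sup>2 * \<phi> (cmod z)) \<partial>lborel)"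
  proof (rule nn_integral_disc_exhaust)
    show "(\<lambda>z. ?G z * indicator unit_disc z) \<in> borel_measurable borel" by measurable
    fix \<rho> :: real assume \<rho>: "0 \<le> \<rho>" "\<rho> < 1"
    have cut: "(\<integral>\<^sup>+z. ?F n z * indicator (cball 0 \<rho>) z \<partial>lborel) =
        (\<integral>\<^sup>+z\<in>unit_disc. ennreal (((cmod z)\<^sup>2) ^ n * (\<phi> (cmod z) * indicator {..\<rho>} (cmod z))) \<partial>lborel)" for n
      using \<rho> by (intro nn_integral_cong) (auto split: split_indicator)
    have "(\<integral>\<^sup>+z\<in>cball 0 \<rho>. ?G z \<partial>lborel) =
        (\<Sum>n<m. ennreal ((cmod (c n))\<^sup>2) * (\<integral>\<^sup>+z. ?F n z * indicator (cball 0 \<rho>) z \<partial>lborel))"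
      by (rule sum_eq[symmetric]) simp
    then show "(\<integral>\<^sup>+z\<in>cball 0 \<rho>. ?G z \<partial>lborel) \<le>
        (\<integral>\<^sup>+z\<in>unit_disc. ennreal ((cmod (H z))\<^sup>2 * \<phi> (cmod z)) \<partial>lborel)"
      using trunc[OF \<rho>] unfolding cut by simp
  qed simp
  then show ?thesis using sum_eq[OF unit_disc_borel] by (simp only: c_def)
qed

section \<open>The energy in terms of Taylor coefficients\<close>

text \<open>
  The square norms of the monomials for the weight \<open>(1 - \<bar>z\<bar>\<^sup>2)\<^sup>p\<close>.
\<close>

lemma disc_moment:
  assumes p: "0 < p"
  shows "(\<integral>\<^sup>+z\<in>unit_disc. ennreal (((cmod z)\<^sup>2) ^ n * (1 - (cmod z)\<^sup>2) powr p) \<partial>lborel) =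
    ennreal (pi * Beta (real n + 1) (p + 1))"
proof -
  have "((\<lambda>t. t powr (real n + 1 - 1) * (1 - t) powr (p + 1 - 1)) has_integral Beta (real n + 1) (p + 1)) {0..1}"
    using p by (intro has_integral_Beta_real) auto
  then have *: "((\<lambda>t. t powr real n * (1 - t) powr p) has_integral Beta (real n + 1) (p + 1)) {0..1}"
    by simp
  have "(\<integral>\<^sup>+t\<in>{0..1}. ennreal (t ^ n * (1 - t) powr p) \<partial>lborel) =
      (\<integral>\<^sup>+t. ennreal (t powr real n * (1 - t) powr p) * indicator {0<..1} t \<partial>lborel)"
  proof (rule nn_integral_cong_AE)
    have "AE t in lborel. (t::real) \<noteq> 0" by (rule AE_lborel_singleton)
    then show "AE t in lborel. ennreal (t ^ n * (1 - t) powr p) * indicator {0..1} t =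
      ennreal (t powr real n * (1 - t) powr p) * indicator {0<..1} t"
      by eventually_elim (auto split: split_indicator simp: powr_realpow)
  qed
  also have "\<dots> = (\<integral>\<^sup>+t. ennreal (t powr real n * (1 - t) powr p) * indicator {0..1} t \<partial>lborel)"
    by (intro nn_integral_cong_AE eventually_mono[OF AE_lborel_singleton[of 0]])
       (auto split: split_indicator)
  also have "\<dots> = ennreal (Beta (real n + 1) (p + 1))"
    by (rule nn_integral_has_integral_lebesgue'[OF _ *]) auto
  finally have eq: "(\<integral>\<^sup>+t\<in>{0..1}. ennreal (t ^ n * (1 - t) powr p) \<partial>lborel) = ennreal (Beta (real n + 1) (p + 1))" .
  have "(\<lambda>t. ennreal (t ^ n * (1 - t) powr p)) \<in> borel_measurable borel" by measurable
  from nn_integral_disc_radial[OF this] show ?thesis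
    by (simp only: eq ennreal_mult'[symmetric, of pi] pi_ge_zero)
qed

text \<open>
  The coefficients of the binomial series of \<open>(1 - x) powr (-p)\<close>. They serve as weights for Taylor
  coefficients, so that \<open>(1 - z * cnj u) powr (-p)\<close> is the reproducing kernel.
\<close>

definition binom_coeff :: "real \<Rightarrow> nat \<Rightarrow> real" where
  "binom_coeff p n = pochhammer p n / fact n"

lemma binom_coeff_pos: "0 < p \<Longrightarrow> 0 < binom_coeff p n"
  by (simp add: binom_coeff_def pochhammer_pos)

lemma binom_coeff_sums:
  assumes "cmod x < 1"
  shows "(\<lambda>n. of_real (binom_coeff p n) * x ^ n) sums ((1 - x) powr of_real (- p))"
proof -
  have "(\<lambda>n. (of_real (-p) gchoose n) * (- x) ^ n) sums ((1 + - x) powr of_real (- p))"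
    using assms by (intro gen_binomial_complex) auto
  moreover have "(of_real (-p) gchoose n) * (- x) ^ n = of_real (binom_coeff p n) * x ^ n" for n
  proof -
    have "(- 1) ^ n * (- 1) ^ n = (1 :: complex)"
      by (simp flip: power_mult_distrib)
    moreover have "(of_real (-p) gchoose n) * (- x) ^ n =
        ((- 1) ^ n * (- 1) ^ n) * (of_real (binom_coeff p n) * x ^ n)"
      unfolding gbinomial_pochhammer power_minus[of x] binom_coeff_def
      by (simp add: pochhammer_of_real)
    ultimately show ?thesis by simp
  qed
  ultimately show ?thesis by (simp only: add_uminus_conv_diff)
qed

text \<open>
  The right-hand side lies between \<open>p / (1 + p)\<close> and \<open>p\<close>: the weight that the energy puts on the
  Taylor coefficient of index \<open>n + 1\<close> is comparable to the reciprocal of the binomial coefficient.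
\<close>

lemma binom_coeff_Beta:
  assumes p: "0 < p"
  shows "binom_coeff p (Suc n) * (real (Suc n))\<^sup>2 * Beta (real n + 1) (p + 1) =
     p * real (Suc n) / (real (Suc n) + p)"
proof -
  have G: "Gamma (real n + 1) = fact n" using Gamma_fact[of n, where ?'a=real] by (simp add: add.commute)
  have Gp: "Gamma (p + 1) = p * Gamma p" using p by (intro Gamma_plus1) auto
  have ph: "pochhammer p (Suc n) = Gamma (p + real (Suc n)) / Gamma p"
    using p by (intro pochhammer_Gamma) auto
  have "Gamma (real n + 1 + (p + 1)) = Gamma ((p + real (Suc n)) + 1)" by (simp add: add_ac)
  also have "\<dots> = (p + real (Suc n)) * Gamma (p + real (Suc n))" using p by (intro Gamma_plus1) auto
  finally have Gs: "Gamma (real n + 1 + (p + 1)) = (p + real (Suc n)) * Gamma (p + real (Suc n))" .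
  have nz: "Gamma p \<noteq> 0" "Gamma (p + real (Suc n)) \<noteq> 0" "p + real (Suc n) \<noteq> 0"
    using p less_imp_neq[OF Gamma_real_pos[of p]] less_imp_neq[OF Gamma_real_pos[of "p + real (Suc n)"]]
    by (auto simp del: of_nat_Suc)
  have "binom_coeff p (Suc n) * (real (Suc n))\<^sup>2 * Beta (real n + 1) (p + 1)
     = Gamma (p + real (Suc n)) / Gamma p / (real (Suc n) * fact n) * (real (Suc n))\<^sup>2 *
       (fact n * (p * Gamma p) / ((p + real (Suc n)) * Gamma (p + real (Suc n))))"
    unfolding binom_coeff_def Beta_def G Gp Gs ph by simp
  also have "\<dots> = p * real (Suc n) / (real (Suc n) + p)"
  proof -
    have "G / P / (s * F) * s\<^sup>2 * (F * (p * P) / ((p + s) * G)) = p * s / (s + p)"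
      if "P \<noteq> 0" "G \<noteq> 0" "p + s \<noteq> 0" "s \<noteq> 0" "F \<noteq> 0" for G P s F :: real
      using that by (simp add: power2_eq_square add.commute)
    from this[OF nz, of "fact n"] show ?thesis by simp
  qed
  finally show ?thesis .
qed

lemma norm_powr_of_real: "z \<noteq> 0 \<Longrightarrow> cmod (z powr of_real a) = cmod z powr a"
  by (simp add: powr_def)

lemma taylor_coeff_deriv: "taylor_coeff (deriv f) n = of_nat (Suc n) * taylor_coeff f (Suc n)"
proof -
  have "(deriv ^^ n) (deriv f) 0 = (deriv ^^ Suc n) f 0" by (simp only: funpow_Suc_right comp_apply)
  moreover have "of_nat (Suc n) * ((deriv ^^ Suc n) f 0 / (of_nat (Suc n) * fact n)) = (deriv ^^ Suc n) f 0 / fact n"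
    by (simp del: of_nat_Suc)
  ultimately show ?thesis unfolding taylor_coeff_def fact_Suc by metis
qed

lemma bessel_energy:
  assumes p: "0 < p" and h: "h holomorphic_on unit_disc"
  shows "(\<Sum>n<m. ennreal ((cmod (taylor_coeff (deriv h) n))\<^sup>2 * (pi * Beta (real n + 1) (p + 1)))) \<le> Qp_energy p h 0"
proof -
  have dh: "deriv h holomorphic_on unit_disc" using h by (intro holomorphic_deriv) auto
  define \<phi> where "\<phi> = (\<lambda>r::real. (1 - r\<^sup>2) powr p)"
  have [measurable]: "\<phi> \<in> borel_measurable borel" unfolding \<phi>_def by measurable
  have le1: "\<phi> r \<le> 1" if "0 \<le> r" "r < 1" for r
    unfolding \<phi>_def using that p by (intro powr_le1) (auto simp: power_le_one)
  have "(\<Sum>n<m. ennreal ((cmod (taylor_coeff (deriv h) n))\<^sup>2) *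
      (\<integral>\<^sup>+z\<in>unit_disc. ennreal (((cmod z)\<^sup>2) ^ n * \<phi> (cmod z)) \<partial>lborel))
    \<le> (\<integral>\<^sup>+z\<in>unit_disc. ennreal ((cmod (deriv h z))\<^sup>2 * \<phi> (cmod z)) \<partial>lborel)"
    by (rule bessel_disc_weighted[OF dh _ _ le1]) (auto simp: \<phi>_def)
  then show ?thesis
    unfolding Qp_energy_0 \<phi>_def by (simp only: disc_moment[OF p] ennreal_mult'[symmetric] zero_le_power2)
qed

text \<open>
  By the lower bound in this comparison, finite energy places the function in
  the Hilbert space with reproducing kernel \<open>(1 - z * cnj u) powr (-p)\<close>.
\<close>

lemma bessel_energy_binom:
  assumes p: "0 < p" and h: "h holomorphic_on unit_disc" and E: "Qp_energy p h 0 \<le> ennreal E" "0 \<le> E"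
  shows "(\<Sum>n<m. (cmod (taylor_coeff h (Suc n)))\<^sup>2 / binom_coeff p (Suc n)) \<le> (1 + p) / (pi * p) * E"
proof -
  have Bpos: "0 < Beta (real n + 1) (p + 1)" for n
    unfolding Beta_def using p by (intro divide_pos_pos mult_pos_pos Gamma_real_pos) auto
  have "ennreal (\<Sum>n<m. (cmod (taylor_coeff (deriv h) n))\<^sup>2 * (pi * Beta (real n + 1) (p + 1))) \<le> ennreal E"
    using order.trans[OF bessel_energy[OF p h] E(1)] Bpos
    by (subst (asm) sum_ennreal) (auto intro!: mult_nonneg_nonneg less_imp_le[OF Bpos])
  then have 1: "(\<Sum>n<m. (cmod (taylor_coeff (deriv h) n))\<^sup>2 * (pi * Beta (real n + 1) (p + 1))) \<le> E"
    using E by (simp add: ennreal_le_iff)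
  have "(cmod (taylor_coeff h (Suc n)))\<^sup>2 / binom_coeff p (Suc n) \<le>
       (1 + p) / (pi * p) * ((cmod (taylor_coeff (deriv h) n))\<^sup>2 * (pi * Beta (real n + 1) (p + 1)))" for n
  proof -
    define s where "s = real (Suc n)"
    define b where "b = binom_coeff p (Suc n)"
    define B where "B = Beta (real n + 1) (p + 1)"
    have s: "1 \<le> s" by (simp add: s_def)
    have b: "0 < b" using p by (simp add: b_def binom_coeff_pos)
    have bB: "b * s\<^sup>2 * B = p * s / (s + p)"
      unfolding b_def s_def B_def by (rule binom_coeff_Beta[OF p])
    have "p * (s + p) \<le> p * s * (1 + p)"
      using mult_left_mono[OF s, of "p * p"] p by (simp add: algebra_simps)
    then have "1 \<le> (1 + p) / p * (p * s / (s + p))"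
      using p s by (simp add: divide_simps) (simp add: algebra_simps)
    also have "\<dots> = ((1 + p) / p * (s\<^sup>2 * B)) * b" by (simp flip: bB)
    finally have "1 / b \<le> (1 + p) / p * (s\<^sup>2 * B)"
      using b by (simp only: pos_divide_le_eq)
    from mult_left_mono[OF this, of "(cmod (taylor_coeff h (Suc n)))\<^sup>2"]
    have "(cmod (taylor_coeff h (Suc n)))\<^sup>2 / b \<le> (cmod (taylor_coeff h (Suc n)))\<^sup>2 * ((1 + p) / p * (s\<^sup>2 * B))"
      by simp
    also have "\<dots> = (1 + p) / (pi * p) * ((cmod (taylor_coeff (deriv h) n))\<^sup>2 * (pi * B))"
      using p unfolding taylor_coeff_deriv norm_mult norm_of_nat power_mult_distrib s_def[symmetric] by simp
    finally show ?thesis unfolding b_def B_def .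
  qed
  then have "(\<Sum>n<m. (cmod (taylor_coeff h (Suc n)))\<^sup>2 / binom_coeff p (Suc n)) \<le>
     (\<Sum>n<m. (1 + p) / (pi * p) * ((cmod (taylor_coeff (deriv h) n))\<^sup>2 * (pi * Beta (real n + 1) (p + 1))))"
    by (intro sum_mono) auto
  also have "\<dots> \<le> (1 + p) / (pi * p) * E"
    unfolding sum_distrib_left[symmetric] using 1 p by (intro mult_left_mono) auto
  finally show ?thesis .
qed

section \<open>Embedding functions of finite energy under a kernel condition\<close>

lemma norm_integral_le_nn_integral:
  fixes f :: "'a \<Rightarrow> 'b::{banach, second_countable_topology}"
  shows "ennreal (norm (integral\<^sup>L M f)) \<le> (\<integral>\<^sup>+x. ennreal (norm (f x)) \<partial>M)"
proof (cases "integrable M f")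
  case True
  then show ?thesis by (rule integral_norm_bound_ennreal)
next
  case False
  then show ?thesis by (simp add: not_integrable_integral_eq)
qed

text \<open>
  Replace \<open>H z * H u\<close> by the mean of the two squares; each square can then be taken out of one of
  the two integrals, leaving the integral of \<open>k\<close> over a row or a column.
\<close>

lemma schur_test:
  fixes k :: "'a \<Rightarrow> 'a \<Rightarrow> ennreal" and H :: "'a \<Rightarrow> real"
  assumes N: "sigma_finite_measure N"
    and k [measurable]: "case_prod k \<in> borel_measurable (N \<Otimes>\<^sub>M N)"
    and H [measurable]: "H \<in> borel_measurable N" and H0: "\<And>z. 0 \<le> H z"
    and row: "AE z in N. (\<integral>\<^sup>+u. k z u \<partial>N) \<le> K" and col: "AE u in N. (\<integral>\<^sup>+z. k z u \<partial>N) \<le> K"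
  shows "(\<integral>\<^sup>+z. ennreal (H z) * (\<integral>\<^sup>+u. k z u * ennreal (H u) \<partial>N) \<partial>N) \<le> K * (\<integral>\<^sup>+z. ennreal ((H z)\<^sup>2) \<partial>N)"
proof -
  interpret sigma_finite_measure N by (rule N)
  interpret NN: pair_sigma_finite N N ..
  define q :: real where "q = 1/2"
  have q0: "0 \<le> q" by (simp add: q_def)
  define X where "X = (\<integral>\<^sup>+z. ennreal ((H z)\<^sup>2) \<partial>N)"
  define Q1 where "Q1 = (\<integral>\<^sup>+z. \<integral>\<^sup>+u. k z u * ennreal ((H z)\<^sup>2) \<partial>N \<partial>N)"
  define Q2 where "Q2 = (\<integral>\<^sup>+z. \<integral>\<^sup>+u. k z u * ennreal ((H u)\<^sup>2) \<partial>N \<partial>N)"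
  have KX: "(\<integral>\<^sup>+z. K * ennreal ((H z)\<^sup>2) \<partial>N) = K * X"
    unfolding X_def by (rule nn_integral_cmult) measurable
  have Q1: "Q1 \<le> K * X"
  proof -
    have "Q1 = (\<integral>\<^sup>+z. (\<integral>\<^sup>+u. k z u \<partial>N) * ennreal ((H z)\<^sup>2) \<partial>N)"
      unfolding Q1_def by (intro nn_integral_cong nn_integral_multc) measurable
    also have "\<dots> \<le> K * X"
      unfolding KX[symmetric]
      by (rule nn_integral_mono_AE) (use row in \<open>eventually_elim, simp add: mult_right_mono\<close>)
    finally show ?thesis .
  qed
  have Q2: "Q2 \<le> K * X"
  proof -
    have "Q2 = (\<integral>\<^sup>+u. \<integral>\<^sup>+z. k z u * ennreal ((H u)\<^sup>2) \<partial>N \<partial>N)"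
      unfolding Q2_def by (rule NN.Fubini'[symmetric]) measurable
    also have "\<dots> = (\<integral>\<^sup>+u. (\<integral>\<^sup>+z. k z u \<partial>N) * ennreal ((H u)\<^sup>2) \<partial>N)"
      by (intro nn_integral_cong nn_integral_multc) measurable
    also have "\<dots> \<le> K * X"
      unfolding KX[symmetric]
      by (rule nn_integral_mono_AE) (use col in \<open>eventually_elim, simp add: mult_right_mono\<close>)
    finally show ?thesis .
  qed
  have "(\<integral>\<^sup>+z. ennreal (H z) * (\<integral>\<^sup>+u. k z u * ennreal (H u) \<partial>N) \<partial>N) =
      (\<integral>\<^sup>+z. \<integral>\<^sup>+u. ennreal (H z) * (k z u * ennreal (H u)) \<partial>N \<partial>N)"
    by (intro nn_integral_cong nn_integral_cmult[symmetric]) measurable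
  also have "\<dots> \<le> (\<integral>\<^sup>+z. \<integral>\<^sup>+u. ennreal q * (k z u * ennreal ((H z)\<^sup>2) + k z u * ennreal ((H u)\<^sup>2)) \<partial>N \<partial>N)"
  proof (intro nn_integral_mono)
    fix z u
    have "ennreal (H z) * (k z u * ennreal (H u)) = k z u * ennreal (H z * H u)"
      using H0 by (simp add: ennreal_mult mult_ac)
    also have "\<dots> \<le> k z u * ennreal (q * ((H z)\<^sup>2 + (H u)\<^sup>2))"
      using sum_squares_bound[of "H z" "H u"] by (intro mult_left_mono ennreal_leI) (auto simp: q_def)
    also have "\<dots> = ennreal q * (k z u * ennreal ((H z)\<^sup>2) + k z u * ennreal ((H u)\<^sup>2))"
      using q0 by (simp add: ennreal_mult ennreal_plus distrib_left mult_ac)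
    finally show "ennreal (H z) * (k z u * ennreal (H u)) \<le>
        ennreal q * (k z u * ennreal ((H z)\<^sup>2) + k z u * ennreal ((H u)\<^sup>2))" .
  qed
  also have "\<dots> = ennreal q * (Q1 + Q2)"
    unfolding Q1_def Q2_def
    by (subst nn_integral_add[symmetric], measurable, subst nn_integral_cmult[symmetric], measurable)
       (intro nn_integral_cong, subst nn_integral_add[symmetric], measurable, intro nn_integral_cmult, measurable)
  also have "\<dots> \<le> ennreal q * (K * X + K * X)"
    by (intro mult_left_mono add_mono Q1 Q2) auto
  also have "\<dots> = (ennreal q + ennreal q) * (K * X)" by (simp add: distrib_left distrib_right)
  also have "ennreal q + ennreal q = ennreal (q + q)" using q0 by (rule ennreal_plus[symmetric]) (rule q0)
  also have "q + q = 1" by (simp add: q_def)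
  finally show ?thesis by (simp add: X_def)
qed

text \<open>
  With \<open>X = \<integral> \<bar>h\<bar>\<^sup>2 dM\<close> over the truncated disc and \<open>\<beta>\<^sub>n = \<integral> z\<^sup>n * cnj (h z) dM\<close>, the Taylor series
  gives \<open>X = \<Sum> a\<^sub>n * \<beta>\<^sub>n\<close>. Cauchy--Schwarz with the binomial weights \<open>c\<^sub>n\<close> bounds \<open>X\<^sup>2\<close> by
  \<open>\<Sum> \<bar>a\<^sub>n\<bar>\<^sup>2 / c\<^sub>n\<close>, which the energy controls, times \<open>\<Sum> c\<^sub>n * \<bar>\<beta>\<^sub>n\<bar>\<^sup>2\<close>. The latter is the quadratic form
  of the kernel \<open>(1 - z * cnj u) powr (-p)\<close> at \<open>h\<close>, at most \<open>K * X\<close> by Schur's test. Hence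
  \<open>X\<^sup>2 \<le> C * E * K * X\<close>. The truncation makes \<open>X\<close> finite, so that it may be cancelled, and makes
  \<open>h\<close> bounded, which justifies all interchanges.
\<close>

lemma dirichlet_embedding_truncated:
  assumes p: "0 < p" and M: "sets M = sets borel"
    and K: "\<And>a. a \<in> unit_disc \<Longrightarrow> (\<integral>\<^sup>+z\<in>unit_disc. ennreal (cmod (1 - cnj a * z) powr (-p)) \<partial>M) \<le> ennreal K" "0 \<le> K"
    and h: "h holomorphic_on unit_disc" "h 0 = 0"
    and E: "Qp_energy p h 0 \<le> ennreal E" "0 \<le> E"
    and \<rho>: "0 \<le> \<rho>" "\<rho> < 1"
  shows "(\<integral>\<^sup>+z\<in>cball 0 \<rho>. ennreal ((cmod (h z))\<^sup>2) \<partial>M) \<le> ennreal ((1 + p) / (pi * p) * E * K)"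
proof -
  note [measurable_cong] = M
  define N where "N = density M (indicator (cball 0 \<rho>))"
  have sN [measurable_cong]: "sets N = sets borel" by (simp add: N_def M)
  have cb: "z \<in> unit_disc" if "z \<in> cball 0 \<rho>" for z using that \<rho> by auto
  have nnN: "(\<integral>\<^sup>+z. F z \<partial>N) = (\<integral>\<^sup>+z\<in>cball 0 \<rho>. F z \<partial>M)" if "F \<in> borel_measurable borel" for F
  proof -
    have "F \<in> borel_measurable M" using that by (simp only: measurable_cong_sets[OF M refl])
    then show ?thesis
      unfolding N_def by (subst nn_integral_density) (auto simp: mult.commute M intro!: borel_measurable_indicator)
  qed
  have KN: "(\<integral>\<^sup>+z. ennreal (cmod (1 - cnj a * z) powr (-p)) \<partial>N) \<le> ennreal K" if "a \<in> unit_disc" for a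
    by (subst nnN, measurable, rule order.trans[OF _ K(1)[OF that]], rule nn_integral_mono)
       (use cb in \<open>auto split: split_indicator\<close>)
  have "emeasure N (space N) = (\<integral>\<^sup>+z. ennreal (cmod (1 - cnj 0 * z) powr (-p)) \<partial>N)"
    by simp
  also have "\<dots> < \<infinity>" using KN[of 0] order.strict_trans1 ennreal_less_top by fastforce
  finally have fin: "emeasure N (space N) \<noteq> \<infinity>" by (simp add: less_top)
  interpret N: finite_measure N by (rule finite_measureI[OF fin])
  have AE: "AE z in N. z \<in> cball 0 \<rho>"
    unfolding N_def by (subst AE_density, measurable) (auto split: split_indicator simp: indicator_def)
  \<comment> \<open>\<open>h\<close> is measurable only on the disc; \<open>H\<close> agrees with it \<open>N\<close>-almost everywhere and is bounded.\<close>
  define H where "H = (\<lambda>z. indicator (cball 0 \<rho>) z *\<^sub>R h z)"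
  have H_meas [measurable]: "H \<in> borel_measurable borel"
    unfolding H_def using cb
    by (intro borel_measurable_continuous_on_indicator holomorphic_on_imp_continuous_on
        holomorphic_on_subset[OF h(1)]) auto
  have "compact (h ` cball 0 \<rho>)"
    using cb by (intro compact_continuous_image holomorphic_on_imp_continuous_on
        holomorphic_on_subset[OF h(1)]) auto
  then obtain b where b: "\<And>z. z \<in> cball 0 \<rho> \<Longrightarrow> cmod (h z) \<le> b"
    by (metis bounded_iff compact_imp_bounded imageI)
  have b0: "0 \<le> b" using b[of 0] \<rho> by (auto intro: order.trans[OF norm_ge_zero])
  have Hb: "cmod (H z) \<le> b" for z using b b0 by (auto simp: H_def split: split_indicator)
  define X where "X = (\<integral>z. (cmod (H z))\<^sup>2 \<partial>N)"
  have X_int: "integrable N (\<lambda>z. (cmod (H z))\<^sup>2)"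
    by (rule N.integrable_const_bound[where B = "b\<^sup>2"]) (auto intro!: AE_I2 power_mono Hb)
  have X0: "0 \<le> X" unfolding X_def by simp
  have X_nn: "(\<integral>\<^sup>+z. ennreal ((cmod (H z))\<^sup>2) \<partial>N) = ennreal X"
    unfolding X_def using X_int by (intro nn_integral_eq_integral) auto
  define a where "a = taylor_coeff h"
  define c where "c = binom_coeff p"
  have c_pos: "0 < c n" for n unfolding c_def using p by (rule binom_coeff_pos)
  have a0: "a 0 = 0" by (simp add: a_def taylor_coeff_def h(2))
  define \<beta> where "\<beta> = (\<lambda>n. \<integral>z. z ^ n * cnj (H z) \<partial>N)"
  have zH_int: "integrable N (\<lambda>z. z ^ n * cnj (H z))" for n
  proof (rule N.integrable_const_bound[where B = b])
    show "AE z in N. norm (z ^ n * cnj (H z)) \<le> b"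
      using AE
    proof eventually_elim
      case (elim z)
      then have "cmod z ^ n \<le> 1" using \<rho> by (intro power_le_one) auto
      then show ?case using mult_mono[of "cmod z ^ n" 1 "cmod (H z)" b] Hb[of z] by (simp add: norm_mult norm_power)
    qed
  qed measurable
  \<comment> \<open>Inserting the Taylor series of \<open>h\<close> into \<open>X\<close>: dominated convergence applies as \<open>\<rho> < 1\<close>.\<close>
  have sm_a: "summable (\<lambda>n. cmod (a n) * \<rho> ^ n)"
    unfolding a_def by (rule taylor_summable_norm[OF h(1) \<rho>])
  have lim1: "(\<lambda>m. \<Sum>n<m. a n * \<beta> n) \<longlonglongrightarrow> of_real X"
  proof -
    have "(\<lambda>m. \<integral>z. (\<Sum>n<m. a n * z ^ n) * cnj (H z) \<partial>N) \<longlonglongrightarrow> (\<integral>z. of_real ((cmod (H z))\<^sup>2) \<partial>N)"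
    proof (rule integral_dominated_convergence[where w = "\<lambda>_. (\<Sum>n. cmod (a n) * \<rho> ^ n) * b"])
      show "AE z in N. (\<lambda>m. (\<Sum>n<m. a n * z ^ n) * cnj (H z)) \<longlonglongrightarrow> of_real ((cmod (H z))\<^sup>2)"
        using AE
      proof eventually_elim
        case (elim z)
        have "(\<lambda>m. \<Sum>n<m. a n * z ^ n) \<longlonglongrightarrow> H z"
          using taylor_sums[OF h(1) cb[OF elim]] elim by (simp add: sums_def a_def H_def)
        from tendsto_mult_right[OF this, of "cnj (H z)"] show ?case
          using complex_norm_square[of "H z"] by simp
      qed
      show "AE z in N. norm ((\<Sum>n<m. a n * z ^ n) * cnj (H z)) \<le> (\<Sum>n. cmod (a n) * \<rho> ^ n) * b" for m
        using AE
      proof eventually_elim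
        case (elim z)
        have "cmod (\<Sum>n<m. a n * z ^ n) \<le> (\<Sum>n<m. cmod (a n) * \<rho> ^ n)"
          using elim \<rho>
          by (intro sum_norm_le) (auto simp: norm_mult norm_power intro!: mult_left_mono power_mono)
        also have "\<dots> \<le> (\<Sum>n. cmod (a n) * \<rho> ^ n)" using \<rho> by (intro sum_le_suminf sm_a) auto
        finally show ?case using Hb[of z] by (auto simp: norm_mult intro!: mult_mono order.trans[OF norm_ge_zero])
      qed
    qed auto
    moreover have "(\<integral>z. (\<Sum>n<m. a n * z ^ n) * cnj (H z) \<partial>N) = (\<Sum>n<m. a n * \<beta> n)" for m
    proof -
      have "(\<integral>z. (\<Sum>n<m. a n * z ^ n) * cnj (H z) \<partial>N) = (\<integral>z. (\<Sum>n<m. a n * (z ^ n * cnj (H z))) \<partial>N)"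
        by (simp add: sum_distrib_right mult.assoc)
      also have "\<dots> = (\<Sum>n<m. \<integral>z. a n * (z ^ n * cnj (H z)) \<partial>N)"
        by (intro Bochner_Integration.integral_sum integrable_mult_right zH_int)
      finally show ?thesis unfolding \<beta>_def by (simp only: integral_mult_right_zero)
    qed
    ultimately show ?thesis by (simp only: X_def integral_complex_of_real)
  qed
  \<comment> \<open>The partial sums of \<open>\<Sum> c\<^sub>n * \<bar>\<beta>\<^sub>n\<bar>\<^sup>2\<close> are integrals of \<open>G m\<close> against \<open>H\<close>, where \<open>G m\<close> tends to the
    integral operator with kernel \<open>(1 - z * cnj u) powr (-p)\<close> applied to \<open>H\<close>.\<close>
  define G where "G = (\<lambda>m z. \<Sum>n<m. of_real (c n) * cnj (\<beta> n) * z ^ n)"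
  define kern where "kern = (\<lambda>z u :: complex. cmod (1 - cnj u * z) powr (- p))"
  have S3: "(\<Sum>n<m. c n * (cmod (\<beta> n))\<^sup>2) \<le> K * X" for m
  proof -
    define Gk where "Gk = (\<lambda>z. \<integral>\<^sup>+u. ennreal (kern z u * cmod (H u)) \<partial>N)"
    have kern_meas [measurable]: "case_prod kern \<in> borel_measurable (borel \<Otimes>\<^sub>M borel)"
      unfolding kern_def by measurable
    define Kb where "Kb = (\<Sum>n. c n * \<rho> ^ n)"
    have sm_c: "summable (\<lambda>n. c n * \<rho> ^ n)"
    proof -
      have "(\<lambda>n. complex_of_real (c n * \<rho> ^ n)) sums ((1 - of_real \<rho>) powr of_real (- p))"
        using binom_coeff_sums[of "of_real \<rho>" p] \<rho> by (simp add: c_def)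
      then show ?thesis by (metis sums_summable summable_of_real_iff)
    qed
    have G_eq: "G m z = (\<integral>u. (\<Sum>n<m. of_real (c n) * (z * cnj u) ^ n) * H u \<partial>N)" for m z
    proof -
      have "(\<integral>u. (\<Sum>n<m. of_real (c n) * (z * cnj u) ^ n) * H u \<partial>N) =
          (\<integral>u. (\<Sum>n<m. (of_real (c n) * z ^ n) * cnj (u ^ n * cnj (H u))) \<partial>N)"
        by (simp add: sum_distrib_left power_mult_distrib mult_ac)
      also have "\<dots> = (\<Sum>n<m. \<integral>u. (of_real (c n) * z ^ n) * cnj (u ^ n * cnj (H u)) \<partial>N)"
        by (intro Bochner_Integration.integral_sum integrable_mult_right integrable_cnj zH_int)
      also have "\<dots> = (\<Sum>n<m. (of_real (c n) * z ^ n) * cnj (\<beta> n))"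
        unfolding \<beta>_def by (simp only: integral_mult_right_zero Bochner_Integration.integral_cnj)
      finally show ?thesis unfolding G_def by (simp add: mult_ac)
    qed
    have part_bound: "cmod (\<Sum>n<m. of_real (c n) * (z * cnj u) ^ n) \<le> Kb" if "cmod z \<le> 1" "cmod u \<le> \<rho>" for m z u
    proof -
      have "cmod (\<Sum>n<m. of_real (c n) * (z * cnj u) ^ n) \<le> (\<Sum>n<m. c n * \<rho> ^ n)"
      proof (rule sum_norm_le)
        fix n
        have "cmod z * cmod u \<le> 1 * \<rho>" using that by (intro mult_mono) auto
        then have "(cmod z * cmod u) ^ n \<le> \<rho> ^ n" by (intro power_mono) auto
        then show "cmod (of_real (c n) * (z * cnj u) ^ n) \<le> c n * \<rho> ^ n"
          using c_pos[of n] by (simp add: norm_mult norm_power)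
      qed
      also have "\<dots> \<le> Kb" unfolding Kb_def using \<rho> c_pos
        by (intro sum_le_suminf sm_c) (auto intro!: mult_nonneg_nonneg less_imp_le[OF c_pos])
      finally show ?thesis .
    qed
    define Ginf where "Ginf = (\<lambda>z. \<integral>u. (1 - z * cnj u) powr (of_real (-p)) * H u \<partial>N)"
    have G_lim: "(\<lambda>m. G m z) \<longlonglongrightarrow> Ginf z" if z: "z \<in> cball 0 \<rho>" for z
      unfolding G_eq Ginf_def
    proof (rule integral_dominated_convergence[where w = "\<lambda>_. Kb * b"])
      have ch: "continuous_on (cball 0 \<rho>) h"
        using cb by (intro holomorphic_on_imp_continuous_on holomorphic_on_subset[OF h(1)]) auto
      have "continuous_on (cball 0 \<rho>) (\<lambda>u. (1 - z * cnj u) powr of_real (- p) * h u)"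
      proof (rule continuous_on_mult[OF continuous_on_powr_complex ch])
        have pos: "0 < Re (1 - z * cnj u)" if u: "u \<in> cball 0 \<rho>" for u
        proof -
          have "cmod (z * cnj u) \<le> \<rho> * 1" unfolding norm_mult
            using z u \<rho> by (intro mult_mono) auto
          then show ?thesis using complex_Re_le_cmod[of "z * cnj u"] \<rho> by simp
        qed
        then show "cball 0 \<rho> \<subseteq> {u. 0 \<le> Re (1 - z * cnj u) \<or> Im (1 - z * cnj u) \<noteq> 0}"
          using less_imp_le by blast
        show "0 < Re (complex_of_real (- p))" if "u \<in> cball 0 \<rho>" "1 - z * cnj u = 0" for u
          using pos[OF that(1)] unfolding that(2) by simp
      qed (intro continuous_intros)+
      then have "(\<lambda>u. indicator (cball 0 \<rho>) u *\<^sub>R ((1 - z * cnj u) powr of_real (- p) * h u)) \<in> borel_measurable borel"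
        by (intro borel_measurable_continuous_on_indicator) auto
      also have "(\<lambda>u. indicator (cball 0 \<rho>) u *\<^sub>R ((1 - z * cnj u) powr of_real (- p) * h u)) =
          (\<lambda>u. (1 - z * cnj u) powr of_real (- p) * H u)"
        by (auto simp: H_def fun_eq_iff split: split_indicator)
      finally have "(\<lambda>x. (1 - z * cnj x) powr of_real (- p) * H x) \<in> borel_measurable borel" .
      then show "(\<lambda>x. (1 - z * cnj x) powr of_real (- p) * H x) \<in> borel_measurable N" by measurable
      show "AE u in N. (\<lambda>m. (\<Sum>n<m. of_real (c n) * (z * cnj u) ^ n) * H u) \<longlonglongrightarrow> (1 - z * cnj u) powr of_real (- p) * H u"
        using AE
      proof eventually_elim
        case (elim u)
        have "cmod (z * cnj u) \<le> \<rho> * 1" unfolding norm_mult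
          using z elim \<rho> by (intro mult_mono) auto
        then have "cmod (z * cnj u) < 1" using \<rho> by simp
        from binom_coeff_sums[OF this, of p] show ?case
          unfolding sums_def c_def by (rule tendsto_mult_right)
      qed
      show "AE u in N. norm ((\<Sum>n<m. of_real (c n) * (z * cnj u) ^ n) * H u) \<le> Kb * b" for m
        using AE
      proof eventually_elim
        case (elim u)
        have *: "cmod (\<Sum>n<m. of_real (c n) * (z * cnj u) ^ n) \<le> Kb"
          using z elim \<rho> by (intro part_bound) auto
        then have "0 \<le> Kb" using norm_ge_zero order.trans by blast
        with * show ?case using Hb[of u] by (auto simp: norm_mult intro!: mult_mono)
      qed
    qed (auto intro!: borel_measurable_times)
    have Ginf_le: "ennreal (cmod (Ginf z)) \<le> Gk z" if z: "z \<in> cball 0 \<rho>" for z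
    proof -
      have "ennreal (cmod (Ginf z)) \<le> (\<integral>\<^sup>+u. ennreal (cmod ((1 - z * cnj u) powr (of_real (-p)) * H u)) \<partial>N)"
        unfolding Ginf_def by (rule norm_integral_le_nn_integral)
      also have "\<dots> = Gk z"
        unfolding Gk_def
      proof (rule nn_integral_cong_AE)
        show "AE u in N. ennreal (cmod ((1 - z * cnj u) powr (of_real (-p)) * H u)) = ennreal (kern z u * cmod (H u))"
          using AE
        proof eventually_elim
          case (elim u)
          have "1 - cnj u * z \<noteq> 0" using disc_aut_denominator[OF cb[OF elim] cb[OF z]] .
          then have nz: "1 - z * cnj u \<noteq> 0" by (simp add: mult.commute)
          show ?case
            unfolding norm_mult norm_powr_of_real[OF nz] kern_def by (simp add: mult.commute)
        qed
      qed
      finally show ?thesis .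
    qed
    have quad: "(\<integral>\<^sup>+z. ennreal (cmod (H z)) * Gk z \<partial>N) \<le> ennreal (K * X)"
    proof -
      have kerK: "(\<integral>\<^sup>+u. ennreal (kern z u) \<partial>N) \<le> ennreal K" if "z \<in> cball 0 \<rho>" for z
      proof -
        have "kern z u = cmod (1 - cnj z * u) powr (-p)" for u
        proof -
          have "cmod (1 - cnj u * z) = cmod (cnj (1 - cnj u * z))" by (simp only: complex_mod_cnj)
          also have "cnj (1 - cnj u * z) = 1 - cnj z * u" by (simp add: mult.commute)
          finally show ?thesis unfolding kern_def by simp
        qed
        then show ?thesis using KN[OF cb[OF that]] by simp
      qed
      have kerK': "(\<integral>\<^sup>+z. ennreal (kern z u) \<partial>N) \<le> ennreal K" if "u \<in> cball 0 \<rho>" for u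
        unfolding kern_def using KN[OF cb[OF that]] .
      have sf: "sigma_finite_measure N" ..
      have km: "(\<lambda>(z, u). ennreal (kern z u)) \<in> borel_measurable (N \<Otimes>\<^sub>M N)" by measurable
      have row: "AE z in N. (\<integral>\<^sup>+u. ennreal (kern z u) \<partial>N) \<le> ennreal K"
        using AE by eventually_elim (rule kerK)
      have col: "AE u in N. (\<integral>\<^sup>+z. ennreal (kern z u) \<partial>N) \<le> ennreal K"
        using AE by eventually_elim (rule kerK')
      have "(\<lambda>z. cmod (H z)) \<in> borel_measurable N" by measurable
      from schur_test[OF sf km this _ row col]
      have "(\<integral>\<^sup>+z. ennreal (cmod (H z)) * (\<integral>\<^sup>+u. ennreal (kern z u) * ennreal (cmod (H u)) \<partial>N) \<partial>N)
          \<le> ennreal K * ennreal X" unfolding X_nn by simp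
      moreover have "Gk z = (\<integral>\<^sup>+u. ennreal (kern z u) * ennreal (cmod (H u)) \<partial>N)" for z
        unfolding Gk_def by (simp add: kern_def ennreal_mult)
      ultimately show ?thesis using K(2) X0 by (simp add: ennreal_mult)
    qed
    have Gb: "ennreal (cmod (G m z)) \<le> ennreal (Kb * b) * emeasure N (space N)" if z: "z \<in> cball 0 \<rho>" for m z
    proof -
      have "ennreal (cmod (G m z)) \<le>
          (\<integral>\<^sup>+u. ennreal (norm ((\<Sum>n<m. of_real (c n) * (z * cnj u) ^ n) * H u)) \<partial>N)"
        unfolding G_eq by (rule norm_integral_le_nn_integral)
      also have "\<dots> \<le> (\<integral>\<^sup>+u. ennreal (Kb * b) \<partial>N)"
      proof (rule nn_integral_mono_AE)
        show "AE u in N. ennreal (norm ((\<Sum>n<m. of_real (c n) * (z * cnj u) ^ n) * H u)) \<le> ennreal (Kb * b)"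
          using AE
        proof eventually_elim
          case (elim u)
          have *: "cmod (\<Sum>n<m. of_real (c n) * (z * cnj u) ^ n) \<le> Kb"
            using z elim \<rho> by (intro part_bound) auto
          then have "0 \<le> Kb" using norm_ge_zero order.trans by blast
          with * show ?case using Hb[of u] by (intro ennreal_leI) (auto simp: norm_mult intro!: mult_mono)
        qed
      qed
      finally show ?thesis by simp
    qed
    have S_le: "ennreal (\<Sum>n<m. c n * (cmod (\<beta> n))\<^sup>2) \<le> (\<integral>\<^sup>+z. ennreal (cmod (H z)) * ennreal (cmod (G m z)) \<partial>N)" for m
    proof -
      have "of_real (\<Sum>n<m. c n * (cmod (\<beta> n))\<^sup>2) = (\<Sum>n<m. of_real (c n) * cnj (\<beta> n) * \<beta> n)"
        using complex_norm_square by (simp add: mult_ac)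
      also have "\<dots> = (\<integral>z. (\<Sum>n<m. of_real (c n) * cnj (\<beta> n) * (z ^ n * cnj (H z))) \<partial>N)"
        unfolding \<beta>_def
        by (subst Bochner_Integration.integral_sum, intro integrable_mult_right zH_int) (simp only: integral_mult_right_zero)
      also have "\<dots> = (\<integral>z. G m z * cnj (H z) \<partial>N)"
        unfolding G_def by (simp add: sum_distrib_right mult.assoc)
      finally have eq: "of_real (\<Sum>n<m. c n * (cmod (\<beta> n))\<^sup>2) = (\<integral>z. G m z * cnj (H z) \<partial>N)" .
      have "ennreal (\<Sum>n<m. c n * (cmod (\<beta> n))\<^sup>2) = ennreal (cmod (of_real (\<Sum>n<m. c n * (cmod (\<beta> n))\<^sup>2)))"
        using c_pos by (simp only: norm_of_real) (simp add: sum_nonneg less_imp_le)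
      also have "\<dots> \<le> (\<integral>\<^sup>+z. ennreal (cmod (G m z * cnj (H z))) \<partial>N)"
        unfolding eq by (rule norm_integral_le_nn_integral)
      finally show ?thesis by (simp add: norm_mult ennreal_mult mult.commute)
    qed
    define J where "J = (\<lambda>z. indicator (cball 0 \<rho>) z *\<^sub>R Ginf z)"
    have G_meas: "G m \<in> borel_measurable borel" for m
      unfolding G_def by measurable
    have J_lim: "(\<lambda>m. indicator (cball 0 \<rho>) z *\<^sub>R G m z) \<longlonglongrightarrow> J z" for z
      unfolding J_def using G_lim[of z] by (auto split: split_indicator)
    have J_meas [measurable]: "J \<in> borel_measurable borel"
      by (rule borel_measurable_LIMSEQ_metric[OF _ J_lim], intro borel_measurable_scaleR borel_measurable_indicator G_meas) auto
    have lim: "(\<lambda>m. \<integral>\<^sup>+z. ennreal (cmod (H z)) * ennreal (cmod (G m z)) \<partial>N) \<longlonglongrightarrow>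
        (\<integral>\<^sup>+z. ennreal (cmod (H z)) * ennreal (cmod (J z)) \<partial>N)"
    proof (rule nn_integral_dominated_convergence[where w = "\<lambda>_. ennreal b * (ennreal (Kb * b) * emeasure N (space N))"])
      show "AE z in N. ennreal (cmod (H z)) * ennreal (cmod (G m z)) \<le> ennreal b * (ennreal (Kb * b) * emeasure N (space N))" for m
        using AE
      proof eventually_elim
        case (elim z)
        show ?case by (intro mult_mono ennreal_leI Hb Gb[OF elim]) auto
      qed
      show "AE z in N. (\<lambda>m. ennreal (cmod (H z)) * ennreal (cmod (G m z))) \<longlonglongrightarrow> ennreal (cmod (H z)) * ennreal (cmod (J z))"
        using AE
      proof eventually_elim
        case (elim z)
        have "(\<lambda>m. ennreal (cmod (G m z))) \<longlonglongrightarrow> ennreal (cmod (J z))"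
          using G_lim[OF elim] elim by (auto simp: J_def intro!: tendsto_intros)
        then show ?case by (intro ennreal_tendsto_cmult) auto
      qed
      show "(\<integral>\<^sup>+z. ennreal b * (ennreal (Kb * b) * emeasure N (space N)) \<partial>N) < \<infinity>"
        using N.emeasure_finite[of "space N"]
        by (simp add: ennreal_mult_eq_top_iff less_top[symmetric])
    qed (use G_meas in measurable)
    have mono: "(\<Sum>n<m. c n * (cmod (\<beta> n))\<^sup>2) \<le> (\<Sum>n<k. c n * (cmod (\<beta> n))\<^sup>2)" if "m \<le> k" for k
      using that c_pos by (intro sum_mono2) (auto intro!: mult_nonneg_nonneg less_imp_le[OF c_pos])
    have "ennreal (\<Sum>n<m. c n * (cmod (\<beta> n))\<^sup>2) \<le> (\<integral>\<^sup>+z. ennreal (cmod (H z)) * ennreal (cmod (J z)) \<partial>N)"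
    proof (rule LIMSEQ_le_const[OF lim], intro exI allI impI)
      fix k assume "m \<le> k"
      then show "ennreal (\<Sum>n<m. c n * (cmod (\<beta> n))\<^sup>2) \<le> (\<integral>\<^sup>+z. ennreal (cmod (H z)) * ennreal (cmod (G k z)) \<partial>N)"
        using order.trans[OF ennreal_leI[OF mono] S_le] by blast
    qed
    also have "\<dots> \<le> (\<integral>\<^sup>+z. ennreal (cmod (H z)) * Gk z \<partial>N)"
    proof (rule nn_integral_mono_AE)
      show "AE z in N. ennreal (cmod (H z)) * ennreal (cmod (J z)) \<le> ennreal (cmod (H z)) * Gk z"
        using AE
      proof eventually_elim
        case (elim z)
        then show ?case using Ginf_le[OF elim] by (intro mult_left_mono) (auto simp: J_def)
      qed
    qed
    also have "\<dots> \<le> ennreal (K * X)" by (rule quad)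
    finally show ?thesis using K(2) X0 by (simp add: ennreal_le_iff)
  qed
  define A where "A = (1 + p) / (pi * p) * E"
  have A0: "0 \<le> A" using p E by (simp add: A_def)
  have SA: "(\<Sum>n<m. (cmod (a n))\<^sup>2 / c n) \<le> A" for m
  proof -
    have "(\<Sum>n<m. (cmod (a n))\<^sup>2 / c n) \<le> (\<Sum>n<Suc m. (cmod (a n))\<^sup>2 / c n)"
      using c_pos[of m] by simp
    also have "\<dots> = (\<Sum>n<m. (cmod (a (Suc n)))\<^sup>2 / c (Suc n))"
      by (subst sum.lessThan_Suc_shift) (simp add: a0)
    also have "\<dots> \<le> A" unfolding A_def a_def c_def by (rule bessel_energy_binom[OF p h(1) E])
    finally show ?thesis .
  qed
  have CS: "cmod (\<Sum>n<m. a n * \<beta> n) \<le> sqrt (A * (K * X))" for m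
  proof -
    have "cmod (\<Sum>n<m. a n * \<beta> n) \<le> (\<Sum>n<m. (cmod (a n) / sqrt (c n)) * (sqrt (c n) * cmod (\<beta> n)))"
    proof (rule sum_norm_le)
      fix n
      have "sqrt (c n) \<noteq> 0" using c_pos[of n] by simp
      then show "cmod (a n * \<beta> n) \<le> cmod (a n) / sqrt (c n) * (sqrt (c n) * cmod (\<beta> n))"
        by (simp add: norm_mult)
    qed
    also have "\<dots> \<le> sqrt (A * (K * X))"
    proof (rule real_le_rsqrt)
      have "(\<Sum>n<m. (cmod (a n) / sqrt (c n)) * (sqrt (c n) * cmod (\<beta> n)))\<^sup>2 \<le>
         (\<Sum>n<m. (cmod (a n) / sqrt (c n))\<^sup>2) * (\<Sum>n<m. (sqrt (c n) * cmod (\<beta> n))\<^sup>2)"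
        by (rule Cauchy_Schwarz_ineq_sum)
      also have "\<dots> = (\<Sum>n<m. (cmod (a n))\<^sup>2 / c n) * (\<Sum>n<m. c n * (cmod (\<beta> n))\<^sup>2)"
        using c_pos by (simp add: power_divide power_mult_distrib less_imp_le)
      also have "\<dots> \<le> A * (K * X)"
        using SA S3 A0 by (intro mult_mono sum_nonneg mult_nonneg_nonneg less_imp_le[OF c_pos]) auto
      finally show "(\<Sum>n<m. (cmod (a n) / sqrt (c n)) * (sqrt (c n) * cmod (\<beta> n)))\<^sup>2 \<le> A * (K * X)" .
    qed
    finally show ?thesis .
  qed
  have "cmod (of_real X) \<le> sqrt (A * (K * X))"
    by (rule LIMSEQ_le_const2[OF tendsto_norm[OF lim1]]) (use CS in blast)
  then have "X \<le> sqrt (A * (K * X))" using X0 by simp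
  then have "X\<^sup>2 \<le> A * (K * X)"
    using X0 A0 K(2) by (metis mult_nonneg_nonneg power_mono real_sqrt_pow2)
  then have "X * X \<le> (A * K) * X" by (simp add: power2_eq_square mult.assoc)
  then have "X \<le> A * K"
    using X0 A0 K(2) by (cases "X = 0") (auto simp: mult_le_cancel_right)
  have "(\<integral>\<^sup>+z\<in>cball 0 \<rho>. ennreal ((cmod (h z))\<^sup>2) \<partial>M) = (\<integral>\<^sup>+z. ennreal ((cmod (H z))\<^sup>2) \<partial>N)"
    by (subst nnN, measurable) (auto intro!: nn_integral_cong simp: H_def split: split_indicator)
  also have "\<dots> \<le> ennreal (A * K)" unfolding X_nn by (rule ennreal_leI[OF \<open>X \<le> A * K\<close>])
  finally show ?thesis unfolding A_def by simp
qed

theorem dirichlet_embedding: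
  assumes p: "0 < p" and M: "sets M = sets borel"
    and K: "\<And>a. a \<in> unit_disc \<Longrightarrow> (\<integral>\<^sup>+z\<in>unit_disc. ennreal (cmod (1 - cnj a * z) powr (-p)) \<partial>M) \<le> ennreal K" "0 \<le> K"
    and h: "h holomorphic_on unit_disc" "h 0 = 0"
    and E: "Qp_energy p h 0 \<le> ennreal E" "0 \<le> E"
  shows "(\<integral>\<^sup>+z\<in>unit_disc. ennreal ((cmod (h z))\<^sup>2) \<partial>M) \<le> ennreal ((1 + p) / (pi * p) * E * K)"
proof (rule nn_integral_disc_exhaust[OF M])
  have [measurable]: "(\<lambda>z. indicator unit_disc z *\<^sub>R h z) \<in> borel_measurable borel"
    by (intro borel_measurable_continuous_on_indicator holomorphic_on_imp_continuous_on h) auto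
  have "(\<lambda>z. ennreal ((cmod (indicator unit_disc z *\<^sub>R h z))\<^sup>2) * indicator unit_disc z) \<in> borel_measurable borel"
    by measurable
  also have "(\<lambda>z. ennreal ((cmod (indicator unit_disc z *\<^sub>R h z))\<^sup>2) * indicator unit_disc z) =
     (\<lambda>z. ennreal ((cmod (h z))\<^sup>2) * indicator unit_disc z)"
    by (auto simp: fun_eq_iff split: split_indicator)
  finally show "(\<lambda>z. ennreal ((cmod (h z))\<^sup>2) * indicator unit_disc z) \<in> borel_measurable borel" .
qed (rule dirichlet_embedding_truncated[OF p M K h E])

section \<open>The norm, Bloch and growth estimates\<close>

lemma Qp_energy_le_norm:
  assumes "f \<in> Qp p" "w \<in> unit_disc"
  shows "Qp_energy p f w \<le> ennreal ((Qp_norm p f)\<^sup>2)"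
proof -
  have fin: "Qp_enorm p f < top" using assms by (simp add: Qp_def)
  have "ennreal_sqrt (Qp_energy p f w) \<le> (SUP w\<in>unit_disc. ennreal_sqrt (Qp_energy p f w))"
    by (rule SUP_upper[OF assms(2)])
  also have "\<dots> \<le> Qp_enorm p f" unfolding Qp_enorm_altdef by (rule add_increasing) auto
  also have "\<dots> = ennreal (Qp_norm p f)" using fin by (simp add: Qp_norm_def)
  finally show ?thesis by (subst (asm) ennreal_sqrt_le_iff) (auto simp: Qp_norm_def)
qed

lemma norm_0_le_Qp_norm:
  assumes "f \<in> Qp p"
  shows "cmod (f 0) \<le> Qp_norm p f"
proof -
  have "Qp_enorm p f < top" using assms by (simp add: Qp_def)
  then have "ennreal (Qp_norm p f) = Qp_enorm p f" by (simp add: Qp_norm_def)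
  moreover have "ennreal (cmod (f 0)) \<le> Qp_enorm p f"
    unfolding Qp_enorm_altdef by (rule add_increasing2) auto
  ultimately have "ennreal (cmod (f 0)) \<le> ennreal (Qp_norm p f)" by simp
  then show ?thesis by (subst (asm) ennreal_le_iff) (auto simp: Qp_norm_def)
qed

lemma Qp_norm_nonneg: "0 \<le> Qp_norm p f"
  by (simp add: Qp_norm_def)

lemma Qp_enorm_le:
  assumes A: "0 \<le> A" "\<And>w. w \<in> unit_disc \<Longrightarrow> Qp_energy p f w \<le> ennreal (A\<^sup>2)" and B: "cmod (f 0) \<le> B"
  shows "Qp_enorm p f \<le> ennreal (B + A)"
proof -
  have "0 \<le> B" using B norm_ge_zero order.trans by blast
  have "Qp_enorm p f \<le> ennreal B + ennreal A"
    unfolding Qp_enorm_altdef using A B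
    by (intro add_mono SUP_least ennreal_leI) (auto simp: ennreal_sqrt_le_iff)
  then show ?thesis using \<open>0 \<le> B\<close> A(1) by simp
qed

lemma Qp_norm_le:
  assumes "0 \<le> A" "\<And>w. w \<in> unit_disc \<Longrightarrow> Qp_energy p f w \<le> ennreal (A\<^sup>2)" and "cmod (f 0) \<le> B"
  shows "Qp_norm p f \<le> B + A"
proof -
  have "0 \<le> B" using assms(3) norm_ge_zero order.trans by blast
  then show ?thesis using Qp_enorm_le[OF assms] assms(1)
    unfolding Qp_norm_def by (intro enn2real_leI) auto
qed

lemma QpI:
  assumes "f holomorphic_on unit_disc" "\<And>z. z \<notin> unit_disc \<Longrightarrow> f z = 0"
    "0 \<le> A" "\<And>w. w \<in> unit_disc \<Longrightarrow> Qp_energy p f w \<le> ennreal (A\<^sup>2)"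
  shows "f \<in> Qp p"
  using assms(1,2) order.strict_trans1[OF Qp_enorm_le[OF assms(3,4) order_refl] ennreal_less_top]
  by (auto simp: Qp_def)

lemma Qp_holomorphic: "f \<in> Qp p \<Longrightarrow> f holomorphic_on unit_disc"
  by (simp add: Qp_def)

lemma Qp_outside: "f \<in> Qp p \<Longrightarrow> z \<notin> unit_disc \<Longrightarrow> f z = 0"
  by (auto simp: Qp_def)

text \<open>
  The constant \<open>\<pi> * Beta 1 (p + 1)\<close> is the integral of the weight \<open>(1 - \<bar>z\<bar>\<^sup>2)\<^sup>p\<close>.
\<close>

definition bloch_const :: "real \<Rightarrow> real" where
  "bloch_const p = 1 / sqrt (pi * Beta 1 (p + 1))"

lemma Beta_pos: "0 < a \<Longrightarrow> 0 < b \<Longrightarrow> 0 < Beta a (b::real)"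
  unfolding Beta_def by (intro divide_pos_pos mult_pos_pos Gamma_real_pos) auto

lemma bloch_const_pos: "0 < p \<Longrightarrow> 0 < bloch_const p"
  by (simp add: bloch_const_def Beta_pos)

text \<open>
  The composition \<open>f \<circ> \<sigma>\<^sub>w\<close> has derivative of modulus \<open>(1 - \<bar>w\<bar>\<^sup>2) * \<bar>f' w\<bar>\<close> at \<open>0\<close>, and its energy at \<open>0\<close>
  is at least the contribution of this single Taylor coefficient.
\<close>

lemma bloch_estimate:
  assumes p: "0 < p" and f: "f holomorphic_on unit_disc" and w: "w \<in> unit_disc"
    and E: "Qp_energy p f w \<le> ennreal (A\<^sup>2)" and A: "0 \<le> A"
  shows "(1 - (cmod w)\<^sup>2) * cmod (deriv f w) \<le> bloch_const p * A"
proof -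
  define h where "h = (\<lambda>z. f (disc_aut w z))"
  define B where "B = pi * Beta 1 (p + 1)"
  have B: "0 < B" using p by (simp add: B_def Beta_pos)
  have h: "h holomorphic_on unit_disc" unfolding h_def by (rule holomorphic_comp_disc_aut[OF f w])
  have "deriv h 0 = deriv f w * (- (1 - cnj w * w))"
    unfolding h_def by (subst deriv_comp_disc_aut[OF f w]) auto
  then have d: "cmod (deriv h 0) = (1 - (cmod w)\<^sup>2) * cmod (deriv f w)"
    using norm_one_minus_cnj_mult_self[OF w] by (simp only: norm_mult norm_minus_cancel mult.commute)
  have "ennreal ((cmod (deriv h 0))\<^sup>2 * B) \<le> Qp_energy p h 0"
    using bessel_energy[OF p h, of 1] by (simp add: taylor_coeff_def B_def)
  also have "\<dots> \<le> ennreal (A\<^sup>2)" using E unfolding Qp_energy_conformal[OF f w] h_def .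
  finally have "(cmod (deriv h 0))\<^sup>2 * B \<le> A\<^sup>2" by (simp add: ennreal_le_iff)
  then have "(cmod (deriv h 0) * sqrt B)\<^sup>2 \<le> A\<^sup>2" using B by (simp add: power_mult_distrib)
  then have "cmod (deriv h 0) * sqrt B \<le> A" using A by (rule power2_le_imp_le)
  then show ?thesis using B unfolding d bloch_const_def B_def[symmetric] by (simp add: field_simps)
qed

text \<open>
  Integrate the Bloch bound along the radius.
\<close>

lemma growth_estimate:
  assumes p: "0 < p" and f: "f holomorphic_on unit_disc" and z: "z \<in> unit_disc"
    and E: "\<And>w. w \<in> unit_disc \<Longrightarrow> Qp_energy p f w \<le> ennreal (A\<^sup>2)" and A: "0 \<le> A"
  shows "cmod (f z - f 0) \<le> bloch_const p * A * ln (1 / (1 - cmod z))"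
proof -
  define B where "B = bloch_const p * A"
  define r where "r = cmod z"
  have r: "0 \<le> r" "r < 1" using z by (auto simp: r_def)
  have B: "0 \<le> B" unfolding B_def using bloch_const_pos[OF p] A by simp
  have disc: "of_real t * z \<in> unit_disc" if "0 \<le> t" "t \<le> 1" for t
  proof -
    have "t * cmod z \<le> 1 * cmod z" using that by (intro mult_right_mono) auto
    then show ?thesis using z that by (simp add: norm_mult)
  qed
  have pos: "0 < 1 - t * r" if "0 \<le> t" "t \<le> 1" for t
    using disc[OF that] that by (simp add: norm_mult r_def)
  have "norm (f (of_real 1 * z) - f (of_real 0 * z)) \<le> - B * ln (1 - 1 * r) - (- B * ln (1 - 0 * r))"
  proof (rule differentiable_bound_general[where a = "0::real" and b = 1
        and f = "\<lambda>t. f (of_real t * z)" and \<phi> = "\<lambda>t. - B * ln (1 - t * r)"])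
    show "continuous_on {0..1} (\<lambda>t. f (complex_of_real t * z))"
      by (rule continuous_on_compose2[OF holomorphic_on_imp_continuous_on[OF f]])
         (use disc in \<open>auto intro!: continuous_intros\<close>)
    show "continuous_on {0..1} (\<lambda>t. - B * ln (1 - t * r))"
      using pos by (intro continuous_intros) (auto simp: less_imp_neq[symmetric])
    fix t :: real assume t: "0 < t" "t < 1"
    have dd: "of_real t * z \<in> unit_disc" using t by (intro disc) auto
    have "((\<lambda>t. f (of_real t * z)) has_vector_derivative (z * deriv f (of_real t * z))) (at t)"
    proof -
      have "((\<lambda>t. of_real t * z) has_vector_derivative z) (at t)"
        by (simp add: has_vector_derivative_def scaleR_conv_of_real[symmetric]
            bounded_linear_imp_has_derivative bounded_linear_scaleR_left)
      from field_vector_diff_chain_at[OF this holomorphic_derivI[OF f open_ball dd]]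
      show ?thesis by (simp add: o_def)
    qed
    then show "((\<lambda>t. f (of_real t * z)) has_vector_derivative (z * deriv f (of_real t * z))) (at t)" .
    show "((\<lambda>t. - B * ln (1 - t * r)) has_vector_derivative (B * r / (1 - t * r))) (at t)"
      unfolding has_real_derivative_iff_has_vector_derivative[symmetric]
      using pos[of t] t by (auto intro!: derivative_eq_intros)
    show "norm (z * deriv f (of_real t * z)) \<le> B * r / (1 - t * r)"
    proof -
      have tr: "0 < 1 - t * r" "0 \<le> t * r" using pos[of t] t r by auto
      have "(1 - (cmod (of_real t * z))\<^sup>2) * cmod (deriv f (of_real t * z)) \<le> B"
        unfolding B_def by (rule bloch_estimate[OF p f dd E[OF dd] A])
      moreover have "cmod (of_real t * z) = t * r" using t by (simp add: norm_mult r_def)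
      moreover have "1 - (t * r)\<^sup>2 \<ge> 1 - t * r"
        using tr by (simp add: power2_eq_square mult_left_le)
      ultimately have "(1 - t * r) * cmod (deriv f (of_real t * z)) \<le> B"
        by (metis mult_right_mono norm_ge_zero order.trans)
      then have "cmod (deriv f (of_real t * z)) \<le> B / (1 - t * r)"
        using tr by (simp add: field_simps)
      from mult_left_mono[OF this r(1)] show ?thesis by (simp add: norm_mult r_def mult.commute)
    qed
  qed simp
  then show ?thesis using r unfolding B_def[symmetric] r_def[symmetric] by (simp add: ln_div)
qed

section \<open>The energy of logarithms\<close>

text \<open>
  Expand \<open>1 / (1 - cnj b * z)\<close> in a geometric series. By orthogonality the powers of \<open>\<bar>b\<bar>\<close> may be
  replaced by \<open>1\<close>; then \<open>\<Sum> \<bar>z\<bar>\<^bsup>2n\<^esup> = 1 / (1 - \<bar>z\<bar>\<^sup>2)\<close> lowers the exponent of the weight from \<open>p\<close> to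
  \<open>p - 1\<close>, which is still integrable.
\<close>

lemma log_kernel_at_origin:
  assumes p: "0 < p" and b: "b \<in> unit_disc"
  shows "(\<integral>\<^sup>+z\<in>unit_disc. ennreal ((1 / cmod (1 - cnj b * z))\<^sup>2 * (1 - (cmod z)\<^sup>2) powr p) \<partial>lborel)
     \<le> ennreal (pi * Beta 1 p)"
proof -
  define \<phi> where "\<phi> = (\<lambda>r::real. (1 - r\<^sup>2) powr p)"
  have \<phi>_meas [measurable]: "\<phi> \<in> borel_measurable borel" unfolding \<phi>_def by measurable
  have \<phi>0: "0 \<le> \<phi> r" for r by (simp add: \<phi>_def)
  have le1: "\<phi> r \<le> 1" if "0 \<le> r" "r < 1" for r
    unfolding \<phi>_def using that p by (intro powr_le1) (auto simp: power_le_one)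
  define T where "T = (\<lambda>m z. \<Sum>n<m. cnj b ^ n * z ^ n)"
  have T_le: "(\<integral>\<^sup>+z\<in>unit_disc. ennreal ((cmod (T m z))\<^sup>2 * \<phi> (cmod z)) \<partial>lborel) \<le> ennreal (pi * Beta 1 p)" for m
  proof -
    have "(\<integral>\<^sup>+z\<in>unit_disc. ennreal ((cmod (T m z))\<^sup>2 * \<phi> (cmod z)) \<partial>lborel) =
       (\<Sum>n<m. ennreal ((cmod (cnj b ^ n))\<^sup>2) * (\<integral>\<^sup>+z\<in>unit_disc. ennreal (((cmod z)\<^sup>2) ^ n * \<phi> (cmod z)) \<partial>lborel))"
      unfolding T_def by (rule nn_integral_norm_polynomial_sq[OF \<phi>_meas \<phi>0 le1])
    also have "\<dots> \<le> (\<Sum>n<m. 1 * (\<integral>\<^sup>+z\<in>unit_disc. ennreal (((cmod z)\<^sup>2) ^ n * \<phi> (cmod z)) \<partial>lborel))"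
    proof (intro sum_mono mult_right_mono)
      fix n
      have "(cmod (cnj b ^ n))\<^sup>2 \<le> 1" using b by (auto simp: norm_power intro!: power_le_one)
      then show "ennreal ((cmod (cnj b ^ n))\<^sup>2) \<le> 1" by (simp add: ennreal_le_1)
    qed auto
    also have "\<dots> = (\<integral>\<^sup>+z. (\<Sum>n<m. ennreal (((cmod z)\<^sup>2) ^ n * \<phi> (cmod z)) * indicator unit_disc z) \<partial>lborel)"
      unfolding mult_1_left by (rule nn_integral_sum[symmetric]) measurable
    also have "\<dots> \<le> (\<integral>\<^sup>+z\<in>unit_disc. ennreal ((1 - (cmod z)\<^sup>2) powr (p - 1)) \<partial>lborel)"
    proof (rule nn_integral_mono)
      fix z :: complex
      show "(\<Sum>n<m. ennreal (((cmod z)\<^sup>2) ^ n * \<phi> (cmod z)) * indicator unit_disc z) \<le>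
         ennreal ((1 - (cmod z)\<^sup>2) powr (p - 1)) * indicator unit_disc z"
      proof (cases "z \<in> unit_disc")
        case True
        define x where "x = (cmod z)\<^sup>2"
        have x: "0 \<le> x" "x < 1" using True by (auto simp: x_def power_less_one_iff)
        have "(\<Sum>n<m. x ^ n) = (1 - x ^ m) / (1 - x)"
          using x sum_gp_strict[of x m] by simp
        also have "\<dots> \<le> 1 / (1 - x)" using x by (intro divide_right_mono) auto
        finally have "(\<Sum>n<m. x ^ n) * (1 - x) powr p \<le> 1 / (1 - x) * (1 - x) powr p"
          by (rule mult_right_mono) simp
        also have "\<dots> = (1 - x) powr (p - 1)" using x by (simp add: powr_diff)
        finally show ?thesis using True x unfolding \<phi>_def x_def[symmetric]
          by (subst (1) sum.cong[OF refl, where h = "\<lambda>n. ennreal (x ^ n * (1 - x) powr p)"])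
             (auto simp: sum_distrib_right intro!: ennreal_leI)
      qed simp
    qed
    also have "\<dots> = ennreal pi * (\<integral>\<^sup>+t\<in>{0..1}. ennreal ((1 - t) powr (p - 1)) \<partial>lborel)"
      by (rule nn_integral_disc_radial) measurable
    also have "(\<integral>\<^sup>+t\<in>{0..1}. ennreal ((1 - t) powr (p - 1)) \<partial>lborel) =
       (\<integral>\<^sup>+t\<in>{0..1}. ennreal (t powr (1 - 1) * (1 - t) powr (p - 1)) \<partial>lborel)"
      by (intro nn_integral_cong_AE eventually_mono[OF AE_lborel_singleton[of 0]])
         (auto split: split_indicator)
    also have "\<dots> = ennreal (Beta 1 p)"
      by (rule nn_integral_has_integral_lebesgue'[OF _ has_integral_Beta_real]) (use p in auto)
    finally show ?thesis by (simp only: ennreal_mult'[symmetric, of pi] pi_ge_zero)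
  qed
  have "(\<integral>\<^sup>+z\<in>unit_disc. ennreal ((1 / cmod (1 - cnj b * z))\<^sup>2 * (1 - (cmod z)\<^sup>2) powr p) \<partial>lborel) \<le>
     (\<integral>\<^sup>+z. liminf (\<lambda>m. ennreal ((cmod (T m z))\<^sup>2 * \<phi> (cmod z)) * indicator unit_disc z) \<partial>lborel)"
  proof (rule nn_integral_mono)
    fix z :: complex
    have "(\<lambda>m. ennreal ((cmod (T m z))\<^sup>2 * \<phi> (cmod z)) * indicator unit_disc z) \<longlonglongrightarrow>
       ennreal ((1 / cmod (1 - cnj b * z))\<^sup>2 * (1 - (cmod z)\<^sup>2) powr p) * indicator unit_disc z"
    proof (cases "z \<in> unit_disc")
      case True
      have "cmod (cnj b * z) < 1"
        using True b mult_strict_mono'[of "cmod b" 1 "cmod z" 1] by (simp add: norm_mult)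
      from geometric_sums[OF this] have "(\<lambda>m. T m z) \<longlonglongrightarrow> 1 / (1 - cnj b * z)"
        unfolding T_def sums_def by (simp add: power_mult_distrib)
      then have "(\<lambda>m. ennreal ((cmod (T m z))\<^sup>2 * \<phi> (cmod z))) \<longlonglongrightarrow>
         ennreal ((cmod (1 / (1 - cnj b * z)))\<^sup>2 * \<phi> (cmod z))"
        by (intro tendsto_intros)
      then show ?thesis using True by (simp add: norm_divide \<phi>_def)
    qed simp
    then show "ennreal ((1 / cmod (1 - cnj b * z))\<^sup>2 * (1 - (cmod z)\<^sup>2) powr p) * indicator unit_disc z \<le>
       liminf (\<lambda>m. ennreal ((cmod (T m z))\<^sup>2 * \<phi> (cmod z)) * indicator unit_disc z)"
      by (simp add: lim_imp_Liminf)
  qed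
  also have "\<dots> \<le> liminf (\<lambda>m. \<integral>\<^sup>+z\<in>unit_disc. ennreal ((cmod (T m z))\<^sup>2 * \<phi> (cmod z)) \<partial>lborel)"
    by (rule nn_integral_liminf) (unfold T_def, measurable)
  also have "\<dots> \<le> ennreal (pi * Beta 1 p)"
    by (rule order.trans[OF Liminf_mono Liminf_const[THEN eq_refl]]) (auto simp: T_le)
  finally show ?thesis .
qed

text \<open>
  This bounds the energy of \<open>Ln (1 - cnj w * z)\<close> at \<open>a\<close>, uniformly in \<open>w\<close> and \<open>a\<close>. After the
  substitution \<open>\<sigma>\<^sub>a\<close> the logarithmic derivative becomes
  \<open>cnj a / (1 - cnj a * z) - cnj b / (1 - cnj b * z)\<close> with \<open>b = \<sigma>\<^sub>a w\<close>, and both terms have bounded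
  energy at the origin.
\<close>

lemma log_kernel:
  assumes p: "0 < p" and w: "w \<in> unit_disc" and a: "a \<in> unit_disc"
  shows "(\<integral>\<^sup>+z\<in>unit_disc. ennreal ((cmod w / cmod (1 - cnj w * z))\<^sup>2 * (1 - (cmod (disc_aut a z))\<^sup>2) powr p) \<partial>lborel)
     \<le> ennreal (4 * pi * Beta 1 p)"
proof -
  define b where "b = disc_aut a w"
  have b: "b \<in> unit_disc" unfolding b_def by (rule disc_aut_in_disc[OF a w])
  define C where "C = pi * Beta 1 p"
  have C: "0 \<le> C" unfolding C_def using p by (simp add: Beta_pos less_imp_le)
  let ?F = "\<lambda>z. ennreal ((cmod w / cmod (1 - cnj w * z))\<^sup>2 * (1 - (cmod (disc_aut a z))\<^sup>2) powr p)"
  let ?J = "\<lambda>b z. ennreal ((1 / cmod (1 - cnj b * z))\<^sup>2 * (1 - (cmod z)\<^sup>2) powr p) * indicator unit_disc z"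
  have J_meas: "?J b \<in> borel_measurable lborel" for b by measurable
  have "(\<integral>\<^sup>+z\<in>unit_disc. ?F z \<partial>lborel) =
     (\<integral>\<^sup>+z\<in>unit_disc. ?F (disc_aut a z) * ennreal (((1 - (cmod a)\<^sup>2) / (cmod (1 - cnj a * z))\<^sup>2)\<^sup>2) \<partial>lborel)"
    by (rule nn_integral_disc_aut[OF a]) measurable
  also have "\<dots> \<le> (\<integral>\<^sup>+z. 2 * (?J b z + ?J a z) \<partial>lborel)"
  proof (rule nn_integral_mono)
    fix z :: complex
    show "?F (disc_aut a z) * ennreal (((1 - (cmod a)\<^sup>2) / (cmod (1 - cnj a * z))\<^sup>2)\<^sup>2) * indicator unit_disc z
       \<le> 2 * (?J b z + ?J a z)"
    proof (cases "z \<in> unit_disc")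
      case z: True
      have nz: "1 - cnj a * z \<noteq> 0" "1 - cnj b * z \<noteq> 0" "1 - cnj w * a \<noteq> 0"
        using disc_aut_denominator a b w z by blast+
      have na: "0 < 1 - (cmod a)\<^sup>2" using a by (simp add: power_less_one_iff)
      have "cmod w / cmod (1 - cnj w * disc_aut a z) * ((1 - (cmod a)\<^sup>2) / (cmod (1 - cnj a * z))\<^sup>2)
          = cmod w * (1 - (cmod a)\<^sup>2) / cmod (1 - cnj w * a) / (cmod (1 - cnj b * z) * cmod (1 - cnj a * z))"
        unfolding one_minus_cnj_disc_aut[OF a z w] b_def[symmetric]
        using nz by (simp add: norm_mult norm_divide power2_eq_square)
      also have "cmod w * (1 - (cmod a)\<^sup>2) / cmod (1 - cnj w * a) = cmod (cnj a - cnj b)"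
      proof -
        have "1 - w * cnj a \<noteq> 0" using nz(3) by (metis complex_cnj_cnj complex_cnj_diff complex_cnj_mult complex_cnj_one complex_cnj_zero_iff)
        then have "cnj a - cnj b = cnj w * (1 - cnj a * a) / (1 - cnj w * a)"
          using nz(3) unfolding b_def disc_aut_def by (simp add: field_simps)
        then have "cmod (cnj a - cnj b) = cmod (cnj w) * cmod (1 - cnj a * a) / cmod (1 - cnj w * a)"
          by (simp only: norm_mult norm_divide)
        then show ?thesis using norm_one_minus_cnj_mult_self[OF a] by simp
      qed
      also have "cmod (cnj a - cnj b) / (cmod (1 - cnj b * z) * cmod (1 - cnj a * z)) =
          cmod (cnj a / (1 - cnj a * z) - cnj b / (1 - cnj b * z))"
        unfolding norm_mult[symmetric] norm_divide[symmetric]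
        using nz by (intro arg_cong[where f = cmod]) (simp add: field_simps)
      also have "\<dots> \<le> cmod (cnj a / (1 - cnj a * z)) + cmod (cnj b / (1 - cnj b * z))"
        by (rule norm_triangle_ineq4)
      also have "\<dots> \<le> 1 / cmod (1 - cnj a * z) + 1 / cmod (1 - cnj b * z)"
        using a b by (intro add_mono) (auto simp: norm_divide intro!: divide_right_mono)
      finally have key: "cmod w / cmod (1 - cnj w * disc_aut a z) * ((1 - (cmod a)\<^sup>2) / (cmod (1 - cnj a * z))\<^sup>2)
          \<le> 1 / cmod (1 - cnj a * z) + 1 / cmod (1 - cnj b * z)" .
      have "(cmod w / cmod (1 - cnj w * disc_aut a z) * ((1 - (cmod a)\<^sup>2) / (cmod (1 - cnj a * z))\<^sup>2))\<^sup>2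
         \<le> (1 / cmod (1 - cnj a * z) + 1 / cmod (1 - cnj b * z))\<^sup>2"
        using na by (intro power_mono key) auto
      also have "\<dots> \<le> 2 * ((1 / cmod (1 - cnj b * z))\<^sup>2 + (1 / cmod (1 - cnj a * z))\<^sup>2)"
        using square_sum_le_weighted[of 1 1 "1 / cmod (1 - cnj a * z)" "1 / cmod (1 - cnj b * z)"] by simp
      finally have "(cmod w / cmod (1 - cnj w * disc_aut a z) * ((1 - (cmod a)\<^sup>2) / (cmod (1 - cnj a * z))\<^sup>2))\<^sup>2 * (1 - (cmod z)\<^sup>2) powr p
         \<le> 2 * ((1 / cmod (1 - cnj b * z))\<^sup>2 + (1 / cmod (1 - cnj a * z))\<^sup>2) * (1 - (cmod z)\<^sup>2) powr p"
        by (rule mult_right_mono) simp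
      also have "\<dots> = 2 * ((1 / cmod (1 - cnj b * z))\<^sup>2 * (1 - (cmod z)\<^sup>2) powr p + (1 / cmod (1 - cnj a * z))\<^sup>2 * (1 - (cmod z)\<^sup>2) powr p)"
        by (simp add: algebra_simps)
      finally have fin: "(cmod w / cmod (1 - cnj w * disc_aut a z) * ((1 - (cmod a)\<^sup>2) / (cmod (1 - cnj a * z))\<^sup>2))\<^sup>2 * (1 - (cmod z)\<^sup>2) powr p
         \<le> 2 * ((1 / cmod (1 - cnj b * z))\<^sup>2 * (1 - (cmod z)\<^sup>2) powr p + (1 / cmod (1 - cnj a * z))\<^sup>2 * (1 - (cmod z)\<^sup>2) powr p)" .
      have "?F (disc_aut a z) * ennreal (((1 - (cmod a)\<^sup>2) / (cmod (1 - cnj a * z))\<^sup>2)\<^sup>2) =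
        ennreal ((cmod w / cmod (1 - cnj w * disc_aut a z) * ((1 - (cmod a)\<^sup>2) / (cmod (1 - cnj a * z))\<^sup>2))\<^sup>2 * (1 - (cmod z)\<^sup>2) powr p)"
      proof -
        have "ennreal (s\<^sup>2 * q) * ennreal (t\<^sup>2) = ennreal ((s * t)\<^sup>2 * q)" if "0 \<le> q" for s t q :: real
          using that by (simp add: ennreal_mult[symmetric] power_mult_distrib mult_ac)
        then show ?thesis unfolding disc_aut_involution[OF a z] by simp
      qed
      also have "\<dots> \<le> ennreal (2 * ((1 / cmod (1 - cnj b * z))\<^sup>2 * (1 - (cmod z)\<^sup>2) powr p + (1 / cmod (1 - cnj a * z))\<^sup>2 * (1 - (cmod z)\<^sup>2) powr p))"
        by (rule ennreal_leI[OF fin])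
      also have "\<dots> = 2 * (?J b z + ?J a z)"
        using z by (subst ennreal_mult) (auto simp: ennreal_plus)
      finally show ?thesis using z by simp
    qed simp
  qed
  also have "\<dots> = 2 * ((\<integral>\<^sup>+z. ?J b z \<partial>lborel) + (\<integral>\<^sup>+z. ?J a z \<partial>lborel))"
    by (subst nn_integral_cmult, intro borel_measurable_add J_meas, subst nn_integral_add[OF J_meas J_meas])
       (rule refl)
  also have "\<dots> \<le> 2 * (ennreal C + ennreal C)"
    unfolding C_def by (intro mult_left_mono add_mono log_kernel_at_origin[OF p] a b) auto
  also have "\<dots> = ennreal (2 * (C + C))"
    using C by (subst ennreal_mult, simp, simp, subst ennreal_plus) (simp_all only: ennreal_numeral zero_le_numeral)
  finally show ?thesis by (simp add: C_def algebra_simps)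
qed

section \<open>Logarithmic test functions\<close>

text \<open>
  The additive constant keeps the real part positive and comparable to \<open>log_size w\<close> on Carleson
  squares. Its value is \<open>10\<^sup>2\<close> because \<open>\<bar>1 - cnj w * z\<bar> \<le> 10 * l\<close> on the square over an arc of length
  \<open>l = 1 - \<bar>w\<bar>\<close>, and \<open>ln (10 / l) \<ge> ln (10\<^sup>2 / l) / 2\<close>.
\<close>

definition log_fn :: "complex \<Rightarrow> complex \<Rightarrow> complex" where
  "log_fn w z = of_real (ln 100) - Ln (1 - cnj w * z)"

text \<open>
  The value of \<open>log_fn w\<close> at \<open>w\<close>.
\<close>

definition log_size :: "complex \<Rightarrow> real" where
  "log_size w = ln (100 / (1 - (cmod w)\<^sup>2))"

text \<open>
  The quotient has the size of the logarithm near \<open>w\<close> but, unlike the logarithm, tends to \<open>0\<close> locally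
  uniformly as \<open>w\<close> approaches the unit circle, which is what compactness arguments require.
\<close>

definition test_fn :: "complex \<Rightarrow> complex \<Rightarrow> complex" where
  "test_fn w z = (if z \<in> unit_disc then (log_fn w z)\<^sup>2 / of_real (log_size w) else 0)"

lemma ln_100_ge: "4 \<le> ln (100::real)"
proof -
  have "1 \<le> ln (3::real)" using exp_le by (subst ln_ge_iff) auto
  moreover have "ln (81::real) = 4 * ln 3" using ln_realpow[of 3 4] by simp
  moreover have "ln (81::real) \<le> ln 100" by simp
  ultimately show ?thesis by linarith
qed

lemma norm_sq_disc: "w \<in> unit_disc \<Longrightarrow> 0 < 1 - (cmod w)\<^sup>2" "1 - (cmod w)\<^sup>2 \<le> 1"
  by (simp_all add: power_less_one_iff)

lemma log_size_ge: "w \<in> unit_disc \<Longrightarrow> ln 100 \<le> log_size w"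
  unfolding log_size_def using norm_sq_disc[of w] by (simp add: field_simps)

lemma log_size_pos: "w \<in> unit_disc \<Longrightarrow> 0 < log_size w"
  using log_size_ge[of w] ln_100_ge by linarith

lemma Re_one_minus_pos:
  assumes "w \<in> unit_disc" "z \<in> unit_disc" shows "0 < Re (1 - cnj w * z)"
proof -
  have "cmod (cnj w * z) < 1"
    using assms mult_strict_mono'[of "cmod w" 1 "cmod z" 1] by (simp add: norm_mult)
  then show ?thesis using complex_Re_le_cmod[of "cnj w * z"] by simp
qed

lemma norm_one_minus_ge:
  assumes "w \<in> unit_disc" "z \<in> unit_disc"
  shows "1 - cmod w \<le> cmod (1 - cnj w * z)" "1 - cmod z \<le> cmod (1 - cnj w * z)" "cmod (1 - cnj w * z) \<le> 2"
proof -
  have "cmod 1 - cmod (cnj w * z) \<le> cmod (1 - cnj w * z)" by (rule norm_triangle_ineq2)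
  moreover have "cmod w * cmod z \<le> cmod w * 1" "cmod w * cmod z \<le> 1 * cmod z"
    using assms by (intro mult_left_mono mult_right_mono; simp)+
  ultimately show "1 - cmod w \<le> cmod (1 - cnj w * z)" "1 - cmod z \<le> cmod (1 - cnj w * z)"
    by (simp_all add: norm_mult)
  have "cmod (1 - cnj w * z) \<le> cmod 1 + cmod (cnj w * z)" by (rule norm_triangle_ineq4)
  with \<open>cmod w * cmod z \<le> cmod w * 1\<close> assms show "cmod (1 - cnj w * z) \<le> 2"
    by (simp add: norm_mult)
qed

lemma log_fn_has_field_derivative:
  assumes w: "w \<in> unit_disc" and z: "z \<in> unit_disc"
  shows "(log_fn w has_field_derivative (cnj w / (1 - cnj w * z))) (at z)"
proof -
  have "1 - cnj w * z \<notin> \<real>\<^sub>\<le>\<^sub>0"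
    using Re_one_minus_pos[OF w z] by (auto simp: complex_nonpos_Reals_iff)
  then show ?thesis unfolding log_fn_def
    using disc_aut_denominator[OF w z] by (auto intro!: derivative_eq_intros simp: field_simps)
qed

lemma Re_log_fn:
  assumes "w \<in> unit_disc" "z \<in> unit_disc" shows "Re (log_fn w z) = ln (100 / cmod (1 - cnj w * z))"
  using disc_aut_denominator[OF assms] by (simp add: log_fn_def ln_div)

lemma norm_log_fn_le:
  assumes w: "w \<in> unit_disc" and z: "z \<in> unit_disc"
  shows "cmod (log_fn w z) \<le> ln (100 / cmod (1 - cnj w * z)) + 2"
proof -
  have "\<bar>Im (log_fn w z)\<bar> < pi / 2"
    using Re_Ln_pos_lt_imp[OF Re_one_minus_pos[OF w z]] by (simp add: log_fn_def)
  moreover have "pi < 4" using pi_less_4 .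
  moreover have "0 \<le> ln (100 / cmod (1 - cnj w * z))"
    using norm_one_minus_ge(3)[OF w z] disc_aut_denominator[OF w z] by (intro ln_ge_zero) (simp add: field_simps)
  ultimately show ?thesis using cmod_le[of "log_fn w z"] Re_log_fn[OF w z] by linarith
qed

text \<open>
  The bounds \<open>\<pi> / 2 < 2\<close> on the argument and \<open>ln 2 < 1\<close> are absorbed by \<open>log_size w \<ge> ln 100 \<ge> 4\<close>.
\<close>

lemma norm_log_fn_le_size:
  assumes w: "w \<in> unit_disc" and z: "z \<in> unit_disc"
  shows "cmod (log_fn w z) \<le> 2 * log_size w"
proof -
  have w1: "0 < 1 - cmod w" using w by simp
  have "100 / cmod (1 - cnj w * z) \<le> 100 / (1 - cmod w)"
    using norm_one_minus_ge(1)[OF w z] w1 by (intro divide_left_mono mult_pos_pos) auto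
  also have "\<dots> \<le> 2 * (100 / (1 - (cmod w)\<^sup>2))"
  proof -
    have "1 - (cmod w)\<^sup>2 = (1 - cmod w) * (1 + cmod w)" by (simp add: power2_eq_square algebra_simps)
    also have "\<dots> \<le> (1 - cmod w) * 2" using w1 by (intro mult_left_mono) auto
    finally show ?thesis using w1 norm_sq_disc(1)[OF w] by (simp add: divide_simps)
  qed
  finally have "ln (100 / cmod (1 - cnj w * z)) \<le> ln (2 * (100 / (1 - (cmod w)\<^sup>2)))"
    using disc_aut_denominator[OF w z] by (subst ln_le_cancel_iff) (use norm_sq_disc(1)[OF w] in auto)
  also have "\<dots> = ln 2 + log_size w"
    unfolding log_size_def using norm_sq_disc(1)[OF w] by (subst ln_mult_pos) auto
  finally have "cmod (log_fn w z) \<le> ln 2 + log_size w + 2" using norm_log_fn_le[OF w z] by linarith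
  then show ?thesis using log_size_ge[OF w] ln_100_ge ln_2_less_1 by linarith
qed

lemma norm_log_fn_le_radius:
  assumes w: "w \<in> unit_disc" and z: "cmod z \<le> r" "r < 1"
  shows "cmod (log_fn w z) \<le> ln (100 / (1 - r)) + 2"
proof -
  have zd: "z \<in> unit_disc" using z by simp
  have "100 / cmod (1 - cnj w * z) \<le> 100 / (1 - r)"
    using norm_one_minus_ge(2)[OF w zd] z by (intro divide_left_mono) (auto intro!: mult_pos_pos disc_aut_denominator[OF w zd])
  then have "ln (100 / cmod (1 - cnj w * z)) \<le> ln (100 / (1 - r))"
    using disc_aut_denominator[OF w zd] z by (subst ln_le_cancel_iff) auto
  then show ?thesis using norm_log_fn_le[OF w zd] by linarith
qed

lemma test_fn_has_field_derivative:
  assumes w: "w \<in> unit_disc" and z: "z \<in> unit_disc"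
  shows "(test_fn w has_field_derivative
      (2 * log_fn w z * (cnj w / (1 - cnj w * z)) / of_real (log_size w))) (at z)"
proof -
  have "((\<lambda>z. (log_fn w z)\<^sup>2 / of_real (log_size w)) has_field_derivative
      (2 * log_fn w z * (cnj w / (1 - cnj w * z)) / of_real (log_size w))) (at z)"
    using log_size_pos[OF w]
    by (auto intro!: derivative_eq_intros log_fn_has_field_derivative[OF w z])
  then show ?thesis
    by (rule DERIV_cong_ev[OF refl _ refl, THEN iffD1, rotated])
       (use z in \<open>auto simp: test_fn_def intro!: eventually_mono[OF eventually_nhds_in_open[OF open_ball z]]\<close>)
qed

lemma deriv_test_fn:
  assumes "w \<in> unit_disc" "z \<in> unit_disc"
  shows "deriv (test_fn w) z = 2 * log_fn w z * (cnj w / (1 - cnj w * z)) / of_real (log_size w)"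
  by (rule DERIV_imp_deriv[OF test_fn_has_field_derivative[OF assms]])

lemma test_fn_holomorphic: "w \<in> unit_disc \<Longrightarrow> test_fn w holomorphic_on unit_disc"
  unfolding holomorphic_on_open[OF open_ball] using test_fn_has_field_derivative by blast

lemma log_fn_self: "w \<in> unit_disc \<Longrightarrow> log_fn w w = of_real (log_size w)"
proof -
  assume w: "w \<in> unit_disc"
  have "1 - cnj w * w = of_real (1 - (cmod w)\<^sup>2)"
    using complex_norm_square[of w] by (simp add: mult.commute)
  then show ?thesis unfolding log_fn_def log_size_def using norm_sq_disc(1)[OF w]
    by (simp add: Ln_of_real ln_div del: of_real_diff) (simp only: of_real_diff)
qed

lemma test_fn_self: "w \<in> unit_disc \<Longrightarrow> test_fn w w = of_real (log_size w)"
  using log_size_pos[of w] by (simp add: test_fn_def log_fn_self power2_eq_square)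

lemma deriv_test_fn_self:
  "w \<in> unit_disc \<Longrightarrow> cmod (deriv (test_fn w) w) = 2 * cmod w / (1 - (cmod w)\<^sup>2)"
  using log_size_pos[of w] norm_one_minus_cnj_mult_self[of w]
  by (simp add: deriv_test_fn log_fn_self norm_mult norm_divide)

definition test_const :: "real \<Rightarrow> real" where
  "test_const p = ln 100 + 8 * sqrt (pi * Beta 1 p)"

text \<open>
  The derivative of the square has one factor \<open>log_fn w / log_size w\<close>, of modulus at most \<open>2\<close>, and
  one factor that is the derivative of a logarithm.
\<close>

lemma test_fn_Qp:
  assumes p: "0 < p" and w: "w \<in> unit_disc"
  shows "test_fn w \<in> Qp p" "Qp_norm p (test_fn w) \<le> test_const p"
proof -
  have C: "0 \<le> pi * Beta 1 p" using p by (simp add: Beta_pos less_imp_le)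
  have E: "Qp_energy p (test_fn w) a \<le> ennreal ((8 * sqrt (pi * Beta 1 p))\<^sup>2)" if a: "a \<in> unit_disc" for a
  proof -
    have "Qp_energy p (test_fn w) a \<le> (\<integral>\<^sup>+z. 16 * (ennreal ((cmod w / cmod (1 - cnj w * z))\<^sup>2 *
       (1 - (cmod (disc_aut a z))\<^sup>2) powr p) * indicator unit_disc z) \<partial>lborel)"
      unfolding Qp_energy_def
    proof (rule nn_integral_mono)
      fix z :: complex
      show "ennreal ((cmod (deriv (test_fn w) z))\<^sup>2 * (1 - (cmod (disc_aut a z))\<^sup>2) powr p) * indicator unit_disc z \<le>
         16 * (ennreal ((cmod w / cmod (1 - cnj w * z))\<^sup>2 * (1 - (cmod (disc_aut a z))\<^sup>2) powr p) * indicator unit_disc z)"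
      proof (cases "z \<in> unit_disc")
        case z: True
        have "cmod (deriv (test_fn w) z) = 2 * (cmod (log_fn w z) / log_size w) * (cmod w / cmod (1 - cnj w * z))"
          using log_size_pos[OF w] by (simp add: deriv_test_fn[OF w z] norm_mult norm_divide)
        also have "\<dots> \<le> 2 * 2 * (cmod w / cmod (1 - cnj w * z))"
          using norm_log_fn_le_size[OF w z] log_size_pos[OF w]
          by (intro mult_right_mono mult_left_mono) (auto simp: pos_divide_le_eq)
        finally have "(cmod (deriv (test_fn w) z))\<^sup>2 \<le> (4 * (cmod w / cmod (1 - cnj w * z)))\<^sup>2"
          by (intro power_mono) auto
        also have "\<dots> = 16 * (cmod w / cmod (1 - cnj w * z))\<^sup>2" by (simp only: power_mult_distrib) simp
        finally have "(cmod (deriv (test_fn w) z))\<^sup>2 * (1 - (cmod (disc_aut a z))\<^sup>2) powr p \<le>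
            16 * (cmod w / cmod (1 - cnj w * z))\<^sup>2 * (1 - (cmod (disc_aut a z))\<^sup>2) powr p"
          by (rule mult_right_mono) simp
        then have "ennreal ((cmod (deriv (test_fn w) z))\<^sup>2 * (1 - (cmod (disc_aut a z))\<^sup>2) powr p) \<le>
            ennreal (16 * ((cmod w / cmod (1 - cnj w * z))\<^sup>2 * (1 - (cmod (disc_aut a z))\<^sup>2) powr p))"
          by (intro ennreal_leI) (simp add: mult.assoc)
        also have "\<dots> = 16 * ennreal ((cmod w / cmod (1 - cnj w * z))\<^sup>2 * (1 - (cmod (disc_aut a z))\<^sup>2) powr p)"
          by (subst ennreal_mult) auto
        finally show ?thesis using z by simp
      qed simp
    qed
    also have "\<dots> = 16 * (\<integral>\<^sup>+z\<in>unit_disc. ennreal ((cmod w / cmod (1 - cnj w * z))\<^sup>2 *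
       (1 - (cmod (disc_aut a z))\<^sup>2) powr p) \<partial>lborel)"
      by (rule nn_integral_cmult) measurable
    also have "\<dots> \<le> 16 * ennreal (4 * pi * Beta 1 p)"
      by (intro mult_left_mono log_kernel[OF p w a]) auto
    also have "\<dots> = ennreal (16 * (4 * pi * Beta 1 p))"
      using C by (subst ennreal_mult) auto
    also have "16 * (4 * pi * Beta 1 p) = (8 * sqrt (pi * Beta 1 p))\<^sup>2"
      using C by (simp add: power_mult_distrib)
    finally show ?thesis .
  qed
  have s0: "0 \<le> 8 * sqrt (pi * Beta 1 p)" using C by simp
  show "test_fn w \<in> Qp p"
    by (rule QpI[OF test_fn_holomorphic[OF w] _ s0 E]) (auto simp: test_fn_def)
  have "cmod (test_fn w 0) = (ln 100)\<^sup>2 / log_size w"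
    using log_size_pos[OF w] by (simp add: test_fn_def log_fn_def norm_divide norm_power)
  also have "\<dots> \<le> ln 100"
    using log_size_pos[OF w] log_size_ge[OF w] ln_100_ge
    by (simp add: pos_divide_le_eq power2_eq_square)
  finally show "Qp_norm p (test_fn w) \<le> test_const p"
    unfolding test_const_def by (intro Qp_norm_le[OF s0 E])
qed

lemma norm_test_fn_le:
  assumes w: "w \<in> unit_disc" and z: "cmod z \<le> r" "r < 1"
  shows "cmod (test_fn w z) \<le> (ln (100 / (1 - r)) + 2)\<^sup>2 / log_size w"
    and "cmod (deriv (test_fn w) z) \<le> 2 * (ln (100 / (1 - r)) + 2) / (1 - r) / log_size w"
proof -
  have zd: "z \<in> unit_disc" using z by simp
  note L = norm_log_fn_le_radius[OF w z] and lp = log_size_pos[OF w]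
  show "cmod (test_fn w z) \<le> (ln (100 / (1 - r)) + 2)\<^sup>2 / log_size w"
    using zd lp by (auto simp: test_fn_def norm_divide norm_power intro!: divide_right_mono power_mono L)
  have "cmod (deriv (test_fn w) z) = 2 * (cmod (log_fn w z) * (cmod w / cmod (1 - cnj w * z))) / log_size w"
    using lp by (simp add: deriv_test_fn[OF w zd] norm_mult norm_divide)
  also have "\<dots> \<le> 2 * ((ln (100 / (1 - r)) + 2) * (1 / (1 - r))) / log_size w"
  proof -
    have "cmod w / cmod (1 - cnj w * z) \<le> 1 / (1 - r)"
      using norm_one_minus_ge(2)[OF w zd] w z by (intro frac_le) auto
    then show ?thesis using lp L order.trans[OF norm_ge_zero L]
      by (intro divide_right_mono mult_left_mono mult_mono) auto
  qed
  finally show "cmod (deriv (test_fn w) z) \<le> 2 * (ln (100 / (1 - r)) + 2) / (1 - r) / log_size w"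
    by simp
qed

lemma norm_test_fn_ge:
  assumes w: "w \<in> unit_disc" and z: "z \<in> unit_disc" and l: "0 < l" "l \<le> 1"
    and near: "cmod (1 - cnj w * z) \<le> 10 * l" and wl: "cmod w = 1 - l"
  shows "ln (2 / l) / 4 \<le> cmod (test_fn w z)"
proof -
  have eq: "1 - (cmod w)\<^sup>2 = l * (2 - l)" unfolding wl by (simp add: power2_eq_square algebra_simps)
  have lam: "log_size w \<le> ln (100 / l)" "ln (100 / (2 * l)) \<le> log_size w"
  proof -
    have *: "0 < l * (2 - l)" "l \<le> l * (2 - l)" "l * (2 - l) \<le> 2 * l"
      using l by (auto simp: algebra_simps mult_left_le)
    have "100 / (l * (2 - l)) \<le> 100 / l" "100 / (2 * l) \<le> 100 / (l * (2 - l))"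
      by (rule divide_left_mono; use * l in simp)+
    then show "log_size w \<le> ln (100 / l)" "ln (100 / (2 * l)) \<le> log_size w"
      unfolding log_size_def eq using *(1) l by (subst ln_le_cancel_iff; simp)+
  qed
  have l100: "ln (100::real) = 2 * ln 10" using ln_realpow[of 10 2] by simp
  have "100 / (10 * l) \<le> 100 / cmod (1 - cnj w * z)"
    using near l disc_aut_denominator[OF w z] by (intro divide_left_mono mult_pos_pos) auto
  then have "ln (100 / (10 * l)) \<le> ln (100 / cmod (1 - cnj w * z))"
    using l disc_aut_denominator[OF w z] by (subst ln_le_cancel_iff) auto
  then have "ln (10 / l) \<le> Re (log_fn w z)" unfolding Re_log_fn[OF w z] by simp
  then have L: "ln (10 / l) \<le> cmod (log_fn w z)" using complex_Re_le_cmod[of "log_fn w z"] by linarith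
  have ll: "ln l \<le> 0" using l by simp
  have "log_size w / 2 \<le> ln (10 / l)"
  proof -
    have "ln (100 / l) = 2 * ln 10 - ln l" "ln (10 / l) = ln 10 - ln l"
      using l by (simp_all add: ln_div l100)
    then show ?thesis using lam(1) ll by linarith
  qed
  then have "log_size w / 2 \<le> cmod (log_fn w z)" using L by linarith
  then have "(log_size w / 2)\<^sup>2 \<le> (cmod (log_fn w z))\<^sup>2"
    using log_size_pos[OF w] by (intro power_mono) auto
  then have "log_size w / 4 \<le> (cmod (log_fn w z))\<^sup>2 / log_size w"
    using log_size_pos[OF w] by (simp add: field_simps power2_eq_square)
  moreover have "ln (2 / l) \<le> log_size w"
  proof -
    have "ln (2 / l) \<le> ln (100 / (2 * l))" using l by (subst ln_le_cancel_iff) (auto simp: divide_simps)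
    then show ?thesis using lam(2) by linarith
  qed
  moreover have "cmod (test_fn w z) = (cmod (log_fn w z))\<^sup>2 / log_size w"
    using z log_size_pos[OF w] by (simp add: test_fn_def norm_divide norm_power)
  ultimately show ?thesis by linarith
qed

lemma log_size_filterlim:
  assumes w: "\<And>n. w n \<in> unit_disc" and lim: "(\<lambda>n. cmod (w n)) \<longlonglongrightarrow> 1"
  shows "filterlim (\<lambda>n. log_size (w n)) at_top sequentially"
proof -
  have "(\<lambda>n. 1 - (cmod (w n))\<^sup>2) \<longlonglongrightarrow> 1 - 1\<^sup>2" by (intro tendsto_intros lim)
  then have "filterlim (\<lambda>n. 1 - (cmod (w n))\<^sup>2) (at_right 0) sequentially"
    using norm_sq_disc(1)[OF w] by (simp add: filterlim_at less_imp_neq[symmetric])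
  from filterlim_compose[OF filterlim_inverse_at_top_right this]
  have "filterlim (\<lambda>n. 100 * inverse (1 - (cmod (w n))\<^sup>2)) at_top sequentially"
    by (intro filterlim_tendsto_pos_mult_at_top[OF tendsto_const]) auto
  from filterlim_compose[OF ln_at_top this] show ?thesis
    unfolding log_size_def by (simp add: divide_inverse)
qed

section \<open>Arcs and Carleson squares\<close>

text \<open>
  The half-width \<open>\<pi> * l\<close> makes \<open>l\<close> the normalised length.
\<close>

definition closed_arc :: "real \<Rightarrow> real \<Rightarrow> complex set" where
  "closed_arc \<alpha> l = cis ` {\<alpha> - pi * l .. \<alpha> + pi * l}"

lemma cis_image_shift: "cis ` {x + 2 * pi * of_int k .. y + 2 * pi * of_int k} = cis ` {x..y}"
proof -
  have c: "cis (t + 2 * pi * of_int k) = cis t" for t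
    using cis_multiple_2pi[of "of_int k"] by (simp add: cis_mult[symmetric])
  have "{x + 2 * pi * of_int k .. y + 2 * pi * of_int k} = (\<lambda>t. t + 2 * pi * of_int k) ` {x..y}"
    by simp
  then show ?thesis by (simp only: image_image c)
qed

lemma cis_eq_cisE:
  assumes "cis s = cis t" obtains k :: int where "s = t + 2 * pi * of_int k"
proof -
  have "cos s = cos t" "sin s = sin t" using assms by (auto simp: complex_eq_iff)
  then show ?thesis using sin_cos_eq_iff[of s t] that by (auto simp: mult_ac)
qed

text \<open>
  After a shift by a multiple of \<open>2 * pi\<close> the interval starts in \<open>[0, 2 * pi)\<close>; the part of it that
  leaves this fundamental domain reappears at \<open>0\<close>.
\<close>

lemma arc_length_cis_interval:
  assumes l: "0 \<le> l" "l \<le> 2 * pi"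
  shows "arc_length (cis ` {x..x + l}) = l / (2 * pi)"
proof -
  define m where "m = \<lfloor>x / (2 * pi)\<rfloor>"
  define y where "y = x - 2 * pi * of_int m"
  have y: "0 \<le> y" "y < 2 * pi"
  proof -
    have "of_int m \<le> x / (2 * pi)" "x / (2 * pi) < of_int m + 1" unfolding m_def by linarith+
    then show "0 \<le> y" "y < 2 * pi" unfolding y_def by (simp_all add: field_simps)
  qed
  have "cis ` {x..x + l} = cis ` {y..y + l}"
    using cis_image_shift[of y m "y + l"] by (simp add: y_def algebra_simps)
  have S: "{t \<in> {0..<2 * pi}. cis t \<in> cis ` {y..y + l}} =
      ({y..y + l} \<inter> {0..<2 * pi}) \<union> ({0..y + l - 2 * pi} \<inter> {0..<2 * pi})" (is "?S = ?R")
  proof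
    show "?S \<subseteq> ?R"
    proof
      fix t assume t: "t \<in> ?S"
      then obtain s where s: "s \<in> {y..y + l}" "cis t = cis s" by auto
      obtain k :: int where k: "t = s + 2 * pi * of_int k" using cis_eq_cisE[OF s(2)] .
      have "2 * pi * of_int k = t - s" "0 \<le> t" "t < 2 * pi" "y \<le> s" "s \<le> y + l" using k t s by auto
      then have "2 * pi * (-2) < 2 * pi * of_int k" "2 * pi * of_int k < 2 * pi * 1" using y l by linarith+
      then have "-2 < real_of_int k" "real_of_int k < 1" by (simp_all only: mult_less_cancel_left_pos pi_gt_zero zero_less_mult_iff zero_less_numeral simp_thms)
      then have "k = 0 \<or> k = -1" by linarith
      then show "t \<in> ?R" using k t s by auto
    qed
    show "?R \<subseteq> ?S"
    proof
      fix t assume t: "t \<in> ?R"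
      show "t \<in> ?S"
      proof (cases "t \<in> {y..y + l}")
        case False
        then have "t \<in> {0..y + l - 2 * pi}" "t \<in> {0..<2 * pi}" using t by auto
        moreover from this have "t + 2 * pi \<in> {y..y + l}" using y by auto
        moreover have "cis (t + 2 * pi) = cis t" by (simp add: cis_mult[symmetric])
        ultimately show ?thesis by (auto simp: image_iff intro!: bexI[of _ "t + 2 * pi"])
      qed (use t in auto)
    qed
  qed
  have "measure lborel ?R = l"
  proof (cases "y + l < 2 * pi")
    case True
    then have "?R = {y..y + l}" using y by auto
    then show ?thesis using l by simp
  next
    case False
    show ?thesis
    proof (cases "l < 2 * pi")
      case True
      have "?R = {y..<2 * pi} \<union> {0..y + l - 2 * pi}" using False True y by auto
      moreover have "measure lborel ({y..<2 * pi} \<union> {0..y + l - 2 * pi}) =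
          measure lborel {y..<2 * pi} + measure lborel {0..y + l - 2 * pi}"
        using True y False by (intro measure_Un_AE) (auto simp: fmeasurable_def)
      ultimately show ?thesis using False y by simp
    next
      case False
      then have "?R = {0..<2 * pi}" using y l by auto
      then show ?thesis using False l by simp
    qed
  qed
  then show ?thesis unfolding arc_length_def \<open>cis ` {x..x + l} = cis ` {y..y + l}\<close> S by simp
qed

lemma arc_length_closed_arc: "0 < l \<Longrightarrow> l \<le> 1 \<Longrightarrow> arc_length (closed_arc \<alpha> l) = l"
  unfolding closed_arc_def using arc_length_cis_interval[of "2 * pi * l" "\<alpha> - pi * l"]
  by (simp add: algebra_simps)

lemma closed_arc_subarc: "0 < l \<Longrightarrow> l \<le> 1 \<Longrightarrow> closed_arc \<alpha> l \<in> subarcs"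
  unfolding subarcs_def using arc_length_closed_arc[of l \<alpha>]
  by (auto simp: closed_arc_def intro!: exI[of _ "{\<alpha> - pi * l .. \<alpha> + pi * l}"] is_interval_cc)

lemma arc_length_le_1: "arc_length I \<le> 1"
proof -
  have "measure lborel {t \<in> {0..<2 * pi}. cis t \<in> I} \<le> 2 * pi"
  proof (cases "{t \<in> {0..<2 * pi}. cis t \<in> I} \<in> sets lborel")
    case True
    have "measure lborel {t \<in> {0..<2 * pi}. cis t \<in> I} \<le> measure lborel {0..<2 * pi}"
      by (rule measure_mono_fmeasurable[OF _ True]) (auto simp: fmeasurable_def)
    then show ?thesis by simp
  qed (simp add: measure_notin_sets)
  then show ?thesis by (simp add: arc_length_def divide_le_eq)
qed

lemma norm_cis_diff_le: "cmod (cis s - cis t) \<le> \<bar>s - t\<bar>"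
proof -
  have "cis s - cis t = cis t * (exp (\<i> * of_real (s - t)) - 1)"
    using cis_mult[of t "s - t"] by (simp add: cis_conv_exp right_diff_distrib)
  then have "cmod (cis s - cis t) = cmod (exp (\<i> * of_real (s - t)) - 1)"
    by (simp only: norm_mult norm_cis mult_1)
  also have "\<dots> = 2 * \<bar>sin ((s - t) / 2)\<bar>" by (rule dist_exp_i_1)
  also have "\<dots> \<le> 2 * \<bar>(s - t) / 2\<bar>" by (intro mult_left_mono abs_sin_x_le_abs_x) auto
  finally show ?thesis by simp
qed

text \<open>
  A chord is at most as long as the arc that it cuts off. The set of angles of an arc is measurable
  because a nonmeasurable set would get measure \<open>0\<close>, while arcs have positive length.
\<close>

lemma subarc_diam:
  assumes I: "I \<in> subarcs" and \<xi>: "\<xi> \<in> I" "\<eta> \<in> I"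
  shows "cmod (\<xi> - \<eta>) \<le> 2 * pi * arc_length I"
proof -
  obtain J where J: "is_interval J" "I = cis ` J" and pos: "0 < arc_length I"
    using I by (auto simp: subarcs_def)
  have meas: "{t \<in> {0..<2 * pi}. cis t \<in> I} \<in> sets lborel"
    using pos by (rule contrapos_pp) (simp add: arc_length_def measure_notin_sets)
  have mono: "arc_length (cis ` {x..x + l}) \<le> arc_length I" if "{x..x + l} \<subseteq> J" for x l
  proof -
    have "measure lborel {t \<in> {0..<2 * pi}. cis t \<in> cis ` {x..x + l}} \<le> measure lborel {t \<in> {0..<2 * pi}. cis t \<in> I}"
    proof (cases "{t \<in> {0..<2 * pi}. cis t \<in> cis ` {x..x + l}} \<in> sets lborel")
      case True
      have "{t \<in> {0..<2 * pi}. cis t \<in> I} \<in> fmeasurable lborel"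
        by (rule fmeasurableI2[OF _ _ meas, of "{0..<2 * pi}"]) (auto simp: fmeasurable_def)
      then show ?thesis using that J(2) by (intro measure_mono_fmeasurable[OF _ True]) auto
    qed (simp add: measure_notin_sets)
    then show ?thesis by (simp add: arc_length_def divide_right_mono)
  qed
  have main: "cmod (cis s - cis t) \<le> 2 * pi * arc_length I" if st: "s \<in> J" "t \<in> J" "s \<le> t" for s t
  proof -
    have sub: "{s..t} \<subseteq> J"
      using J(1) st unfolding is_interval_1 by (meson atLeastAtMost_iff subsetI)
    show ?thesis
    proof (cases "t - s \<le> 2 * pi")
      case True
      have "cmod (cis s - cis t) \<le> t - s" using norm_cis_diff_le[of s t] st by simp
      also have "\<dots> = 2 * pi * arc_length (cis ` {s..s + (t - s)})"
        using True st by (subst arc_length_cis_interval) auto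
      also have "\<dots> \<le> 2 * pi * arc_length I" using sub by (intro mult_left_mono mono) auto
      finally show ?thesis .
    next
      case False
      have "1 = arc_length (cis ` {s..s + 2 * pi})" by (subst arc_length_cis_interval) auto
      also have "\<dots> \<le> arc_length I" using sub False by (intro mono) auto
      finally have "1 \<le> arc_length I" .
      have "cmod (cis s - cis t) \<le> 2" using norm_triangle_ineq4[of "cis s" "cis t"] by simp
      also have "\<dots> \<le> 2 * pi * 1" using pi_ge_two by simp
      also have "\<dots> \<le> 2 * pi * arc_length I" using \<open>1 \<le> arc_length I\<close> by (intro mult_left_mono) auto
      finally show ?thesis .
    qed
  qed
  obtain s t where "s \<in> J" "t \<in> J" "\<xi> = cis s" "\<eta> = cis t" using \<xi> J(2) by auto
  then show ?thesis using main[of s t] main[of t s] by (cases "s \<le> t") (auto simp: norm_minus_commute)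
qed

text \<open>
  Take \<open>w = (1 - \<bar>I\<bar>) * \<xi>\<close> for any \<open>\<xi>\<close> in \<open>I\<close>. The radial contribution to \<open>\<bar>1 - cnj w * z\<bar>\<close> is at
  most \<open>2 * \<bar>I\<bar>\<close> and the angular one at most \<open>2 * pi * \<bar>I\<bar> \<le> 8 * \<bar>I\<bar>\<close>.
\<close>

lemma subarc_near_test_point:
  assumes I: "I \<in> subarcs"
  obtains w where "w \<in> unit_disc" "cmod w = 1 - arc_length I"
    "\<And>z. z \<in> carleson_square I \<Longrightarrow> cmod (1 - cnj w * z) \<le> 10 * arc_length I"
proof -
  define l where "l = arc_length I"
  have l: "0 < l" "l \<le> 1" using I arc_length_le_1[of I] by (auto simp: subarcs_def l_def)
  obtain J where J: "I = cis ` J" using I by (auto simp: subarcs_def)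
  have "I \<noteq> {}" using l(1) by (auto simp: l_def arc_length_def)
  then obtain \<xi> where \<xi>: "\<xi> \<in> I" by blast
  have unit: "cmod \<eta> = 1" if "\<eta> \<in> I" for \<eta> using that J by auto
  define w where "w = of_real (1 - l) * \<xi>"
  have nw: "cmod w = 1 - l" using l unit[OF \<xi>] by (simp only: w_def norm_mult norm_of_real) simp
  have "cmod (1 - cnj w * z) \<le> 10 * l" if "z \<in> carleson_square I" for z
  proof -
    obtain r \<eta> where z: "z = of_real r * \<eta>" "1 - l \<le> r" "r < 1" "\<eta> \<in> I"
      using \<open>z \<in> carleson_square I\<close> by (auto simp: carleson_square_def l_def)
    have r: "0 \<le> (1 - l) * r" "(1 - l) * r \<le> 1" "1 - (1 - l) * r \<le> 2 * l"
    proof -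
      have "0 \<le> r" using z l by linarith
      then show "0 \<le> (1 - l) * r" using l by simp
      show "(1 - l) * r \<le> 1" using mult_mono[of "1 - l" 1 r 1] l z \<open>0 \<le> r\<close> by simp
      have "(1 - l) * (1 - l) \<le> (1 - l) * r" using l z by (intro mult_left_mono) auto
      moreover have "(1 - l) * (1 - l) = 1 - 2 * l + l * l" by (simp add: algebra_simps)
      moreover have "0 \<le> l * l" by simp
      ultimately show "1 - (1 - l) * r \<le> 2 * l" by linarith
    qed
    have "cnj \<xi> * \<xi> = 1" using complex_norm_square[of \<xi>] unit[OF \<xi>] by (simp add: mult.commute)
    then have "1 - cnj w * z = of_real (1 - (1 - l) * r) + of_real ((1 - l) * r) * (cnj \<xi> * (\<xi> - \<eta>))"
      by (simp add: w_def z(1) right_diff_distrib mult_ac)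
    then have "cmod (1 - cnj w * z) \<le> cmod (of_real (1 - (1 - l) * r)) + cmod (of_real ((1 - l) * r) * (cnj \<xi> * (\<xi> - \<eta>)))"
      by (metis norm_triangle_ineq)
    also have "cmod (of_real (1 - (1 - l) * r)) = 1 - (1 - l) * r" using r by (subst norm_of_real) simp
    also have "cmod (of_real ((1 - l) * r) * (cnj \<xi> * (\<xi> - \<eta>))) = (1 - l) * r * cmod (\<xi> - \<eta>)"
      using r unit[OF \<xi>] by (simp only: norm_mult norm_of_real complex_mod_cnj)
    also have "\<dots> \<le> 1 * (2 * pi * l)"
      using subarc_diam[OF I \<xi> z(4)] r by (intro mult_mono) (auto simp: l_def)
    also have "1 - (1 - l) * r + 1 * (2 * pi * l) \<le> 2 * l + 8 * l"
      using r(3) l pi_less_4 by (intro add_mono) auto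
    finally show ?thesis by simp
  qed
  then show ?thesis using that[of w] nw l unfolding l_def by simp
qed

text \<open>
  Jordan's inequality: a concave function lies above its chord.
\<close>

lemma jordan_ineq:
  assumes "0 \<le> x" "x \<le> pi / 2"
  shows "2 / pi * x \<le> sin x"
proof -
  have "concave_on {0..pi} sin"
    by (rule f''_le0_imp_concave[where f' = cos and f'' = "\<lambda>x. - sin x"])
       (auto intro!: derivative_eq_intros sin_ge_zero)
  from concave_onD[OF this, of "2 / pi * x" 0 "pi / 2"] assms
  show ?thesis by (simp add: field_simps)
qed

lemma abs_angle_le:
  assumes "\<bar>\<phi>\<bar> \<le> pi" shows "\<bar>\<phi>\<bar> \<le> pi / 2 * cmod (1 - cis \<phi>)"
proof -
  have sq: "(cmod (1 - cis \<phi>))\<^sup>2 = (2 * sin (\<bar>\<phi>\<bar> / 2))\<^sup>2"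
  proof -
    have "(cmod (1 - cis \<phi>))\<^sup>2 = 2 - 2 * cos \<phi>"
      unfolding cmod_power2 by (simp add: power2_diff)
    also have "cos \<phi> = 1 - 2 * (sin (\<bar>\<phi>\<bar> / 2))\<^sup>2"
      using cos_double_sin[of "\<bar>\<phi>\<bar> / 2"] by simp
    finally show ?thesis by (simp add: power_mult_distrib)
  qed
  have "0 \<le> 2 * sin (\<bar>\<phi>\<bar> / 2)" using assms by (intro mult_nonneg_nonneg sin_ge_zero) auto
  from power2_eq_imp_eq[OF sq norm_ge_zero this] have "cmod (1 - cis \<phi>) = 2 * sin (\<bar>\<phi>\<bar> / 2)" .
  moreover have "2 / pi * (\<bar>\<phi>\<bar> / 2) \<le> sin (\<bar>\<phi>\<bar> / 2)" using assms by (intro jordan_ineq) auto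
  ultimately show ?thesis by (simp add: field_simps)
qed

text \<open>
  If \<open>\<bar>1 - cnj a * z\<bar> \<le> t\<close>, the modulus of \<open>cnj a * z\<close> is at least \<open>1 - t\<close>, and moving \<open>cnj a * z\<close>
  radially to the circle costs at most another \<open>t\<close>. So the angle between \<open>a\<close> and \<open>z\<close> has a chord of
  length at most \<open>2 * t\<close>, hence is at most \<open>pi * t\<close> by Jordan's inequality: exactly the
  half-width of an arc of normalised length \<open>t\<close>.
\<close>

lemma nonisotropic_ball_subset_carleson_square:
  assumes a: "a \<in> unit_disc" and t: "0 < t" "t \<le> 1"
  shows "{z \<in> unit_disc. cmod (1 - cnj a * z) \<le> t} \<subseteq> carleson_square (closed_arc (Arg a) t)"
proof
  fix z assume z: "z \<in> {z \<in> unit_disc. cmod (1 - cnj a * z) \<le> t}"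
  define \<alpha> where "\<alpha> = Arg a"
  define \<phi> where "\<phi> = Arg (z * cis (- \<alpha>))"
  have a_eq: "a = of_real (cmod a) * cis \<alpha>" unfolding \<alpha>_def by (metis Arg_def rcis_cmod_Arg rcis_def)
  have "z * cis (- \<alpha>) = of_real (cmod z) * cis \<phi>"
    unfolding \<phi>_def using rcis_cmod_Arg[of "z * cis (- \<alpha>)"] by (simp add: rcis_def norm_mult)
  then have "z * cis (- \<alpha>) * cis \<alpha> = of_real (cmod z) * cis \<phi> * cis \<alpha>" by simp
  then have z_eq: "z = of_real (cmod z) * cis (\<alpha> + \<phi>)" by (simp add: mult.assoc cis_mult add.commute)
  have \<phi>: "\<bar>\<phi>\<bar> \<le> pi" unfolding \<phi>_def using Arg_bounded[of "z * cis (- \<alpha>)"] by linarith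
  define s where "s = cmod a * cmod z"
  have s: "0 \<le> s" "s \<le> cmod z" "s < 1" using a z mult_right_mono[of "cmod a" 1 "cmod z"] by (auto simp: s_def intro: le_less_trans)
  have \<zeta>: "cnj a * z = of_real s * cis \<phi>"
    by (subst a_eq, subst z_eq) (simp add: s_def cis_cnj cis_mult mult_ac)
  have t1: "cmod (1 - of_real s * cis \<phi>) \<le> t" using z by (simp flip: \<zeta>)
  have t2: "1 - s \<le> t"
    using norm_triangle_ineq2[of 1 "of_real s * cis \<phi>"] t1 s by (simp add: norm_mult)
  have "cmod (1 - cis \<phi>) \<le> cmod (1 - of_real s * cis \<phi>) + cmod (of_real s * cis \<phi> - cis \<phi>)"
    using norm_triangle_ineq[of "1 - of_real s * cis \<phi>" "of_real s * cis \<phi> - cis \<phi>"] by simp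
  also have "of_real s * cis \<phi> - cis \<phi> = of_real (s - 1) * cis \<phi>" by (simp add: algebra_simps)
  also have "cmod (of_real (s - 1) * cis \<phi>) = 1 - s" using s by (simp only: norm_mult norm_of_real norm_cis) simp
  finally have "cmod (1 - cis \<phi>) \<le> 2 * t" using t1 t2 by linarith
  with abs_angle_le[OF \<phi>] have "\<bar>\<phi>\<bar> \<le> pi / 2 * (2 * t)"
    by (meson mult_left_mono order.trans pi_half_ge_zero)
  then have \<phi>t: "\<bar>\<phi>\<bar> \<le> pi * t" by simp
  have "cis (\<alpha> + \<phi>) \<in> closed_arc \<alpha> t"
    unfolding closed_arc_def using \<phi>t by (intro imageI) auto
  moreover have "cmod z \<in> {1 - arc_length (closed_arc \<alpha> t)..<1}"
    using arc_length_closed_arc[OF t] s t2 z by auto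
  ultimately show "z \<in> carleson_square (closed_arc (Arg a) t)"
    unfolding carleson_square_def \<alpha>_def[symmetric] using z z_eq by blast
qed

lemma carleson_square_closed_arc_borel:
  assumes l: "0 < l" "l \<le> 1"
  shows "carleson_square (closed_arc \<alpha> l) \<in> sets borel"
proof -
  define K where "K = (\<lambda>(r, \<theta>). of_real r * cis \<theta>) ` ({1 - l..1} \<times> {\<alpha> - pi * l .. \<alpha> + pi * l})"
  have "compact K" unfolding K_def
    by (intro compact_continuous_image compact_Times compact_Icc)
       (auto simp: case_prod_beta intro!: continuous_intros)
  moreover have "carleson_square (closed_arc \<alpha> l) = unit_disc \<inter> K"
  proof
    show "carleson_square (closed_arc \<alpha> l) \<subseteq> unit_disc \<inter> K"
      unfolding carleson_square_def K_def closed_arc_def[symmetric] arc_length_closed_arc[OF l]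
      by (force simp: closed_arc_def)
    show "unit_disc \<inter> K \<subseteq> carleson_square (closed_arc \<alpha> l)"
    proof
      fix z assume z: "z \<in> unit_disc \<inter> K"
      then obtain r \<theta> where r: "r \<in> {1 - l..1}" and \<theta>: "\<theta> \<in> {\<alpha> - pi * l .. \<alpha> + pi * l}" and zr: "z = of_real r * cis \<theta>"
        by (auto simp: K_def)
      have "r = cmod z" using r l by (simp add: zr norm_mult)
      then have "r \<in> {1 - l..<1}" using z r by auto
      moreover have "cis \<theta> \<in> closed_arc \<alpha> l" unfolding closed_arc_def using \<theta> by (rule imageI)
      ultimately show "z \<in> carleson_square (closed_arc \<alpha> l)"
        unfolding carleson_square_def arc_length_closed_arc[OF l] using z zr by blast
    qed
  qed
  ultimately show ?thesis by (simp add: compact_imp_closed)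
qed

lemma annulus_covered_by_carleson_squares:
  assumes N: "0 < (N::nat)" and z: "z \<in> unit_disc" "1 - 1 / real N \<le> cmod z"
  shows "\<exists>j<N. z \<in> carleson_square (closed_arc ((2 * real j + 1) * pi / real N) (1 / real N))"
proof -
  define \<theta> where "\<theta> = Arg2pi z"
  have \<theta>: "0 \<le> \<theta>" "\<theta> < 2 * pi" "z = of_real (cmod z) * cis \<theta>"
    unfolding \<theta>_def using Arg2pi[of z] by (auto simp: cis_conv_exp is_Arg_def)
  define j where "j = nat \<lfloor>\<theta> * real N / (2 * pi)\<rfloor>"
  have nn: "0 \<le> \<theta> * real N / (2 * pi)" using \<theta> by simp
  have j: "real j \<le> \<theta> * real N / (2 * pi)" "\<theta> * real N / (2 * pi) < real j + 1"
    using nn unfolding j_def by (simp_all add: of_nat_nat)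
  have "\<theta> * real N / (2 * pi) < real N" using \<theta> N by (simp add: field_simps)
  then have "j < N" using j by linarith
  have l: "0 < 1 / real N" "1 / real N \<le> 1" using N by auto
  have "\<theta> \<in> {(2 * real j + 1) * pi / real N - pi * (1 / real N) .. (2 * real j + 1) * pi / real N + pi * (1 / real N)}"
    using j N by (auto simp: field_simps)
  then have "cis \<theta> \<in> closed_arc ((2 * real j + 1) * pi / real N) (1 / real N)"
    unfolding closed_arc_def by blast
  then have "z \<in> carleson_square (closed_arc ((2 * real j + 1) * pi / real N) (1 / real N))"
    unfolding carleson_square_def arc_length_closed_arc[OF l] using z \<theta>(3) by auto
  with \<open>j < N\<close> show ?thesis by blast
qed

section \<open>Logarithmic Carleson measures\<close>

text \<open>
  The logarithmic Carleson condition on nonisotropic balls in place of squares. These balls are sublevel sets of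
  \<open>\<bar>1 - cnj a * z\<bar>\<close>, the quantity in which all kernels are expressed, so that dyadic decompositions
  apply to them directly. The centre \<open>a\<close> ranges over the whole disc.
\<close>

definition log_carleson :: "real \<Rightarrow> complex measure \<Rightarrow> real \<Rightarrow> bool" where
  "log_carleson p \<nu> A \<longleftrightarrow> (\<forall>a\<in>unit_disc. \<forall>t. 0 < t \<longrightarrow> t \<le> 1 \<longrightarrow>
     emeasure \<nu> {z \<in> unit_disc. cmod (1 - cnj a * z) \<le> t} \<le> ennreal (A * t powr p / (ln (2 / t))\<^sup>2))"

text \<open>
  The quotient of \<open>1 - \<bar>\<sigma>\<^sub>w z\<bar>\<^sup>2\<close> by \<open>1 - \<bar>z\<bar>\<^sup>2\<close>, so its \<open>p\<close>-th power is the quotient of the energy weights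
  at \<open>w\<close> and at \<open>0\<close>.
\<close>

definition poisson_kernel :: "complex \<Rightarrow> complex \<Rightarrow> real" where
  "poisson_kernel w z = (1 - (cmod w)\<^sup>2) / (cmod (1 - cnj w * z))\<^sup>2"

lemma poisson_kernel_measurable [measurable]: "poisson_kernel w \<in> borel_measurable borel"
  unfolding poisson_kernel_def by measurable

text \<open>
  Dyadic decomposition with nested balls \<open>S j\<close> in place of shells: a point is charged to one ball
  containing it, and the balls are what Carleson conditions measure.
\<close>

lemma nn_integral_le_layers:
  assumes M: "sets M = sets borel"
    and S: "\<And>j. S j \<in> sets borel" and c: "\<And>j. 0 \<le> c j"
    and cover: "\<And>z. z \<in> D \<Longrightarrow> \<exists>j::nat. z \<in> S j \<and> F z \<le> ennreal (c j)"
    and small: "\<And>j. emeasure M (S j) \<le> ennreal (m j)" "\<And>j. 0 \<le> m j"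
    and summ: "summable b" and b: "\<And>j. c j * m j \<le> b j"
  shows "(\<integral>\<^sup>+z\<in>D. F z \<partial>M) \<le> ennreal (suminf b)"
proof -
  have b0: "0 \<le> b j" for j using b[of j] c[of j] small(2)[of j] by (metis mult_nonneg_nonneg order.trans)
  have "(\<integral>\<^sup>+z\<in>D. F z \<partial>M) \<le> (\<integral>\<^sup>+z. (\<Sum>j. ennreal (c j) * indicator (S j) z) \<partial>M)"
  proof (rule nn_integral_mono)
    fix z
    show "F z * indicator D z \<le> (\<Sum>j. ennreal (c j) * indicator (S j) z)"
    proof (cases "z \<in> D")
      case True
      then obtain j where j: "z \<in> S j" "F z \<le> ennreal (c j)" using cover by blast
      then have "F z \<le> ennreal (c j) * indicator (S j) z" by simp
      also have "\<dots> = (\<Sum>i\<in>{j}. ennreal (c i) * indicator (S i) z)"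
        by (simp only: sum.insert finite.emptyI empty_iff not_False_eq_True sum.empty add_0_right)
      also have "\<dots> \<le> (\<Sum>j. ennreal (c j) * indicator (S j) z)"
        by (rule sum_le_suminf) auto
      finally show ?thesis using True by simp
    qed simp
  qed
  also have "\<dots> = (\<Sum>j. \<integral>\<^sup>+z. ennreal (c j) * indicator (S j) z \<partial>M)"
    using S by (intro nn_integral_suminf borel_measurable_times_ennreal borel_measurable_indicator) (auto simp: M)
  also have "\<dots> = (\<Sum>j. ennreal (c j) * emeasure M (S j))"
    using S by (simp add: nn_integral_cmult_indicator M)
  also have "\<dots> \<le> (\<Sum>j. ennreal (b j))"
  proof (intro suminf_le allI)
    fix j
    have "ennreal (c j) * emeasure M (S j) \<le> ennreal (c j) * ennreal (m j)"
      by (intro mult_left_mono small) auto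
    also have "\<dots> = ennreal (c j * m j)" using c small(2) by (simp add: ennreal_mult)
    also have "\<dots> \<le> ennreal (b j)" by (rule ennreal_leI[OF b])
    finally show "ennreal (c j) * emeasure M (S j) \<le> ennreal (b j)" .
  qed auto
  also have "\<dots> = ennreal (suminf b)" by (rule suminf_ennreal2[OF b0 summ])
  finally show ?thesis .
qed

lemma nonisotropic_ball_borel: "{z \<in> unit_disc. cmod (1 - cnj a * z) \<le> t} \<in> sets borel"
  by measurable

lemma log_carleson_total:
  assumes "log_carleson p \<nu> A"
  shows "emeasure \<nu> unit_disc \<le> ennreal (A / (ln 2)\<^sup>2)"
proof -
  have "emeasure \<nu> {z \<in> unit_disc. cmod (1 - cnj 0 * z) \<le> 1} \<le> ennreal (A * 1 powr p / (ln (2 / 1))\<^sup>2)"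
    using assms[unfolded log_carleson_def, rule_format, of 0 1] by simp
  moreover have "{z \<in> unit_disc. cmod (1 - cnj 0 * z) \<le> 1} = unit_disc" by auto
  ultimately show ?thesis by (simp only: powr_one_eq_one mult_1_right div_by_1)
qed

definition kernel_const :: "real \<Rightarrow> real" where
  "kernel_const p = (\<Sum>k. 2 powr p / (real (Suc k) * ln 2)\<^sup>2)"

lemma kernel_summable: "summable (\<lambda>k. 2 powr p / (real (Suc k) * ln 2)\<^sup>2)"
proof -
  have "summable (\<lambda>k. (2 powr p / (ln 2)\<^sup>2) * inverse (real (Suc k) ^ 2))"
    by (intro summable_mult, subst summable_Suc_iff[where f = "\<lambda>k. inverse (real k ^ 2)"],
        rule inverse_power_summable) simp
  then show ?thesis by (simp add: power_mult_distrib divide_inverse mult_ac del: of_nat_Suc)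
qed

text \<open>
  On the shell where \<open>\<bar>1 - cnj a * z\<bar>\<close> is about \<open>2 powr (-k)\<close> the kernel is about \<open>2 powr (k * p)\<close>. This
  cancels the power of the radius in the Carleson condition and leaves the squared reciprocal
  logarithm, about \<open>1 / k\<^sup>2\<close>, which is summable.
\<close>

lemma log_carleson_kernel:
  assumes p: "0 < p" and M: "sets \<nu> = sets borel" and lc: "log_carleson p \<nu> A" and A: "0 \<le> A"
    and a: "a \<in> unit_disc"
  shows "(\<integral>\<^sup>+z\<in>unit_disc. ennreal (cmod (1 - cnj a * z) powr (-p)) \<partial>\<nu>) \<le> ennreal (kernel_const p * A)"
proof -
  define x where "x = (\<lambda>z. cmod (1 - cnj a * z))"
  have xpos: "0 < x z" if "z \<in> unit_disc" for z
    using disc_aut_denominator[OF a that] by (simp add: x_def)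
  define S where "S = (\<lambda>k::nat. if k = 0 then unit_disc else {z \<in> unit_disc. x z \<le> (1/2) ^ k})"
  define m where "m = (\<lambda>k::nat. A * ((1/2) ^ k) powr p / (real (Suc k) * ln 2)\<^sup>2)"
  have ln_k: "ln (2 / (1/2) ^ k) = real (Suc k) * ln 2" for k :: nat
  proof -
    have "2 / (1/2 :: real) ^ k = 2 ^ Suc k" by (simp add: power_divide)
    then show ?thesis by (simp only: ln_realpow zero_less_numeral)
  qed
  have "(\<integral>\<^sup>+z\<in>unit_disc. ennreal (x z powr (-p)) \<partial>\<nu>) \<le> ennreal (\<Sum>k. (2 powr p / (real (Suc k) * ln 2)\<^sup>2) * A)"
  proof (rule nn_integral_le_layers[OF M, where S = S and c = "\<lambda>k. ((1/2) ^ Suc k) powr (-p)" and m = m])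
    show "S k \<in> sets borel" for k unfolding S_def x_def by simp
    show "emeasure \<nu> (S k) \<le> ennreal (m k)" for k
    proof (cases "k = 0")
      case True
      then show ?thesis using log_carleson_total[OF lc] by (simp add: S_def m_def)
    next
      case False
      have "(1/2::real) ^ k \<le> 1" by (rule power_le_one) auto
      then have "emeasure \<nu> {z \<in> unit_disc. x z \<le> (1/2) ^ k} \<le> ennreal (A * ((1/2) ^ k) powr p / (ln (2 / (1/2) ^ k))\<^sup>2)"
        using lc a unfolding log_carleson_def x_def by simp
      then show ?thesis using False unfolding S_def m_def ln_k by simp
    qed
    show "\<exists>k. z \<in> S k \<and> ennreal (x z powr (-p)) \<le> ennreal (((1/2) ^ Suc k) powr (-p))" if z: "z \<in> unit_disc" for z
    proof -
      define k where "k = (LEAST n. (1/2) ^ Suc n < x z)"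
      obtain n where "(1/2::real) ^ n < x z" using real_arch_pow_inv[OF xpos[OF z], of "1/2"] by auto
      then have "(1/2::real) ^ Suc n < x z" by (rule order.strict_trans1[rotated]) simp
      then have k: "(1/2) ^ Suc k < x z" unfolding k_def by (rule LeastI)
      have "z \<in> S k"
      proof (cases k)
        case (Suc l)
        then have "\<not> (1/2) ^ Suc l < x z" using not_less_Least[of l "\<lambda>n. (1/2) ^ Suc n < x z"] by (simp add: k_def)
        then show ?thesis using z Suc by (simp add: S_def)
      qed (use z in \<open>simp add: S_def\<close>)
      moreover have "x z powr (-p) \<le> ((1/2) ^ Suc k) powr (-p)"
        using p k by (intro powr_mono2') auto
      ultimately show ?thesis by (auto intro!: exI[of _ k] ennreal_leI)
    qed
    show "((1/2) ^ Suc k) powr (-p) * m k \<le> 2 powr p / (real (Suc k) * ln 2)\<^sup>2 * A" for k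
    proof -
      have "((1/2::real) ^ Suc k) powr (-p) = 2 powr p * ((1/2) ^ k) powr (-p)"
      proof -
        have "(1/2::real) powr (-p) = 2 powr p" by (simp add: powr_minus powr_divide)
        then show ?thesis by (simp only: power_Suc powr_mult)
      qed
      moreover have "((1/2::real) ^ k) powr (-p) * ((1/2) ^ k) powr p = 1"
        by (simp add: powr_add[symmetric])
      ultimately have "((1/2::real) ^ Suc k) powr (-p) * ((1/2) ^ k) powr p = 2 powr p"
        by (simp add: mult.assoc)
      moreover have "((1/2) ^ Suc k) powr (-p) * m k = (((1/2) ^ Suc k) powr (-p) * ((1/2) ^ k) powr p) * A / (real (Suc k) * ln 2)\<^sup>2"
        by (simp add: m_def mult_ac del: of_nat_Suc power_Suc)
      ultimately show ?thesis by simp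
    qed
    show "summable (\<lambda>k. 2 powr p / (real (Suc k) * ln 2)\<^sup>2 * A)"
      by (rule summable_mult2[OF kernel_summable])
  qed (use A in \<open>auto simp: m_def\<close>)
  also have "(\<Sum>k. (2 powr p / (real (Suc k) * ln 2)\<^sup>2) * A) = kernel_const p * A"
    unfolding kernel_const_def by (rule suminf_mult2[symmetric, OF kernel_summable])
  finally show ?thesis unfolding x_def .
qed

definition poisson_const :: "real \<Rightarrow> real" where
  "poisson_const p = (\<Sum>j. 4 powr p * ((real j + 2)\<^sup>2 * (2 powr (-p)) ^ j))"

lemma summable_square_geometric:
  fixes q :: real
  assumes q: "0 < q" "q < 1"
  shows "summable (\<lambda>j. (real j + 2)\<^sup>2 * q ^ j)"
proof -
  define c where "c = (1 + q) / 2"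
  have c: "q < c" "c < 1" using q by (auto simp: c_def)
  have "(\<lambda>n. ((real n + 3) / (real n + 2))\<^sup>2 * q) \<longlonglongrightarrow> 1\<^sup>2 * q"
    by (intro tendsto_intros) real_asymp
  then have "eventually (\<lambda>n. ((real n + 3) / (real n + 2))\<^sup>2 * q < c) sequentially"
    using c by (intro order_tendstoD) auto
  then obtain N where N: "\<And>n. n \<ge> N \<Longrightarrow> ((real n + 3) / (real n + 2))\<^sup>2 * q < c"
    by (auto simp: eventually_sequentially)
  show ?thesis
  proof (rule summable_ratio_test[OF c(2), of N])
    fix n assume "N \<le> n"
    have "norm ((real (Suc n) + 2)\<^sup>2 * q ^ Suc n) = ((real n + 3) / (real n + 2))\<^sup>2 * q * ((real n + 2)\<^sup>2 * q ^ n)"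
      using q by (simp add: power_divide add_ac abs_mult)
    also have "\<dots> \<le> c * ((real n + 2)\<^sup>2 * q ^ n)"
      using N[OF \<open>N \<le> n\<close>] q by (intro mult_right_mono) auto
    finally show "norm ((real (Suc n) + 2)\<^sup>2 * q ^ Suc n) \<le> c * norm ((real n + 2)\<^sup>2 * q ^ n)"
      using q by (simp add: abs_mult)
  qed
qed

lemma poisson_summable: "0 < p \<Longrightarrow> summable (\<lambda>j. 4 powr p * ((real j + 2)\<^sup>2 * (2 powr (-p)) ^ j))"
  by (intro summable_mult summable_square_geometric) (auto simp: powr_minus divide_simps)

text \<open>
  On the shell where \<open>\<bar>1 - cnj w * z\<bar>\<close> is about \<open>2\<^sup>j * \<delta>\<close> with \<open>\<delta> = 1 - \<bar>w\<bar>\<close>, kernel times measure is about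
  \<open>2 powr (- j * p)\<close> divided by the square of \<open>ln (2 / (2\<^bsup>j+1\<^esup> * \<delta>))\<close>. Passing from \<open>2\<^bsup>j+1\<^esup> * \<delta>\<close> to \<open>\<delta>\<close>
  changes the logarithm by a factor of at most \<open>j + 2\<close>, which the geometric decay absorbs.
\<close>

lemma log_carleson_poisson:
  assumes p: "0 < p" and M: "sets \<nu> = sets borel" and lc: "log_carleson p \<nu> A" and A: "0 \<le> A"
    and w: "w \<in> unit_disc"
  shows "(\<integral>\<^sup>+z\<in>unit_disc. ennreal (poisson_kernel w z powr p) \<partial>\<nu>) \<le>
     ennreal (poisson_const p * A / (ln (2 / (1 - cmod w)))\<^sup>2)"
proof -
  define x where "x = (\<lambda>z. cmod (1 - cnj w * z))"
  define \<delta> where "\<delta> = 1 - cmod w"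
  have \<delta>: "0 < \<delta>" "\<delta> \<le> 1" using w by (auto simp: \<delta>_def)
  have xge: "\<delta> \<le> x z" if "z \<in> unit_disc" for z
    unfolding x_def \<delta>_def by (rule norm_one_minus_ge(1)[OF w that])
  define L where "L = ln (2 / \<delta>)"
  have L: "ln 2 \<le> L" unfolding L_def using \<delta> by (subst ln_le_cancel_iff) (auto simp: field_simps)
  have L0: "0 < L" using L ln_gt_zero[of "2::real"] by linarith
  have recip: "1 / a \<le> X / b" if "b \<le> X * a" "0 < a" "0 < b" for a b X :: real
    using that by (simp add: field_simps)
  define S where "S = (\<lambda>j::nat. if 2 ^ Suc j * \<delta> \<le> 1 then {z \<in> unit_disc. x z \<le> 2 ^ Suc j * \<delta>} else unit_disc)"
  define m where "m = (\<lambda>j::nat. A * (2 ^ Suc j * \<delta>) powr p * (real j + 2)\<^sup>2 / L\<^sup>2)"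
  define c where "c = (\<lambda>j::nat. (2 * \<delta>) powr p * (2 ^ j * \<delta>) powr (- (2 * p)))"
  define b where "b = (\<lambda>j. (4 powr p * ((real j + 2)\<^sup>2 * (2 powr (-p)) ^ j)) * (A / L\<^sup>2))"
  have "(\<integral>\<^sup>+z\<in>unit_disc. ennreal (poisson_kernel w z powr p) \<partial>\<nu>) \<le> ennreal (suminf b)"
  proof (rule nn_integral_le_layers[OF M, where S = S and c = c and m = m])
    show "S j \<in> sets borel" for j unfolding S_def x_def by simp
    show "0 \<le> c j" for j by (simp add: c_def)
    show "0 \<le> m j" for j using A by (simp add: m_def)
    show "summable b" unfolding b_def by (intro summable_mult2 poisson_summable p)
    show "emeasure \<nu> (S j) \<le> ennreal (m j)" for j
    \<comment> \<open>Shells beyond radius \<open>1\<close> are replaced by the whole disc, whose mass is that of the ball of radius \<open>1\<close>.\<close>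
    proof (cases "2 ^ Suc j * \<delta> \<le> 1")
      case True
      define s where "s = 2 ^ Suc j * \<delta>"
      have s: "0 < s" "s \<le> 1" using True \<delta> by (auto simp: s_def)
      define u where "u = ln (2 / s)"
      have u: "ln 2 \<le> u" unfolding u_def using s by (subst ln_le_cancel_iff) (auto simp: field_simps)
      have u0: "0 < u" using u ln_gt_zero[of "2::real"] by linarith
      have "2 / \<delta> = 2 ^ Suc j * (2 / s)" using \<delta> by (simp add: s_def)
      then have "L = ln (2 ^ Suc j) + u" unfolding L_def u_def using s by (simp only: ln_mult_pos zero_less_power zero_less_numeral zero_less_divide_iff simp_thms)
      also have "\<dots> = real (Suc j) * ln 2 + u" by (simp only: ln_realpow zero_less_numeral)
      also have "\<dots> \<le> real (Suc j) * u + u" using u by (intro add_right_mono mult_left_mono) auto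
      finally have "L \<le> (real j + 2) * u" by (simp add: algebra_simps)
      then have "L\<^sup>2 \<le> ((real j + 2) * u)\<^sup>2" using L0 by (intro power_mono) auto
      then have "1 / u\<^sup>2 \<le> (real j + 2)\<^sup>2 / L\<^sup>2"
        unfolding power_mult_distrib using L0 u0 by (intro recip) auto
      from mult_left_mono[OF this, of "A * s powr p"] A
      have "A * s powr p / u\<^sup>2 \<le> m j" by (simp add: m_def s_def)
      moreover have "emeasure \<nu> {z \<in> unit_disc. x z \<le> s} \<le> ennreal (A * s powr p / u\<^sup>2)"
        using lc w s unfolding log_carleson_def x_def u_def by blast
      ultimately show ?thesis using True unfolding S_def s_def[symmetric]
        by (simp add: s_def[symmetric]) (meson ennreal_leI order.trans)
    next
      case False
      then have big: "1 < 2 ^ Suc j * \<delta>" by simp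
      have "2 / \<delta> < 2 * 2 ^ Suc j" using big \<delta> by (simp add: field_simps)
      also have "\<dots> = 2 ^ (j + 2)" by simp
      finally have "L \<le> ln (2 ^ (j + 2))" unfolding L_def using \<delta> by (subst ln_le_cancel_iff) auto
      also have "\<dots> = (real j + 2) * ln 2" by (subst ln_realpow) auto
      finally have "L\<^sup>2 \<le> ((real j + 2) * ln 2)\<^sup>2" using L0 by (intro power_mono) auto
      then have "1 / (ln 2)\<^sup>2 \<le> (real j + 2)\<^sup>2 / L\<^sup>2"
        unfolding power_mult_distrib using L0 by (intro recip) auto
      also have "\<dots> \<le> (2 ^ Suc j * \<delta>) powr p * ((real j + 2)\<^sup>2 / L\<^sup>2)"
        using ge_one_powr_ge_zero[of "2 ^ Suc j * \<delta>" p] big p mult_right_mono[of 1 "(2 ^ Suc j * \<delta>) powr p" "(real j + 2)\<^sup>2 / L\<^sup>2"]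
        by simp
      finally have "A * (1 / (ln 2)\<^sup>2) \<le> A * ((2 ^ Suc j * \<delta>) powr p * ((real j + 2)\<^sup>2 / L\<^sup>2))"
        by (rule mult_left_mono[OF _ A])
      then have "A / (ln 2)\<^sup>2 \<le> m j" by (simp add: m_def)
      then show ?thesis using False log_carleson_total[OF lc] unfolding S_def
        by simp (meson ennreal_leI order.trans)
    qed
    show "\<exists>j. z \<in> S j \<and> ennreal (poisson_kernel w z powr p) \<le> ennreal (c j)" if z: "z \<in> unit_disc" for z
    proof -
      define j where "j = (LEAST n. x z < 2 ^ Suc n * \<delta>)"
      obtain n where "x z / \<delta> < 2 ^ n" using real_arch_pow[of 2 "x z / \<delta>"] by auto
      then have "x z < 2 ^ n * \<delta>" using \<delta> by (simp add: field_simps)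
      also have "\<dots> \<le> 2 ^ Suc n * \<delta>" using \<delta> by simp
      finally have j: "x z < 2 ^ Suc j * \<delta>" unfolding j_def by (rule LeastI)
      have ge: "2 ^ j * \<delta> \<le> x z"
      proof (cases j)
        case 0
        then show ?thesis using xge[OF z] by simp
      next
        case (Suc l)
        then have "\<not> x z < 2 ^ Suc l * \<delta>"
          using not_less_Least[of l "\<lambda>n. x z < 2 ^ Suc n * \<delta>"] by (simp add: j_def)
        then show ?thesis using Suc by simp
      qed
      have x0: "0 < x z" using xge[OF z] \<delta> by linarith
      have "1 - (cmod w)\<^sup>2 \<le> 2 * \<delta>"
        using zero_le_power2[of "1 - cmod w"] unfolding \<delta>_def by (simp add: power2_diff)
      have pk: "poisson_kernel w z powr p = (1 - (cmod w)\<^sup>2) powr p * x z powr (- (2 * p))"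
      proof -
        have "(x z)\<^sup>2 powr p = x z powr (2 * p)"
          using x0 by (simp add: powr_powr[symmetric])
        moreover have "poisson_kernel w z = (1 - (cmod w)\<^sup>2) / (x z)\<^sup>2"
          by (simp add: poisson_kernel_def x_def)
        ultimately show ?thesis using norm_sq_disc(1)[OF w] x0
          by (simp add: powr_divide powr_minus_divide)
      qed
      also have "\<dots> \<le> c j" unfolding c_def
        using norm_sq_disc(1)[OF w] \<open>1 - (cmod w)\<^sup>2 \<le> 2 * \<delta>\<close> p ge \<delta>
        by (intro mult_mono powr_mono2 powr_mono2') auto
      finally have "poisson_kernel w z powr p \<le> c j" .
      moreover have "z \<in> S j" using z j by (auto simp: S_def)
      ultimately show ?thesis by (auto intro!: exI[of _ j] ennreal_leI)
    qed
    show "c j * m j \<le> b j" for j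
    proof -
      have "(2 * \<delta>) powr p * (2 ^ j * \<delta>) powr (- (2 * p)) * (2 ^ Suc j * \<delta>) powr p = 4 powr p * (2 powr (-p)) ^ j"
      proof -
        have e1: "(2 * \<delta>) powr p = 2 powr p * \<delta> powr p" using \<delta> by (simp add: powr_mult)
        have e2: "(2 ^ Suc j * \<delta>) powr p = 2 powr p * ((2 powr p) ^ j * \<delta> powr p)"
          using \<delta> by (simp add: powr_mult powr_powr powr_realpow[symmetric] mult_ac)
        have e3: "(2 ^ j * \<delta>) powr (- (2 * p)) = ((2 powr (-p)) ^ j * (2 powr (-p)) ^ j) * (\<delta> powr (-p) * \<delta> powr (-p))"
          using \<delta> by (simp add: powr_mult powr_powr powr_realpow[symmetric] powr_add[symmetric] algebra_simps)
        have e4: "(2 powr p) ^ j * (2 powr (-p)) ^ j = 1"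
          by (simp add: power_mult_distrib[symmetric] powr_add[symmetric])
        have e5: "\<delta> powr p * \<delta> powr (-p) = 1" using \<delta> by (simp add: powr_add[symmetric])
        have e6: "4 powr p = 2 powr p * 2 powr p" by (simp add: powr_mult[symmetric])
        have "(2 * \<delta>) powr p * (2 ^ j * \<delta>) powr (- (2 * p)) * (2 ^ Suc j * \<delta>) powr p =
            (2 powr p * 2 powr p) * (2 powr (-p)) ^ j * ((2 powr p) ^ j * (2 powr (-p)) ^ j) *
            (\<delta> powr p * \<delta> powr (-p)) * (\<delta> powr p * \<delta> powr (-p))"
          unfolding e1 e2 e3 by (simp only: mult_ac)
        then show ?thesis unfolding e4 e5 e6 by simp
      qed
      then show ?thesis unfolding c_def m_def b_def by (simp add: mult_ac)
    qed
  qed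
  also have "suminf b = poisson_const p * A / L\<^sup>2"
    unfolding b_def poisson_const_def using suminf_mult2[OF poisson_summable[OF p], of "A / L\<^sup>2"] by simp
  finally show ?thesis unfolding L_def \<delta>_def .
qed

lemma norm_diff_le_one_minus_cnj:
  assumes "a \<in> unit_disc" "b \<in> unit_disc" shows "cmod (a - b) \<le> cmod (1 - cnj a * b)"
  using disc_aut_lt_1[OF assms] disc_aut_denominator[OF assms]
  by (simp add: disc_aut_def norm_divide divide_less_eq less_imp_le)

text \<open>
  With \<open>X\<close>, \<open>Y\<close> the factors \<open>\<bar>1 - cnj w * z\<bar>\<close>, \<open>\<bar>1 - cnj b * z\<bar>\<close>, where \<open>b = \<sigma>\<^sub>w a\<close>, the transformed
  kernel is the \<open>p\<close>-th power of \<open>\<bar>1 - cnj w * b\<bar> / (X * Y)\<close>. Since \<open>\<bar>z - b\<bar> \<le> Y\<close>, the triangle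
  inequality gives \<open>\<bar>1 - cnj w * b\<bar> \<le> X + Y\<close>, so the quotient is at most \<open>1 / X + 1 / Y\<close>.
\<close>

lemma poisson_kernel_transform:
  assumes p: "0 < p" and w: "w \<in> unit_disc" and a: "a \<in> unit_disc" and z: "z \<in> unit_disc"
  shows "poisson_kernel w z powr p * cmod (1 - cnj a * disc_aut w z) powr (-p) \<le>
    2 powr p * (cmod (1 - cnj w * z) powr (-p) + cmod (1 - cnj (disc_aut w a) * z) powr (-p))"
proof -
  define b where "b = disc_aut w a"
  have b: "b \<in> unit_disc" unfolding b_def by (rule disc_aut_in_disc[OF w a])
  define X where "X = cmod (1 - cnj w * z)"
  define Y where "Y = cmod (1 - cnj b * z)"
  define Z where "Z = cmod (1 - cnj a * w)"
  define d where "d = 1 - (cmod w)\<^sup>2"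
  have X: "0 < X" and Y: "0 < Y" and Z: "0 < Z" and d: "0 < d"
    using disc_aut_denominator w z b a norm_sq_disc(1)[OF w] by (auto simp: X_def Y_def Z_def d_def)
  have Z': "cmod (1 - cnj w * a) = Z"
  proof -
    have "cmod (1 - cnj w * a) = cmod (cnj (1 - cnj w * a))" by (simp only: complex_mod_cnj)
    then show ?thesis by (simp add: Z_def mult.commute)
  qed
  have "cmod (1 - cnj w * b) = d / Z"
    unfolding b_def one_minus_cnj_disc_aut[OF w a w]
    using norm_one_minus_cnj_mult_self[OF w] by (simp add: norm_mult norm_divide Z' d_def)
  moreover have "cmod (1 - cnj w * b) \<le> X + Y"
  proof -
    have "cmod (1 - cnj w * b) = cmod ((1 - cnj w * z) + cnj w * (z - b))" by (simp add: algebra_simps)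
    also have "\<dots> \<le> X + cmod w * cmod (z - b)"
      unfolding X_def by (rule order.trans[OF norm_triangle_ineq]) (simp add: norm_mult)
    also have "cmod w * cmod (z - b) \<le> 1 * cmod (b - z)"
      using w by (subst norm_minus_commute, intro mult_right_mono) auto
    also have "\<dots> \<le> Y" unfolding Y_def using norm_diff_le_one_minus_cnj[OF b z] by simp
    finally show ?thesis by simp
  qed
  ultimately have dZ: "d / Z \<le> X + Y" by simp
  have n: "cmod (1 - cnj a * disc_aut w z) = Z * Y / X"
    unfolding one_minus_cnj_disc_aut[OF w z a] b_def[symmetric]
    by (simp add: norm_mult norm_divide X_def Y_def Z_def)
  have "poisson_kernel w z powr p * cmod (1 - cnj a * disc_aut w z) powr (-p) =
      (poisson_kernel w z / (Z * Y / X)) powr p"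
    unfolding n using d X Y Z
    by (simp add: poisson_kernel_def powr_divide powr_mult powr_minus_divide d_def[symmetric] X_def[symmetric])
  also have "poisson_kernel w z / (Z * Y / X) = (d / Z) / (X * Y)"
    using X by (simp add: poisson_kernel_def d_def X_def power2_eq_square)
  also have "((d / Z) / (X * Y)) powr p \<le> (2 * max (1 / X) (1 / Y)) powr p"
  proof (intro powr_mono2 less_imp_le[OF p])
    have "(d / Z) / (X * Y) \<le> (X + Y) / (X * Y)" using dZ X Y by (intro divide_right_mono) auto
    also have "\<dots> = 1 / X + 1 / Y" using X Y by (simp add: field_simps)
    finally show "(d / Z) / (X * Y) \<le> 2 * max (1 / X) (1 / Y)" by linarith
  qed (use d Z X Y in auto)
  also have "\<dots> = 2 powr p * (max (1 / X) (1 / Y)) powr p"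
    by (rule powr_mult)
  also have "(max (1 / X) (1 / Y)) powr p \<le> X powr (-p) + Y powr (-p)"
    using X Y by (auto simp: max_def powr_divide powr_minus_divide)
  finally show ?thesis by (simp add: X_def Y_def b_def)
qed

definition embed_const :: "real \<Rightarrow> real" where
  "embed_const p = 2 * (bloch_const p + 2)\<^sup>2 * poisson_const p
     + 4 * 2 powr p * ((1 + p) / (pi * p)) * kernel_const p"

lemma kernel_const_nonneg: "0 \<le> kernel_const p"
  unfolding kernel_const_def by (intro suminf_nonneg kernel_summable) auto

lemma poisson_const_nonneg: "0 < p \<Longrightarrow> 0 \<le> poisson_const p"
  unfolding poisson_const_def by (intro suminf_nonneg poisson_summable) auto

lemma embed_const_nonneg: "0 < p \<Longrightarrow> 0 \<le> embed_const p"
  unfolding embed_const_def using kernel_const_nonneg[of p] poisson_const_nonneg[of p]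
  by (intro add_nonneg_nonneg mult_nonneg_nonneg) auto

text \<open>
  The constant \<open>f w\<close> costs a squared logarithm, which is the gain of the Poisson integral. The
  difference \<open>f - f w\<close> is transplanted by \<open>\<sigma>\<^sub>w\<close> to a function vanishing at \<open>0\<close>, and the measure is
  transplanted along; the embedding theorem applies because its kernel condition is conformally
  invariant.
\<close>

theorem log_carleson_embedding:
  assumes p: "0 < p" and M: "sets \<nu> = sets borel" and lc: "log_carleson p \<nu> A" and A: "0 \<le> A"
    and f: "f holomorphic_on unit_disc" and f0: "cmod (f 0) \<le> B"
    and E: "\<And>w. w \<in> unit_disc \<Longrightarrow> Qp_energy p f w \<le> ennreal (B\<^sup>2)"
    and w: "w \<in> unit_disc"
  shows "(\<integral>\<^sup>+z\<in>unit_disc. ennreal ((cmod (f z))\<^sup>2 * poisson_kernel w z powr p) \<partial>\<nu>) \<le>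
     ennreal (embed_const p * A * B\<^sup>2)"
proof -
  note [measurable_cong] = M
  have B: "0 \<le> B" using f0 norm_ge_zero order.trans by blast
  define fw where "fw = f w"
  define D where "D = (\<lambda>z. f z - fw)"
  have D_hol: "D holomorphic_on unit_disc" unfolding D_def by (intro holomorphic_intros f)
  have D_meas [measurable]: "(\<lambda>z. indicator unit_disc z *\<^sub>R D z) \<in> borel_measurable borel"
    by (intro borel_measurable_continuous_on_indicator holomorphic_on_imp_continuous_on D_hol) auto
  define P where "P = (\<lambda>z. poisson_kernel w z powr p)"
  have P [measurable]: "P \<in> borel_measurable borel" and P0: "0 \<le> P z" for z unfolding P_def by auto
  define T1 where "T1 = (\<integral>\<^sup>+z\<in>unit_disc. ennreal (P z) \<partial>\<nu>)"
  define T2 where "T2 = (\<integral>\<^sup>+z. ennreal ((cmod (indicator unit_disc z *\<^sub>R D z))\<^sup>2 * P z) \<partial>\<nu>)"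
  \<comment> \<open>The contribution of the constant \<open>f w\<close>: growth estimate against Poisson integral.\<close>
  define L where "L = ln (2 / (1 - cmod w))"
  have w1: "0 < 1 - cmod w" "1 - cmod w \<le> 1" using w by auto
  have L2: "ln 2 \<le> L" unfolding L_def using w1 by (subst ln_le_cancel_iff) (auto simp: field_simps)
  have L0: "0 < L" using L2 ln_gt_zero[of "2::real"] by linarith
  have T1: "ennreal (2 * (cmod fw)\<^sup>2) * T1 \<le> ennreal (2 * (bloch_const p + 2)\<^sup>2 * poisson_const p * A * B\<^sup>2)"
  proof -
    have "cmod (fw - f 0) \<le> bloch_const p * B * ln (1 / (1 - cmod w))"
      unfolding fw_def by (rule growth_estimate[OF p f w E B])
    also have "\<dots> \<le> bloch_const p * B * L"
      unfolding L_def using w1 bloch_const_pos[OF p] B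
      by (intro mult_left_mono) (auto simp: ln_div intro!: mult_nonneg_nonneg)
    finally have "cmod fw \<le> bloch_const p * B * L + B"
      using norm_triangle_sub[of fw "f 0"] f0 by linarith
    moreover have "B \<le> 2 * B * L"
    proof -
      have "1 \<le> 2 * L" using L2 ln2_ge_two_thirds by linarith
      from mult_left_mono[OF this B] show ?thesis by (simp add: mult_ac)
    qed
    moreover have "(bloch_const p + 2) * B * L = bloch_const p * B * L + 2 * B * L" by (simp add: algebra_simps)
    ultimately have "cmod fw \<le> (bloch_const p + 2) * B * L" by linarith
    then have "(cmod fw)\<^sup>2 \<le> ((bloch_const p + 2) * B * L)\<^sup>2" by (intro power_mono) auto
    then have fw2: "2 * (cmod fw)\<^sup>2 \<le> 2 * ((bloch_const p + 2) * B * L)\<^sup>2" by simp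
    have "ennreal (2 * (cmod fw)\<^sup>2) * T1 \<le> ennreal (2 * ((bloch_const p + 2) * B * L)\<^sup>2) * ennreal (poisson_const p * A / L\<^sup>2)"
      unfolding T1_def P_def L_def
      by (intro mult_mono ennreal_leI fw2[unfolded L_def] log_carleson_poisson[OF p M lc A w]) auto
    also have "\<dots> = ennreal (2 * ((bloch_const p + 2) * B * L)\<^sup>2 * (poisson_const p * A / L\<^sup>2))"
      using poisson_const_nonneg[OF p] A by (subst ennreal_mult[symmetric]) auto
    also have "2 * ((bloch_const p + 2) * B * L)\<^sup>2 * (poisson_const p * A / L\<^sup>2) = 2 * (bloch_const p + 2)\<^sup>2 * poisson_const p * A * B\<^sup>2"
      using L0 by (simp add: power_mult_distrib)
    finally show ?thesis .
  qed
  \<comment> \<open>The contribution of \<open>f - f w\<close>: \<open>N\<close> is the image under \<open>\<sigma>\<^sub>w\<close> of the measure weighted by the kernel, and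
    \<open>h\<close> is the corresponding function, vanishing at \<open>0\<close>.\<close>
  have T2: "T2 \<le> ennreal ((1 + p) / (pi * p) * B\<^sup>2 * (2 powr p * (2 * kernel_const p * A)))"
  proof -
    define h where "h = (\<lambda>u. D (disc_aut w u))"
    have h: "h holomorphic_on unit_disc" "h 0 = 0"
      unfolding h_def using holomorphic_comp_disc_aut[OF D_hol w] by (auto simp: D_def fw_def)
    define N where "N = distr (density \<nu> (\<lambda>z. ennreal (P z) * indicator unit_disc z)) borel (disc_aut w)"
    have sN: "sets N = sets borel" by (simp add: N_def)
    have nnN: "(\<integral>\<^sup>+u. F u \<partial>N) = (\<integral>\<^sup>+z\<in>unit_disc. ennreal (P z) * F (disc_aut w z) \<partial>\<nu>)"
      if [measurable]: "F \<in> borel_measurable borel" for F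
    proof -
      have 1: "(\<integral>\<^sup>+u. F u \<partial>N) = (\<integral>\<^sup>+z. F (disc_aut w z) \<partial>density \<nu> (\<lambda>z. ennreal (P z) * indicator unit_disc z))"
        unfolding N_def by (rule nn_integral_distr) measurable
      also have "\<dots> = (\<integral>\<^sup>+z. (ennreal (P z) * indicator unit_disc z) * F (disc_aut w z) \<partial>\<nu>)"
        by (rule nn_integral_density) measurable
      finally show ?thesis by (simp add: mult_ac)
    qed
    have K: "(\<integral>\<^sup>+u\<in>unit_disc. ennreal (cmod (1 - cnj a * u) powr (-p)) \<partial>N) \<le> ennreal (2 powr p * (2 * kernel_const p * A))"
      if a: "a \<in> unit_disc" for a
    proof -
      define b where "b = disc_aut w a"
      have b: "b \<in> unit_disc" unfolding b_def by (rule disc_aut_in_disc[OF w a])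
      let ?J = "\<lambda>a z. ennreal (cmod (1 - cnj a * z) powr (-p)) * indicator unit_disc z"
      have J [measurable]: "?J a \<in> borel_measurable \<nu>" for a by measurable
      have "(\<integral>\<^sup>+u. ?J a u \<partial>N) = (\<integral>\<^sup>+z\<in>unit_disc. ennreal (P z) * ?J a (disc_aut w z) \<partial>\<nu>)"
        by (rule nnN) measurable
      also have "\<dots> \<le> (\<integral>\<^sup>+z. ennreal (2 powr p) * (?J w z + ?J b z) \<partial>\<nu>)"
      proof (rule nn_integral_mono)
        fix z
        show "ennreal (P z) * ?J a (disc_aut w z) * indicator unit_disc z \<le> ennreal (2 powr p) * (?J w z + ?J b z)"
        proof (cases "z \<in> unit_disc")
          case True
          have "ennreal (P z) * ?J a (disc_aut w z) * indicator unit_disc z =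
              ennreal (P z * cmod (1 - cnj a * disc_aut w z) powr (-p))"
            using True disc_aut_in_disc[OF w True] P0 by (simp add: ennreal_mult)
          also have "\<dots> \<le> ennreal (2 powr p * (cmod (1 - cnj w * z) powr (-p) + cmod (1 - cnj b * z) powr (-p)))"
            unfolding P_def b_def by (intro ennreal_leI poisson_kernel_transform p w a True)
          also have "\<dots> = ennreal (2 powr p) * (?J w z + ?J b z)"
            using True by (simp add: ennreal_mult ennreal_plus)
          finally show ?thesis .
        qed simp
      qed
      also have "\<dots> = ennreal (2 powr p) * ((\<integral>\<^sup>+z. ?J w z \<partial>\<nu>) + (\<integral>\<^sup>+z. ?J b z \<partial>\<nu>))"
        by (subst nn_integral_cmult, intro borel_measurable_add J, subst nn_integral_add[OF J J]) (rule refl)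
      also have "\<dots> \<le> ennreal (2 powr p) * (ennreal (kernel_const p * A) + ennreal (kernel_const p * A))"
        by (intro mult_left_mono add_mono log_carleson_kernel[OF p M lc A] w b) auto
      also have "\<dots> = ennreal (2 powr p * (2 * kernel_const p * A))"
      proof -
        have k: "0 \<le> kernel_const p * A" using kernel_const_nonneg[of p] A by simp
        have "2 * kernel_const p * A = kernel_const p * A + kernel_const p * A" by simp
        then show ?thesis using k by (simp only: ennreal_mult ennreal_plus powr_ge_zero add_nonneg_nonneg)
      qed
      finally show ?thesis .
    qed
    have Eh: "Qp_energy p h 0 \<le> ennreal (B\<^sup>2)"
    proof -
      have "deriv D z = deriv f z" if "z \<in> unit_disc" for z
        unfolding D_def using holomorphic_on_imp_differentiable_at[OF f open_ball that] by simp
      then have "Qp_energy p D w = Qp_energy p f w"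
        unfolding Qp_energy_def by (intro nn_integral_cong) (auto split: split_indicator)
      then show ?thesis using E[OF w] unfolding h_def Qp_energy_conformal[OF D_hol w, symmetric] by simp
    qed
    have hm [measurable]: "(\<lambda>u. indicator unit_disc u *\<^sub>R h u) \<in> borel_measurable borel"
      by (intro borel_measurable_continuous_on_indicator holomorphic_on_imp_continuous_on h) auto
    have "T2 = (\<integral>\<^sup>+z\<in>unit_disc. ennreal (P z) * ennreal ((cmod (indicator unit_disc (disc_aut w z) *\<^sub>R h (disc_aut w z)))\<^sup>2) \<partial>\<nu>)"
      unfolding T2_def
    proof (rule nn_integral_cong)
      fix z
      show "ennreal ((cmod (indicator unit_disc z *\<^sub>R D z))\<^sup>2 * P z) =
        ennreal (P z) * ennreal ((cmod (indicator unit_disc (disc_aut w z) *\<^sub>R h (disc_aut w z)))\<^sup>2) * indicator unit_disc z"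
      proof (cases "z \<in> unit_disc")
        case True
        then show ?thesis using disc_aut_in_disc[OF w True] disc_aut_involution[OF w True] P0
          by (simp add: h_def ennreal_mult mult.commute)
      qed simp
    qed
    also have "\<dots> = (\<integral>\<^sup>+u. ennreal ((cmod (indicator unit_disc u *\<^sub>R h u))\<^sup>2) \<partial>N)"
      by (rule nnN[symmetric]) measurable
    also have "\<dots> = (\<integral>\<^sup>+u\<in>unit_disc. ennreal ((cmod (h u))\<^sup>2) \<partial>N)"
      by (intro nn_integral_cong) (auto split: split_indicator)
    also have "\<dots> \<le> ennreal ((1 + p) / (pi * p) * B\<^sup>2 * (2 powr p * (2 * kernel_const p * A)))"
      using kernel_const_nonneg[of p] A by (intro dirichlet_embedding[OF p sN K _ h Eh]) auto
    finally show ?thesis .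
  qed
  have "(\<integral>\<^sup>+z\<in>unit_disc. ennreal ((cmod (f z))\<^sup>2 * poisson_kernel w z powr p) \<partial>\<nu>) \<le>
     (\<integral>\<^sup>+z. ennreal (2 * (cmod fw)\<^sup>2) * (ennreal (P z) * indicator unit_disc z) +
         ennreal 2 * ennreal ((cmod (indicator unit_disc z *\<^sub>R D z))\<^sup>2 * P z) \<partial>\<nu>)"
  proof (rule nn_integral_mono)
    fix z
    show "ennreal ((cmod (f z))\<^sup>2 * poisson_kernel w z powr p) * indicator unit_disc z \<le>
       ennreal (2 * (cmod fw)\<^sup>2) * (ennreal (P z) * indicator unit_disc z) +
         ennreal 2 * ennreal ((cmod (indicator unit_disc z *\<^sub>R D z))\<^sup>2 * P z)"
    proof (cases "z \<in> unit_disc")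
      case True
      have "cmod (f z) \<le> cmod fw + cmod (D z)" using norm_triangle_ineq[of fw "D z"] by (simp add: D_def)
      then have "(cmod (f z))\<^sup>2 \<le> (cmod fw + cmod (D z))\<^sup>2" by (intro power_mono) auto
      also have "\<dots> \<le> 2 * (cmod fw)\<^sup>2 + 2 * (cmod (D z))\<^sup>2"
        using square_sum_le_weighted[of 1 1 "cmod fw" "cmod (D z)"] by simp
      finally have "(cmod (f z))\<^sup>2 * P z \<le> (2 * (cmod fw)\<^sup>2 + 2 * (cmod (D z))\<^sup>2) * P z"
        by (rule mult_right_mono) (rule P0)
      then have "ennreal ((cmod (f z))\<^sup>2 * P z) \<le> ennreal (2 * (cmod fw)\<^sup>2 * P z + 2 * ((cmod (D z))\<^sup>2 * P z))"
        by (intro ennreal_leI) (simp add: algebra_simps)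
      also have "\<dots> = ennreal (2 * (cmod fw)\<^sup>2) * ennreal (P z) + ennreal 2 * ennreal ((cmod (D z))\<^sup>2 * P z)"
        using P0 by (subst ennreal_plus) (simp_all only: ennreal_mult mult_nonneg_nonneg zero_le_power2 zero_le_numeral)
      finally show ?thesis using True unfolding P_def by simp
    qed simp
  qed
  also have "\<dots> = ennreal (2 * (cmod fw)\<^sup>2) * T1 + ennreal 2 * T2"
    unfolding T1_def T2_def
    by (subst nn_integral_add, measurable, subst (1 2) nn_integral_cmult, measurable)
  also have "\<dots> \<le> ennreal (2 * (bloch_const p + 2)\<^sup>2 * poisson_const p * A * B\<^sup>2) +
      ennreal 2 * ennreal ((1 + p) / (pi * p) * B\<^sup>2 * (2 powr p * (2 * kernel_const p * A)))"
    by (intro add_mono T1 mult_left_mono T2) auto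
  also have "\<dots> = ennreal (2 * (bloch_const p + 2)\<^sup>2 * poisson_const p * A * B\<^sup>2 +
      2 * ((1 + p) / (pi * p) * B\<^sup>2 * (2 powr p * (2 * kernel_const p * A))))"
    using p A kernel_const_nonneg[of p] poisson_const_nonneg[OF p]
    by (subst ennreal_mult[symmetric], simp, simp, subst ennreal_plus) auto
  also have "2 * (bloch_const p + 2)\<^sup>2 * poisson_const p * A * B\<^sup>2 +
      2 * ((1 + p) / (pi * p) * B\<^sup>2 * (2 powr p * (2 * kernel_const p * A))) = embed_const p * A * B\<^sup>2"
    by (simp add: embed_const_def algebra_simps)
  finally show ?thesis .
qed

section \<open>The operators\<close>

definition weight_density :: "real \<Rightarrow> (complex \<Rightarrow> complex) \<Rightarrow> complex \<Rightarrow> ennreal" where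
  "weight_density p g z = ennreal ((1 - (cmod z)\<^sup>2) powr p * (cmod (deriv g z))\<^sup>2) * indicator unit_disc z"

text \<open>
  The measure attached to \<open>g\<close>, extended by zero from the disc to the plane, so that its measurable
  sets are all Borel sets.
\<close>

definition plane_measure :: "real \<Rightarrow> (complex \<Rightarrow> complex) \<Rightarrow> complex measure" where
  "plane_measure p g = density lborel (weight_density p g)"

lemma sets_plane_measure [simp]: "sets (plane_measure p g) = sets borel"
  by (simp add: plane_measure_def)

lemma weight_density_measurable:
  assumes g: "g holomorphic_on unit_disc"
  shows "weight_density p g \<in> borel_measurable borel"
proof -
  have [measurable]: "(\<lambda>z. indicator unit_disc z *\<^sub>R deriv g z) \<in> borel_measurable borel"
    using g by (intro borel_measurable_continuous_on_indicator holomorphic_on_imp_continuous_on holomorphic_deriv) auto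
  have "(\<lambda>z. ennreal ((1 - (cmod z)\<^sup>2) powr p * (cmod (indicator unit_disc z *\<^sub>R deriv g z))\<^sup>2) * indicator unit_disc z) \<in> borel_measurable borel"
    by measurable
  also have "(\<lambda>z. ennreal ((1 - (cmod z)\<^sup>2) powr p * (cmod (indicator unit_disc z *\<^sub>R deriv g z))\<^sup>2) * indicator unit_disc z) = weight_density p g"
    by (auto simp: fun_eq_iff weight_density_def split: split_indicator)
  finally show ?thesis .
qed

lemma emeasure_mu_measure:
  assumes g: "g holomorphic_on unit_disc" and S: "S \<in> sets borel" "S \<subseteq> unit_disc"
  shows "emeasure (mu_measure p g) S = emeasure (plane_measure p g) S"
proof -
  let ?\<phi> = "\<lambda>z. ennreal ((1 - (cmod z)\<^sup>2) powr p * (cmod (deriv g z))\<^sup>2)"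
  have m: "?\<phi> \<in> borel_measurable (restrict_space lborel unit_disc)"
    using weight_density_measurable[OF g, of p] unfolding weight_density_def
    by (subst borel_measurable_restrict_space_iff_ennreal) auto
  have "emeasure (mu_measure p g) S = (\<integral>\<^sup>+z. ?\<phi> z * indicator S z \<partial>restrict_space lborel unit_disc)"
    unfolding mu_measure_def using S by (intro emeasure_density m) (auto simp: sets_restrict_space_iff)
  also have "\<dots> = (\<integral>\<^sup>+z. ?\<phi> z * indicator S z * indicator unit_disc z \<partial>lborel)"
    by (rule nn_integral_restrict_space) auto
  also have "\<dots> = emeasure (plane_measure p g) S"
    unfolding plane_measure_def using S weight_density_measurable[OF g, of p]
    by (subst emeasure_density) (auto simp: weight_density_def mult_ac)
  finally show ?thesis .
qed

lemma emeasure_mu_measure_le: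
  assumes g: "g holomorphic_on unit_disc" and S: "S \<in> sets borel" "S \<subseteq> unit_disc" and R: "R \<subseteq> S"
  shows "emeasure (mu_measure p g) R \<le> emeasure (plane_measure p g) S"
  unfolding emeasure_mu_measure[OF g S, symmetric]
  using S by (intro emeasure_mono[OF R]) (auto simp: mu_measure_def sets_restrict_space_iff)

lemma nn_integral_plane_measure:
  assumes g: "g holomorphic_on unit_disc" and f: "f holomorphic_on unit_disc" and w: "w \<in> unit_disc"
  shows "(\<integral>\<^sup>+z\<in>unit_disc. ennreal ((cmod (f z))\<^sup>2 * poisson_kernel w z powr p) \<partial>plane_measure p g) =
    (\<integral>\<^sup>+z\<in>unit_disc. ennreal ((cmod (deriv g z * f z))\<^sup>2 * (1 - (cmod (disc_aut w z))\<^sup>2) powr p) \<partial>lborel)"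
proof -
  have [measurable]: "(\<lambda>z. indicator unit_disc z *\<^sub>R f z) \<in> borel_measurable borel"
    by (intro borel_measurable_continuous_on_indicator holomorphic_on_imp_continuous_on f) auto
  let ?F = "\<lambda>z. ennreal ((cmod (indicator unit_disc z *\<^sub>R f z))\<^sup>2 * poisson_kernel w z powr p)"
  have "(\<integral>\<^sup>+z\<in>unit_disc. ennreal ((cmod (f z))\<^sup>2 * poisson_kernel w z powr p) \<partial>plane_measure p g) =
     (\<integral>\<^sup>+z. ?F z \<partial>plane_measure p g)"
    by (intro nn_integral_cong) (auto split: split_indicator)
  also have "\<dots> = (\<integral>\<^sup>+z. weight_density p g z * ?F z \<partial>lborel)"
    unfolding plane_measure_def
  proof (rule nn_integral_density)
    show "weight_density p g \<in> borel_measurable lborel" using weight_density_measurable[OF g] by simp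
    show "?F \<in> borel_measurable lborel" by measurable
  qed
  also have "\<dots> = (\<integral>\<^sup>+z\<in>unit_disc. ennreal ((cmod (deriv g z * f z))\<^sup>2 * (1 - (cmod (disc_aut w z))\<^sup>2) powr p) \<partial>lborel)"
  proof (rule nn_integral_cong)
    fix z
    show "weight_density p g z * ?F z =
      ennreal ((cmod (deriv g z * f z))\<^sup>2 * (1 - (cmod (disc_aut w z))\<^sup>2) powr p) * indicator unit_disc z"
    proof (cases "z \<in> unit_disc")
      case True
      have "1 - (cmod (disc_aut w z))\<^sup>2 = poisson_kernel w z * (1 - (cmod z)\<^sup>2)"
        unfolding disc_aut_compl[OF w True] poisson_kernel_def by simp
      moreover have "0 \<le> poisson_kernel w z" "0 \<le> 1 - (cmod z)\<^sup>2"
        using norm_sq_disc(1)[OF w] norm_sq_disc(1)[OF True] by (auto simp: poisson_kernel_def)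
      ultimately have "(1 - (cmod (disc_aut w z))\<^sup>2) powr p = poisson_kernel w z powr p * (1 - (cmod z)\<^sup>2) powr p"
        by (simp add: powr_mult)
      then show ?thesis using True
        by (simp add: weight_density_def norm_mult power_mult_distrib mult_ac flip: ennreal_mult)
    qed (simp add: weight_density_def)
  qed
  finally show ?thesis .
qed

lemma Qp_energy_cong:
  assumes "\<And>z. z \<in> unit_disc \<Longrightarrow> cmod (deriv f z) = cmod (deriv h z)"
  shows "Qp_energy p f w = Qp_energy p h w"
  unfolding Qp_energy_def using assms by (intro nn_integral_cong) (auto split: split_indicator)

text \<open>
  On the disc a holomorphic function has a primitive, and the integral along the radius is its
  increment.
\<close>

lemma disc_primitive:
  assumes F: "F holomorphic_on unit_disc"
    and G: "\<And>z. z \<in> unit_disc \<Longrightarrow> G z = contour_integral (linepath 0 z) F"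
  shows "G holomorphic_on unit_disc" "\<And>z. z \<in> unit_disc \<Longrightarrow> deriv G z = F z" "G 0 = 0"
proof -
  obtain H where H: "\<And>z. z \<in> unit_disc \<Longrightarrow> (H has_field_derivative F z) (at z within unit_disc)"
    using holomorphic_convex_primitive'[OF convex_ball open_ball F] by blast
  have eq: "G z = H z - H 0" if z: "z \<in> unit_disc" for z
  proof -
    have "(F has_contour_integral (H (pathfinish (linepath 0 z)) - H (pathstart (linepath 0 z)))) (linepath 0 z)"
    proof (rule contour_integral_primitive[OF H])
      show "path_image (linepath 0 z) \<subseteq> unit_disc"
        using z by (simp add: closed_segment_subset)
    qed auto
    then show ?thesis using G[OF z] by (simp add: contour_integral_unique)
  qed
  have d: "(G has_field_derivative F z) (at z)" if z: "z \<in> unit_disc" for z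
  proof -
    have "((\<lambda>z. H z - H 0) has_field_derivative F z) (at z)"
      using H[OF z] z by (auto intro!: derivative_eq_intros simp: at_within_open[OF z open_ball])
    then show ?thesis
      by (rule DERIV_cong_ev[OF refl _ refl, THEN iffD1, rotated])
         (use eq in \<open>auto intro!: eventually_mono[OF eventually_nhds_in_open[OF open_ball z]]\<close>)
  qed
  show "G holomorphic_on unit_disc" unfolding holomorphic_on_open[OF open_ball] using d by blast
  show "deriv G z = F z" if "z \<in> unit_disc" for z by (rule DERIV_imp_deriv[OF d[OF that]])
  show "G 0 = 0" using eq[of 0] by simp
qed

lemma V_op_props:
  assumes g: "g holomorphic_on unit_disc" and f: "f holomorphic_on unit_disc"
  shows "V_op g f holomorphic_on unit_disc" "z \<in> unit_disc \<Longrightarrow> deriv (V_op g f) z = deriv g z * f z"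
    "V_op g f 0 = 0" "z \<notin> unit_disc \<Longrightarrow> V_op g f z = 0"
proof -
  have F: "(\<lambda>w. deriv g w * f w) holomorphic_on unit_disc"
    using g f by (intro holomorphic_intros) auto
  note * = disc_primitive[OF F, of "V_op g f"]
  show "V_op g f holomorphic_on unit_disc" "z \<in> unit_disc \<Longrightarrow> deriv (V_op g f) z = deriv g z * f z" "V_op g f 0 = 0"
    using * by (auto simp: V_op_def)
  show "z \<notin> unit_disc \<Longrightarrow> V_op g f z = 0" by (simp add: V_op_def)
qed

lemma U_op_props:
  assumes g: "g holomorphic_on unit_disc" and f: "f holomorphic_on unit_disc"
  shows "U_op g f holomorphic_on unit_disc" "z \<in> unit_disc \<Longrightarrow> deriv (U_op g f) z = g z * deriv f z"
    "U_op g f 0 = 0" "z \<notin> unit_disc \<Longrightarrow> U_op g f z = 0"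
proof -
  have F: "(\<lambda>w. g w * deriv f w) holomorphic_on unit_disc"
    using g f by (intro holomorphic_intros) auto
  note * = disc_primitive[OF F, of "U_op g f"]
  show "U_op g f holomorphic_on unit_disc" "z \<in> unit_disc \<Longrightarrow> deriv (U_op g f) z = g z * deriv f z" "U_op g f 0 = 0"
    using * by (auto simp: U_op_def)
  show "z \<notin> unit_disc \<Longrightarrow> U_op g f z = 0" by (simp add: U_op_def)
qed

lemma M_op_props:
  assumes g: "g holomorphic_on unit_disc" and f: "f holomorphic_on unit_disc"
  shows "M_op g f holomorphic_on unit_disc"
    "z \<in> unit_disc \<Longrightarrow> deriv (M_op g f) z = deriv g z * f z + g z * deriv f z"
    "z \<notin> unit_disc \<Longrightarrow> M_op g f z = 0"
proof -
  have d: "(M_op g f has_field_derivative (deriv g z * f z + g z * deriv f z)) (at z)" if z: "z \<in> unit_disc" for z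
  proof -
    have "((\<lambda>z. f z * g z) has_field_derivative (deriv g z * f z + g z * deriv f z)) (at z)"
      by (auto intro!: derivative_eq_intros holomorphic_derivI[OF f open_ball z] holomorphic_derivI[OF g open_ball z])
    then show ?thesis
      by (rule DERIV_cong_ev[OF refl _ refl, THEN iffD1, rotated])
         (use z in \<open>auto simp: M_op_def intro!: eventually_mono[OF eventually_nhds_in_open[OF open_ball z]]\<close>)
  qed
  show "M_op g f holomorphic_on unit_disc" unfolding holomorphic_on_open[OF open_ball] using d by blast
  show "z \<in> unit_disc \<Longrightarrow> deriv (M_op g f) z = deriv g z * f z + g z * deriv f z"
    by (rule DERIV_imp_deriv[OF d])
  show "z \<notin> unit_disc \<Longrightarrow> M_op g f z = 0" by (simp add: M_op_def)
qed

lemma Qp_energy_V_op: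
  assumes g: "g holomorphic_on unit_disc" and f: "f holomorphic_on unit_disc" and w: "w \<in> unit_disc"
  shows "Qp_energy p (V_op g f) w =
    (\<integral>\<^sup>+z\<in>unit_disc. ennreal ((cmod (f z))\<^sup>2 * poisson_kernel w z powr p) \<partial>plane_measure p g)"
  unfolding nn_integral_plane_measure[OF g f w] Qp_energy_def
  using V_op_props(2)[OF g f] by (intro nn_integral_cong) (auto split: split_indicator)

lemma Qp_energy_U_op_le:
  assumes g: "g holomorphic_on unit_disc" and f: "f holomorphic_on unit_disc" and w: "w \<in> unit_disc"
    and G: "\<And>z. z \<in> unit_disc \<Longrightarrow> cmod (g z) \<le> G" and E: "Qp_energy p f w \<le> ennreal (B\<^sup>2)"
  shows "Qp_energy p (U_op g f) w \<le> ennreal ((G * B)\<^sup>2)"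
proof -
  have G0: "0 \<le> G" using G[of 0] order.trans[OF norm_ge_zero] by auto
  have "Qp_energy p (U_op g f) w \<le> (\<integral>\<^sup>+z. ennreal (G\<^sup>2) *
      (ennreal ((cmod (deriv f z))\<^sup>2 * (1 - (cmod (disc_aut w z))\<^sup>2) powr p) * indicator unit_disc z) \<partial>lborel)"
    unfolding Qp_energy_def
  proof (rule nn_integral_mono)
    fix z
    show "ennreal ((cmod (deriv (U_op g f) z))\<^sup>2 * (1 - (cmod (disc_aut w z))\<^sup>2) powr p) * indicator unit_disc z \<le>
      ennreal (G\<^sup>2) * (ennreal ((cmod (deriv f z))\<^sup>2 * (1 - (cmod (disc_aut w z))\<^sup>2) powr p) * indicator unit_disc z)"
    proof (cases "z \<in> unit_disc")
      case True
      have "(cmod (deriv (U_op g f) z))\<^sup>2 \<le> G\<^sup>2 * (cmod (deriv f z))\<^sup>2"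
        unfolding U_op_props(2)[OF g f True] norm_mult power_mult_distrib
        by (intro mult_right_mono power_mono G True) auto
      from mult_right_mono[OF this, of "(1 - (cmod (disc_aut w z))\<^sup>2) powr p"] show ?thesis
        using True by (simp add: ennreal_leI mult.assoc flip: ennreal_mult)
    qed simp
  qed
  also have "\<dots> = ennreal (G\<^sup>2) * Qp_energy p f w"
    unfolding Qp_energy_def by (rule nn_integral_cmult[OF Qp_integrand_measurable[OF f w]])
  also have "\<dots> \<le> ennreal (G\<^sup>2) * ennreal (B\<^sup>2)" by (intro mult_left_mono E) auto
  also have "\<dots> = ennreal ((G * B)\<^sup>2)" by (simp add: power_mult_distrib flip: ennreal_mult)
  finally show ?thesis .
qed

text \<open>
  This is used in both directions for \<open>(M\<^sub>g f)' = (V\<^sub>g f)' + (U\<^sub>g f)'\<close>: to bound \<open>M\<^sub>g\<close> by \<open>V\<^sub>g\<close> and \<open>U\<^sub>g\<close>, and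
  \<open>V\<^sub>g\<close> by \<open>M\<^sub>g\<close> and \<open>U\<^sub>g\<close>.
\<close>

lemma Qp_energy_sum_le:
  assumes f: "f holomorphic_on unit_disc" and h: "h holomorphic_on unit_disc" and w: "w \<in> unit_disc"
    and le: "\<And>z. z \<in> unit_disc \<Longrightarrow> cmod (deriv k z) \<le> cmod (deriv f z) + cmod (deriv h z)"
    and E: "Qp_energy p f w \<le> ennreal (A\<^sup>2)" "Qp_energy p h w \<le> ennreal (B\<^sup>2)" and AB: "0 \<le> A" "0 \<le> B"
  shows "Qp_energy p k w \<le> ennreal ((2 * (A + B))\<^sup>2)"
proof -
  let ?W = "\<lambda>z. (1 - (cmod (disc_aut w z))\<^sup>2) powr p"
  let ?I = "\<lambda>f z. ennreal ((cmod (deriv f z))\<^sup>2 * ?W z) * indicator unit_disc z"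
  have mf: "?I f \<in> borel_measurable lborel" and mh: "?I h \<in> borel_measurable lborel"
    using Qp_integrand_measurable f h w by blast+
  have "Qp_energy p k w \<le> (\<integral>\<^sup>+z. ennreal 2 * (?I f z + ?I h z) \<partial>lborel)"
    unfolding Qp_energy_def
  proof (rule nn_integral_mono)
    fix z
    show "?I k z \<le> ennreal 2 * (?I f z + ?I h z)"
    proof (cases "z \<in> unit_disc")
      case True
      have "(cmod (deriv k z))\<^sup>2 \<le> (cmod (deriv f z) + cmod (deriv h z))\<^sup>2" by (intro power_mono le True) auto
      also have "\<dots> \<le> 2 * ((cmod (deriv f z))\<^sup>2 + (cmod (deriv h z))\<^sup>2)"
        using square_sum_le_weighted[of 1 1 "cmod (deriv f z)" "cmod (deriv h z)"] by simp
      finally have "(cmod (deriv k z))\<^sup>2 * ?W z \<le> 2 * ((cmod (deriv f z))\<^sup>2 + (cmod (deriv h z))\<^sup>2) * ?W z"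
        by (rule mult_right_mono) simp
      also have "\<dots> = 2 * ((cmod (deriv f z))\<^sup>2 * ?W z + (cmod (deriv h z))\<^sup>2 * ?W z)" by (simp add: algebra_simps)
      finally have "ennreal ((cmod (deriv k z))\<^sup>2 * ?W z) \<le> ennreal (2 * ((cmod (deriv f z))\<^sup>2 * ?W z + (cmod (deriv h z))\<^sup>2 * ?W z))"
        by (rule ennreal_leI)
      then show ?thesis using True by (simp add: ennreal_mult)
    qed simp
  qed
  also have "\<dots> = ennreal 2 * (Qp_energy p f w + Qp_energy p h w)"
    unfolding Qp_energy_def
    by (subst nn_integral_cmult, intro borel_measurable_add mf mh, subst nn_integral_add[OF mf mh]) (rule refl)
  also have "\<dots> \<le> ennreal 2 * (ennreal (A\<^sup>2) + ennreal (B\<^sup>2))"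
    by (intro mult_left_mono add_mono E) auto
  also have "\<dots> = ennreal (2 * (A\<^sup>2 + B\<^sup>2))"
    by (simp only: ennreal_plus[symmetric] ennreal_mult[symmetric] zero_le_power2 zero_le_numeral add_nonneg_nonneg)
  also have "\<dots> \<le> ennreal ((2 * (A + B))\<^sup>2)"
  proof (rule ennreal_leI)
    have "0 \<le> A * B" using AB by simp
    moreover have "(2 * (A + B))\<^sup>2 = 4 * A\<^sup>2 + 8 * (A * B) + 4 * B\<^sup>2" by (simp add: power2_eq_square algebra_simps)
    moreover have "0 \<le> A\<^sup>2" "0 \<le> B\<^sup>2" by auto
    moreover have "2 * (A\<^sup>2 + B\<^sup>2) = 2 * A\<^sup>2 + 2 * B\<^sup>2" by simp
    ultimately show "2 * (A\<^sup>2 + B\<^sup>2) \<le> (2 * (A + B))\<^sup>2" by linarith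
  qed
  finally show ?thesis .
qed

text \<open>
  The mass that a logarithmic Carleson measure may give, up to a constant, to the square over an arc
  of length \<open>t\<close>.
\<close>

definition arc_gauge :: "real \<Rightarrow> real \<Rightarrow> real" where
  "arc_gauge p t = t powr p / (ln (2 / t))\<^sup>2"

lemma arc_gauge_pos: "0 < t \<Longrightarrow> t \<le> 1 \<Longrightarrow> 0 < arc_gauge p t"
proof -
  assume t: "0 < t" "t \<le> 1"
  then have "0 < ln (2 / t)" by (intro ln_gt_zero) (simp add: field_simps)
  then show ?thesis using t by (simp add: arc_gauge_def)
qed

lemma arc_gauge_mono: "0 < p \<Longrightarrow> 0 < s \<Longrightarrow> s \<le> t \<Longrightarrow> t \<le> 1 \<Longrightarrow> arc_gauge p s \<le> arc_gauge p t"
  unfolding arc_gauge_def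
  by (intro frac_le powr_mono2 power_mono zero_less_power ln_gt_zero ln_mono ln_ge_zero) (auto simp: field_simps)

lemma LCM_norm_finite_iff:
  "LCM_norm p \<mu> < \<infinity> \<longleftrightarrow> (\<exists>A\<ge>0. \<forall>I\<in>subarcs. emeasure \<mu> (carleson_square I) \<le> ennreal (A * arc_gauge p (arc_length I)))"
proof -
  have len: "0 < arc_length I" "arc_length I \<le> 1" if "I \<in> subarcs" for I
    using that arc_length_le_1 by (auto simp: subarcs_def)
  have g: "arc_length I powr p * (ln (2 / arc_length I)) powi (-2) = arc_gauge p (arc_length I)" for I
    by (simp add: arc_gauge_def power_int_minus divide_inverse)
  have iff: "ennreal_sqrt (emeasure \<mu> S / ennreal d) \<le> ennreal C \<longleftrightarrow> emeasure \<mu> S \<le> ennreal (C\<^sup>2 * d)"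
    if "0 < d" "0 \<le> C" for d C S
  proof -
    have "emeasure \<mu> S / ennreal d \<le> ennreal (C\<^sup>2) \<longleftrightarrow> emeasure \<mu> S \<le> ennreal (C\<^sup>2) * ennreal d"
      using that by (cases "emeasure \<mu> S")
        (auto simp: divide_ennreal ennreal_mult[symmetric] pos_divide_le_eq ennreal_top_divide top_unique)
    then show ?thesis using that by (simp add: ennreal_sqrt_le_iff ennreal_mult)
  qed
  show ?thesis
  proof
    assume fin: "LCM_norm p \<mu> < \<infinity>"
    define C where "C = enn2real (LCM_norm p \<mu>)"
    have C: "LCM_norm p \<mu> = ennreal C" "0 \<le> C" using fin by (auto simp: C_def)
    have "emeasure \<mu> (carleson_square I) \<le> ennreal (C\<^sup>2 * arc_gauge p (arc_length I))" if I: "I \<in> subarcs" for I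
      unfolding iff[OF arc_gauge_pos[OF len[OF I]] C(2), symmetric] C(1)[symmetric] LCM_norm_def g
      by (rule SUP_upper[OF I])
    then show "\<exists>A\<ge>0. \<forall>I\<in>subarcs. emeasure \<mu> (carleson_square I) \<le> ennreal (A * arc_gauge p (arc_length I))"
      by (intro exI[of _ "C\<^sup>2"]) auto
  next
    assume "\<exists>A\<ge>0. \<forall>I\<in>subarcs. emeasure \<mu> (carleson_square I) \<le> ennreal (A * arc_gauge p (arc_length I))"
    then obtain A where A: "0 \<le> A" "\<And>I. I \<in> subarcs \<Longrightarrow> emeasure \<mu> (carleson_square I) \<le> ennreal (A * arc_gauge p (arc_length I))"
      by blast
    have "LCM_norm p \<mu> \<le> ennreal (sqrt A)"
      unfolding LCM_norm_def g using A by (intro SUP_least) (auto simp: iff[OF arc_gauge_pos[OF len]])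
    then show "LCM_norm p \<mu> < \<infinity>" using order.strict_trans1 ennreal_less_top by fastforce
  qed
qed

lemma log_carleson_gauge:
  "log_carleson p \<nu> A \<longleftrightarrow> (\<forall>a\<in>unit_disc. \<forall>t. 0 < t \<longrightarrow> t \<le> 1 \<longrightarrow>
     emeasure \<nu> {z \<in> unit_disc. cmod (1 - cnj a * z) \<le> t} \<le> ennreal (A * arc_gauge p t))"
  by (simp add: log_carleson_def arc_gauge_def)

lemma plane_measure_ball_le:
  assumes g: "g holomorphic_on unit_disc" and a: "a \<in> unit_disc" and t: "0 < t" "t \<le> 1"
    and le: "emeasure (mu_measure p g) (carleson_square (closed_arc (Arg a) t)) \<le> C"
  shows "emeasure (plane_measure p g) {z \<in> unit_disc. cmod (1 - cnj a * z) \<le> t} \<le> C"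
proof -
  have sub: "carleson_square (closed_arc (Arg a) t) \<subseteq> unit_disc" by (auto simp: carleson_square_def)
  have "emeasure (plane_measure p g) {z \<in> unit_disc. cmod (1 - cnj a * z) \<le> t} \<le>
     emeasure (plane_measure p g) (carleson_square (closed_arc (Arg a) t))"
    using carleson_square_closed_arc_borel[OF t]
    by (intro emeasure_mono nonisotropic_ball_subset_carleson_square a t) auto
  also have "\<dots> \<le> C"
    using le emeasure_mu_measure[OF g carleson_square_closed_arc_borel[OF t] sub] by simp
  finally show ?thesis .
qed

lemma LCM_imp_log_carleson:
  assumes g: "g holomorphic_on unit_disc" and fin: "LCM_norm p (mu_measure p g) < \<infinity>"
  obtains A where "0 \<le> A" "log_carleson p (plane_measure p g) A"
proof -
  obtain A where A: "0 \<le> A" "\<And>I. I \<in> subarcs \<Longrightarrow> emeasure (mu_measure p g) (carleson_square I) \<le> ennreal (A * arc_gauge p (arc_length I))"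
    using fin unfolding LCM_norm_finite_iff by blast
  have "log_carleson p (plane_measure p g) A"
    unfolding log_carleson_gauge
  proof (intro ballI allI impI)
    fix a t assume a: "a \<in> unit_disc" and t: "0 < t" "t \<le> (1::real)"
    show "emeasure (plane_measure p g) {z \<in> unit_disc. cmod (1 - cnj a * z) \<le> t} \<le> ennreal (A * arc_gauge p t)"
      using A(2)[OF closed_arc_subarc[OF t, of "Arg a"]] unfolding arc_length_closed_arc[OF t]
      by (rule plane_measure_ball_le[OF g a t])
  qed
  with A(1) that show ?thesis by blast
qed

lemma V_op_bound:
  assumes p: "0 < p" and g: "g holomorphic_on unit_disc"
    and lc: "log_carleson p (plane_measure p g) A" and A: "0 \<le> A" and f: "f \<in> Qp p"
  shows "V_op g f \<in> Qp p" "Qp_norm p (V_op g f) \<le> sqrt (embed_const p * A) * Qp_norm p f"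
    and "\<And>w. w \<in> unit_disc \<Longrightarrow> Qp_energy p (V_op g f) w \<le> ennreal ((sqrt (embed_const p * A) * Qp_norm p f)\<^sup>2)"
proof -
  note fh = Qp_holomorphic[OF f]
  have c: "0 \<le> embed_const p * A" using embed_const_nonneg[OF p] A by simp
  show E: "Qp_energy p (V_op g f) w \<le> ennreal ((sqrt (embed_const p * A) * Qp_norm p f)\<^sup>2)" if w: "w \<in> unit_disc" for w
    unfolding Qp_energy_V_op[OF g fh w] power_mult_distrib real_sqrt_pow2[OF c]
    by (rule log_carleson_embedding[OF p sets_plane_measure lc A fh norm_0_le_Qp_norm[OF f] Qp_energy_le_norm[OF f] w])
  have s0: "0 \<le> sqrt (embed_const p * A) * Qp_norm p f" using c Qp_norm_nonneg by simp
  show "V_op g f \<in> Qp p" by (rule QpI[OF V_op_props(1)[OF g fh] V_op_props(4)[OF g fh] s0 E])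
  show "Qp_norm p (V_op g f) \<le> sqrt (embed_const p * A) * Qp_norm p f"
    using Qp_norm_le[OF s0 E, of 0] V_op_props(3)[OF g fh] by simp
qed

text \<open>
  For \<open>w\<close> on the inner edge of the Carleson square over \<open>I\<close>, the test function is on this square at least a
  multiple of \<open>ln (2 / \<bar>I\<bar>)\<close> and the Poisson-type kernel at least \<open>1 / (100 * \<bar>I\<bar>)\<close>; hence the energy
  at \<open>w\<close> bounds the measure of the square.
\<close>

lemma V_op_lower:
  assumes p: "0 < p" and g: "g holomorphic_on unit_disc" and I: "I \<in> subarcs"
  obtains w where "w \<in> unit_disc" "cmod w = 1 - arc_length I"
    "\<And>N. Qp_energy p (V_op g (test_fn w)) w \<le> ennreal (N\<^sup>2) \<Longrightarrow>
       emeasure (mu_measure p g) (carleson_square I) \<le> ennreal (16 * 100 powr p * N\<^sup>2 * arc_gauge p (arc_length I))"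
proof -
  define l where "l = arc_length I"
  have l: "0 < l" "l \<le> 1" using I arc_length_le_1[of I] by (auto simp: subarcs_def l_def)
  obtain w where w: "w \<in> unit_disc" "cmod w = 1 - l"
    and near: "\<And>z. z \<in> carleson_square I \<Longrightarrow> cmod (1 - cnj w * z) \<le> 10 * l"
    using subarc_near_test_point[OF I] unfolding l_def by blast
  define S where "S = {z \<in> unit_disc. cmod (1 - cnj w * z) \<le> 10 * l}"
  have S: "S \<in> sets borel" "S \<subseteq> unit_disc" unfolding S_def by auto
  have IS: "carleson_square I \<subseteq> S" using near by (auto simp: S_def carleson_square_def)
  define c where "c = (ln (2 / l))\<^sup>2 / 16 * (1 / (100 * l)) powr p"
  have ln0: "0 < ln (2 / l)" using l by (intro ln_gt_zero) (simp add: field_simps)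
  have c0: "0 < c" using ln0 l by (simp add: c_def)
  have pt: "c \<le> (cmod (test_fn w z))\<^sup>2 * poisson_kernel w z powr p" if z: "z \<in> S" for z
    unfolding c_def
  proof (intro mult_mono)
    have zd: "z \<in> unit_disc" and nz: "cmod (1 - cnj w * z) \<le> 10 * l" using z by (auto simp: S_def)
    have "(ln (2 / l) / 4)\<^sup>2 \<le> (cmod (test_fn w z))\<^sup>2"
      using norm_test_fn_ge[OF w(1) zd l nz w(2)] ln0 by (intro power_mono) auto
    then show "(ln (2 / l))\<^sup>2 / 16 \<le> (cmod (test_fn w z))\<^sup>2" by (simp add: power_divide)
    have "l \<le> 1 - (cmod w)\<^sup>2" unfolding w(2) using l by (simp add: power2_eq_square algebra_simps mult_left_le)
    moreover have "(cmod (1 - cnj w * z))\<^sup>2 \<le> (10 * l)\<^sup>2" using nz by (intro power_mono) auto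
    ultimately have "l / (10 * l)\<^sup>2 \<le> poisson_kernel w z"
      unfolding poisson_kernel_def using l disc_aut_denominator[OF w(1) zd] by (intro frac_le) auto
    moreover have "l / (10 * l)\<^sup>2 = 1 / (100 * l)" using l by (simp add: power2_eq_square)
    ultimately show "(1 / (100 * l)) powr p \<le> poisson_kernel w z powr p"
      using l p by (intro powr_mono2) auto
  qed (use l in auto)
  show ?thesis
  proof (rule that[OF w(1)])
    show "cmod w = 1 - arc_length I" using w(2) by (simp add: l_def)
    fix N assume E: "Qp_energy p (V_op g (test_fn w)) w \<le> ennreal (N\<^sup>2)"
    have "ennreal c * emeasure (plane_measure p g) S = (\<integral>\<^sup>+z. ennreal c * indicator S z \<partial>plane_measure p g)"
      using S by (simp add: nn_integral_cmult_indicator)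
    also have "\<dots> \<le> (\<integral>\<^sup>+z\<in>unit_disc. ennreal ((cmod (test_fn w z))\<^sup>2 * poisson_kernel w z powr p) \<partial>plane_measure p g)"
      using pt S by (intro nn_integral_mono) (auto split: split_indicator intro!: ennreal_leI)
    also have "\<dots> \<le> ennreal (N\<^sup>2)"
      using E unfolding Qp_energy_V_op[OF g test_fn_holomorphic[OF w(1)] w(1)] .
    finally have "ennreal c * emeasure (plane_measure p g) S \<le> ennreal (N\<^sup>2)" .
    then have "ennreal (1 / c) * (ennreal c * emeasure (plane_measure p g) S) \<le> ennreal (1 / c) * ennreal (N\<^sup>2)"
      by (intro mult_left_mono) auto
    then have "emeasure (plane_measure p g) S \<le> ennreal (1 / c * N\<^sup>2)"
      using c0 by (simp add: mult.assoc[symmetric] flip: ennreal_mult)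
    also have "1 / c * N\<^sup>2 = 16 * 100 powr p * N\<^sup>2 * arc_gauge p l"
      using ln0 l by (simp add: c_def arc_gauge_def powr_divide powr_mult)
    finally show "emeasure (mu_measure p g) (carleson_square I) \<le> ennreal (16 * 100 powr p * N\<^sup>2 * arc_gauge p (arc_length I))"
      unfolding l_def using emeasure_mu_measure_le[OF g S IS, of p] by simp
  qed
qed

text \<open>
  Test the Bloch estimate at \<open>w\<close> itself: the factors \<open>1 - \<bar>w\<bar>\<^sup>2\<close> cancel.
\<close>

lemma U_op_lower:
  assumes p: "0 < p" and g: "g holomorphic_on unit_disc" and w: "w \<in> unit_disc"
    and T: "U_op g (test_fn w) \<in> Qp p"
  shows "2 * cmod w * cmod (g w) \<le> bloch_const p * Qp_norm p (U_op g (test_fn w))"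
proof -
  have "(1 - (cmod w)\<^sup>2) * cmod (deriv (U_op g (test_fn w)) w) \<le> bloch_const p * Qp_norm p (U_op g (test_fn w))"
    by (rule bloch_estimate[OF p Qp_holomorphic[OF T] w Qp_energy_le_norm[OF T w] Qp_norm_nonneg])
  moreover have "(1 - (cmod w)\<^sup>2) * cmod (deriv (U_op g (test_fn w)) w) = 2 * cmod w * cmod (g w)"
    using norm_sq_disc(1)[OF w]
    by (simp add: U_op_props(2)[OF g test_fn_holomorphic[OF w] w] norm_mult deriv_test_fn_self[OF w])
  ultimately show ?thesis by simp
qed

text \<open>
  The image has value \<open>log_size w * g w\<close> at \<open>w\<close>, while the growth estimate allows only a multiple of
  the same logarithm.
\<close>

lemma M_op_lower:
  assumes p: "0 < p" and g: "g holomorphic_on unit_disc" and w: "w \<in> unit_disc"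
    and T: "M_op g (test_fn w) \<in> Qp p"
  shows "cmod (g w) \<le> (1 + bloch_const p) * Qp_norm p (M_op g (test_fn w))"
proof -
  define N where "N = Qp_norm p (M_op g (test_fn w))"
  have N: "0 \<le> N" by (simp add: N_def Qp_norm_nonneg)
  have w1: "0 < 1 - cmod w" using w by simp
  have "cmod (M_op g (test_fn w) w - M_op g (test_fn w) 0) \<le> bloch_const p * N * ln (1 / (1 - cmod w))"
    unfolding N_def
    by (rule growth_estimate[OF p Qp_holomorphic[OF T] w Qp_energy_le_norm[OF T] Qp_norm_nonneg])
  moreover have "cmod (M_op g (test_fn w) 0) \<le> N" unfolding N_def by (rule norm_0_le_Qp_norm[OF T])
  moreover have "cmod (M_op g (test_fn w) w) \<le> cmod (M_op g (test_fn w) w - M_op g (test_fn w) 0) + cmod (M_op g (test_fn w) 0)"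
    using norm_triangle_sub[of "M_op g (test_fn w) w" "M_op g (test_fn w) 0"] by simp
  moreover have "cmod (M_op g (test_fn w) w) = log_size w * cmod (g w)"
    using w log_size_pos[OF w] by (simp add: M_op_def test_fn_self norm_mult)
  ultimately have 1: "log_size w * cmod (g w) \<le> bloch_const p * N * ln (1 / (1 - cmod w)) + N" by linarith
  have "ln (1 / (1 - cmod w)) \<le> log_size w"
    unfolding log_size_def
  proof (subst ln_le_cancel_iff)
    have "1 - (cmod w)\<^sup>2 = (1 - cmod w) * (1 + cmod w)" by (simp add: power2_eq_square algebra_simps)
    also have "\<dots> \<le> (1 - cmod w) * 100" using w1 by (intro mult_left_mono) auto
    finally show "1 / (1 - cmod w) \<le> 100 / (1 - (cmod w)\<^sup>2)" using w1 norm_sq_disc(1)[OF w] by (simp add: divide_simps)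
  qed (use w1 norm_sq_disc(1)[OF w] in auto)
  then have "bloch_const p * N * ln (1 / (1 - cmod w)) \<le> bloch_const p * N * log_size w"
    using bloch_const_pos[OF p] N by (intro mult_left_mono) auto
  moreover have "N \<le> N * log_size w" using log_size_ge[OF w] ln_100_ge mult_left_mono[of 1 "log_size w" N] N by simp
  ultimately have "log_size w * cmod (g w) \<le> log_size w * ((1 + bloch_const p) * N)"
    using 1 by (simp add: algebra_simps)
  then show ?thesis using log_size_pos[OF w] unfolding N_def by simp
qed

section \<open>Compactness in terms of sequences\<close>

lemma Qp_diff:
  assumes "f \<in> Qp p" "h \<in> Qp p" shows "(\<lambda>z. f z - h z) \<in> Qp p"
proof -
  have "Qp_enorm p (\<lambda>z. f z - h z) \<le> Qp_enorm p f + Qp_enorm p h"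
    using assms by (intro Qp_enorm_diff_le) (auto simp: Qp_def)
  also have "\<dots> < \<infinity>" using assms by (simp add: Qp_def)
  finally show ?thesis using assms by (auto simp: Qp_def intro!: holomorphic_intros)
qed

lemma Qp_pointwise_bound:
  assumes p: "0 < p" and f: "f \<in> Qp p" and z: "z \<in> unit_disc"
  shows "cmod (f z) \<le> (1 + bloch_const p * ln (1 / (1 - cmod z))) * Qp_norm p f"
proof -
  have "cmod (f z - f 0) \<le> bloch_const p * Qp_norm p f * ln (1 / (1 - cmod z))"
    by (rule growth_estimate[OF p Qp_holomorphic[OF f] z Qp_energy_le_norm[OF f] Qp_norm_nonneg])
  then show ?thesis
    using norm_triangle_sub[of "f z" "f 0"] norm_0_le_Qp_norm[OF f] by (simp add: algebra_simps)
qed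

lemma zero_in_Qp: "(\<lambda>_. 0) \<in> Qp p"
  by (rule QpI[where A = 0]) (auto simp: Qp_energy_def)

lemma Qp_norm_zero: "Qp_norm p (\<lambda>_. 0) = 0"
  using Qp_norm_le[of 0 p "\<lambda>_. 0" 0] Qp_norm_nonneg[of p "\<lambda>_. 0"] by (simp add: Qp_energy_def)

text \<open>
  Norm convergence implies pointwise convergence, so the only possible limit is \<open>0\<close>.
\<close>

lemma compact_on_Qp_null_sequence:
  assumes p: "0 < p" and T: "compact_on_Qp p T"
    and f: "\<And>n. f n \<in> Qp p" "\<And>n. Qp_norm p (f n) \<le> r"
    and null: "\<And>z. z \<in> unit_disc \<Longrightarrow> (\<lambda>n. T (f n) z) \<longlonglongrightarrow> 0"
  obtains s :: "nat \<Rightarrow> nat" where "strict_mono s" "(\<lambda>n. Qp_norm p (T (f (s n)))) \<longlonglongrightarrow> 0"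
proof -
  interpret Metric_space "Qp p" "Qp_dist p" by (rule Metric_space_Qp)
  have TQ: "T h \<in> Qp p" if "h \<in> Qp p" for h using T that by (auto simp: compact_on_Qp_def)
  define B where "B = range f"
  have "compactin mtopology (mtopology closure_of (T ` B))"
  proof -
    have "B \<subseteq> Qp p" "\<exists>r. \<forall>h\<in>B. Qp_norm p h \<le> r" using f by (auto simp: B_def)
    then show ?thesis using T unfolding compact_on_Qp_def by simp
  qed
  moreover have sub: "T ` B \<subseteq> mtopology closure_of (T ` B)"
    using TQ f by (intro closure_of_subset) (auto simp: B_def)
  moreover have "range (\<lambda>n. T (f n)) \<subseteq> mtopology closure_of (T ` B)"
    using sub by (auto simp: B_def)
  ultimately obtain F s where F: "strict_mono s" "limitin mtopology ((\<lambda>n. T (f n)) \<circ> s) F sequentially"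
    unfolding compactin_sequentially by blast
  then have FQ: "F \<in> Qp p" and d: "(\<lambda>n. Qp_dist p (T (f (s n))) F) \<longlonglongrightarrow> 0"
    by (simp_all add: limitin_metric_dist_null o_def)
  have "F z = 0" for z
  proof (cases "z \<in> unit_disc")
    case True
    have "(\<lambda>n. T (f (s n)) z - F z) \<longlonglongrightarrow> 0"
    proof (rule Lim_null_comparison)
      show "\<forall>\<^sub>F n in sequentially. norm (T (f (s n)) z - F z) \<le> (1 + bloch_const p * ln (1 / (1 - cmod z))) * Qp_dist p (T (f (s n))) F"
        using Qp_pointwise_bound[OF p Qp_diff[OF TQ[OF f(1)] FQ] True] by (simp add: Qp_dist_def)
      show "(\<lambda>n. (1 + bloch_const p * ln (1 / (1 - cmod z))) * Qp_dist p (T (f (s n))) F) \<longlonglongrightarrow> 0"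
        using tendsto_mult_left[OF d] by simp
    qed
    moreover have "(\<lambda>n. T (f (s n)) z - F z) \<longlonglongrightarrow> 0 - F z"
      using LIMSEQ_subseq_LIMSEQ[OF null[OF True] F(1)] by (intro tendsto_intros) (simp add: o_def)
    ultimately show ?thesis using LIMSEQ_unique by fastforce
  qed (use Qp_outside[OF FQ] in auto)
  then have "(\<lambda>n. Qp_norm p (T (f (s n)))) \<longlonglongrightarrow> 0"
    using d by (simp add: Qp_dist_def)
  with F(1) that show ?thesis by blast
qed

text \<open>
  By the Bolzano--Weierstrass criterion it suffices that every infinite subset of the image has a
  limit point in the space. A sequence of distinct elements guarantees that the limit is
  approached by points different from it.
\<close>

lemma compact_on_Qp_I:
  assumes T: "T \<in> Qp p \<rightarrow> Qp p"
    and seq: "\<And>f r. \<lbrakk>\<And>n. f n \<in> Qp p; \<And>n. Qp_norm p (f n) \<le> r\<rbrakk> \<Longrightarrow>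
      \<exists>s F. strict_mono (s :: nat \<Rightarrow> nat) \<and> F \<in> Qp p \<and> (\<lambda>n. Qp_norm p (\<lambda>z. T (f (s n)) z - F z)) \<longlonglongrightarrow> 0"
  shows "compact_on_Qp p T"
proof -
  interpret Metric_space "Qp p" "Qp_dist p" by (rule Metric_space_Qp)
  show ?thesis
    unfolding compact_on_Qp_def
  proof (intro conjI T allI impI)
    fix B assume B: "B \<subseteq> Qp p" and "\<exists>r. \<forall>f\<in>B. Qp_norm p f \<le> r"
    then obtain r where r: "\<And>f. f \<in> B \<Longrightarrow> Qp_norm p f \<le> r" by blast
    show "compactin mtopology (mtopology closure_of (T ` B))"
      unfolding compact_closure_of_eq_Bolzano_Weierstrass
    proof (intro allI impI)
      fix X assume X: "infinite X \<and> X \<subseteq> T ` B \<and> X \<subseteq> Qp p"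
      then obtain y :: "nat \<Rightarrow> complex \<Rightarrow> complex" where y: "inj y" "range y \<subseteq> X"
        using infinite_countable_subset by blast
      have "\<forall>n. \<exists>f\<in>B. y n = T f" using y X by blast
      then obtain f where f: "\<And>n. f n \<in> B" "\<And>n. y n = T (f n)" by metis
      obtain s F where s: "strict_mono s" and F: "F \<in> Qp p"
        and lim: "(\<lambda>n. Qp_norm p (\<lambda>z. T (f (s n)) z - F z)) \<longlonglongrightarrow> 0"
        using seq[of f r] f B r by blast
      have "F \<in> mtopology derived_set_of X"
        unfolding metric_derived_set_of
      proof (intro CollectI conjI F allI impI)
        fix e :: real assume "0 < e"
        then have "\<forall>\<^sub>F n in sequentially. Qp_norm p (\<lambda>z. T (f (s n)) z - F z) < e"
          by (intro order_tendstoD[OF lim])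
        then obtain N where N: "\<And>n. N \<le> n \<Longrightarrow> Qp_norm p (\<lambda>z. T (f (s n)) z - F z) < e"
          by (auto simp: eventually_sequentially)
        have "y (s N) \<noteq> y (s (Suc N))"
          using y(1) strict_mono_eq[OF s] by (auto dest: injD)
        then obtain n where n: "N \<le> n" "y (s n) \<noteq> F" by (metis le_SucI order_refl)
        have "Qp_dist p F (y (s n)) < e"
          using N[OF n(1)] by (subst commute) (simp add: Qp_dist_def f(2))
        then have "y (s n) \<in> mball F e" using F y X by (auto simp: in_mball)
        then show "\<exists>y\<in>X. y \<noteq> F \<and> y \<in> mball F e" using n y by blast
      qed
      then show "mtopology derived_set_of X \<noteq> {}" by blast
    qed
  qed
qed

lemma test_fn_sequence_ops_null:
  assumes g: "g holomorphic_on unit_disc" and w: "\<And>n. w n \<in> unit_disc" and lim: "(\<lambda>n. cmod (w n)) \<longlonglongrightarrow> 1"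
    and z: "z \<in> unit_disc"
  shows "(\<lambda>n. V_op g (test_fn (w n)) z) \<longlonglongrightarrow> 0" "(\<lambda>n. U_op g (test_fn (w n)) z) \<longlonglongrightarrow> 0"
    "(\<lambda>n. M_op g (test_fn (w n)) z) \<longlonglongrightarrow> 0"
proof -
  define r where "r = cmod z"
  have r: "0 \<le> r" "r < 1" using z by (auto simp: r_def)
  have cb: "u \<in> unit_disc" if "u \<in> cball 0 r" for u using that r by auto
  have seg: "u \<in> cball 0 r" if "u \<in> closed_segment 0 z" for u
    using that segment_bound1[of u 0 z] by (simp add: r_def)
  have inv: "(\<lambda>n. c / log_size (w n)) \<longlonglongrightarrow> 0" for c
    by (rule tendsto_divide_0[OF tendsto_const filterlim_at_top_imp_at_infinity[OF log_size_filterlim[OF w lim]]])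
  have bdd: "\<exists>b. \<forall>u\<in>cball 0 r. cmod (h u) \<le> b" if h: "h holomorphic_on unit_disc" for h
  proof -
    have "compact (h ` cball 0 r)"
      using cb by (intro compact_continuous_image holomorphic_on_imp_continuous_on
        holomorphic_on_subset[OF h]) auto
    then show ?thesis by (meson bounded_iff compact_imp_bounded imageI)
  qed
  obtain b where b: "\<And>u. u \<in> cball 0 r \<Longrightarrow> cmod (g u) \<le> b" using bdd[OF g] by blast
  obtain b' where b': "\<And>u. u \<in> cball 0 r \<Longrightarrow> cmod (deriv g u) \<le> b'"
    using bdd[OF holomorphic_deriv[OF g open_ball]] by blast
  have bn: "0 \<le> b" "0 \<le> b'" using b[of 0] b'[of 0] r order.trans[OF norm_ge_zero] by auto
  define c1 where "c1 = (ln (100 / (1 - r)) + 2)\<^sup>2"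
  define c2 where "c2 = 2 * (ln (100 / (1 - r)) + 2) / (1 - r)"
  have t1: "cmod (test_fn (w n) u) \<le> c1 / log_size (w n)" and t2: "cmod (deriv (test_fn (w n)) u) \<le> c2 / log_size (w n)"
    if "u \<in> cball 0 r" for n u
    using norm_test_fn_le[OF w _ r(2), of u n] that by (auto simp: c1_def c2_def)
  have pos: "0 \<le> c1 / log_size (w n)" "0 \<le> c2 / log_size (w n)" for n
    using t1[of 0 n] t2[of 0 n] r order.trans[OF norm_ge_zero] by auto
  show "(\<lambda>n. M_op g (test_fn (w n)) z) \<longlonglongrightarrow> 0"
  proof (rule Lim_null_comparison[OF always_eventually inv[of "c1 * b"]], rule allI)
    fix n
    have "cmod (test_fn (w n) z) * cmod (g z) \<le> c1 / log_size (w n) * b"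
      using pos by (intro mult_mono t1 b) (auto simp: r_def)
    then show "norm (M_op g (test_fn (w n)) z) \<le> c1 * b / log_size (w n)"
      using z by (simp add: M_op_def norm_mult)
  qed
  have th: "test_fn (w n) holomorphic_on unit_disc" for n by (rule test_fn_holomorphic[OF w])
  have cint: "h contour_integrable_on linepath 0 z" if "h holomorphic_on unit_disc" for h
    using seg cb by (intro contour_integrable_continuous_linepath holomorphic_on_imp_continuous_on
        holomorphic_on_subset[OF that]) auto
  show "(\<lambda>n. V_op g (test_fn (w n)) z) \<longlonglongrightarrow> 0"
  proof (rule Lim_null_comparison[OF always_eventually inv[of "b' * c1 * cmod z"]], rule allI)
    fix n
    have "cmod (contour_integral (linepath 0 z) (\<lambda>u. deriv g u * test_fn (w n) u)) \<le>
        b' * (c1 / log_size (w n)) * cmod (z - 0)"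
    proof (rule contour_integral_bound_linepath)
      show "(\<lambda>u. deriv g u * test_fn (w n) u) contour_integrable_on linepath 0 z"
        by (intro cint holomorphic_intros g th) auto
      show "0 \<le> b' * (c1 / log_size (w n))" by (intro mult_nonneg_nonneg bn pos)
      show "cmod (deriv g u * test_fn (w n) u) \<le> b' * (c1 / log_size (w n))" if "u \<in> closed_segment 0 z" for u
        unfolding norm_mult using seg[OF that] bn by (intro mult_mono b' t1) auto
    qed
    then show "norm (V_op g (test_fn (w n)) z) \<le> b' * c1 * cmod z / log_size (w n)"
      using z by (simp add: V_op_def)
  qed
  show "(\<lambda>n. U_op g (test_fn (w n)) z) \<longlonglongrightarrow> 0"
  proof (rule Lim_null_comparison[OF always_eventually inv[of "b * c2 * cmod z"]], rule allI)
    fix n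
    have "cmod (contour_integral (linepath 0 z) (\<lambda>u. g u * deriv (test_fn (w n)) u)) \<le>
        b * (c2 / log_size (w n)) * cmod (z - 0)"
    proof (rule contour_integral_bound_linepath)
      show "(\<lambda>u. g u * deriv (test_fn (w n)) u) contour_integrable_on linepath 0 z"
        by (intro cint holomorphic_intros g th) auto
      show "0 \<le> b * (c2 / log_size (w n))" by (intro mult_nonneg_nonneg bn pos)
      show "cmod (g u * deriv (test_fn (w n)) u) \<le> b * (c2 / log_size (w n))" if "u \<in> closed_segment 0 z" for u
        unfolding norm_mult using seg[OF that] bn by (intro mult_mono b t2) auto
    qed
    then show "norm (U_op g (test_fn (w n)) z) \<le> b * c2 * cmod z / log_size (w n)"
      using z by (simp add: U_op_def)
  qed
qed

text \<open>
  Otherwise some sequence of test functions moving to the boundary has images of norm at least \<open>e\<close>,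
  which contradicts the existence of a null subsequence.
\<close>

lemma compact_test_fn_null:
  assumes p: "0 < p" and T: "compact_on_Qp p T"
    and null: "\<And>w z. \<lbrakk>\<And>n. w n \<in> unit_disc; (\<lambda>n. cmod (w n)) \<longlonglongrightarrow> 1; z \<in> unit_disc\<rbrakk> \<Longrightarrow> (\<lambda>n. T (test_fn (w n)) z) \<longlonglongrightarrow> 0"
    and e: "0 < e"
  obtains \<rho> where "0 \<le> \<rho>" "\<rho> < 1" "\<And>w. \<lbrakk>w \<in> unit_disc; \<rho> \<le> cmod w\<rbrakk> \<Longrightarrow> Qp_norm p (T (test_fn w)) < e"
proof (rule ccontr)
  assume contra: "\<not> thesis"
  have "\<exists>w. w \<in> unit_disc \<and> 1 - 1 / real (Suc n) \<le> cmod w \<and> e \<le> Qp_norm p (T (test_fn w))" for n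
  proof (rule ccontr)
    assume *: "\<not> ?thesis"
    have "0 \<le> 1 - 1 / real (Suc n)" "1 - 1 / real (Suc n) < 1" by (auto simp: field_simps)
    from that[OF this] * contra show False by (meson not_le)
  qed
  then obtain w where w: "\<And>n. w n \<in> unit_disc" "\<And>n. 1 - 1 / real (Suc n) \<le> cmod (w n)"
    "\<And>n. e \<le> Qp_norm p (T (test_fn (w n)))" by metis
  have lim: "(\<lambda>n. cmod (w n)) \<longlonglongrightarrow> 1"
  proof (rule tendsto_sandwich[of "\<lambda>n. 1 - 1 / real (Suc n)" _ _ "\<lambda>_. 1"])
    show "(\<lambda>n. 1 - 1 / real (Suc n)) \<longlonglongrightarrow> 1"
      using tendsto_diff[OF tendsto_const[of "1::real"] LIMSEQ_inverse_real_of_nat] by (simp add: inverse_eq_divide)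
  qed (use w in \<open>auto intro!: always_eventually less_imp_le\<close>)
  obtain s where "strict_mono s" "(\<lambda>n. Qp_norm p (T (test_fn (w (s n))))) \<longlonglongrightarrow> 0"
    using compact_on_Qp_null_sequence[OF p T, of "\<lambda>n. test_fn (w n)" "test_const p"]
      test_fn_Qp[OF p w(1)] null[OF w(1) lim] by blast
  then have "e \<le> 0" by (intro LIMSEQ_le_const[of "\<lambda>n. Qp_norm p (T (test_fn (w (s n))))"]) (use w(3) in auto)
  with e show False by simp
qed

text \<open>
  Maximum modulus principle on circles close to the unit circle.
\<close>

lemma holomorphic_zero_if_null_at_boundary:
  assumes g: "g holomorphic_on unit_disc"
    and null: "\<And>e. 0 < e \<Longrightarrow> \<exists>\<rho><1. \<forall>w\<in>unit_disc. \<rho> \<le> cmod w \<longrightarrow> cmod (g w) \<le> e"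
    and z: "z \<in> unit_disc"
  shows "g z = 0"
proof -
  have "cmod (g z) \<le> e" if e: "0 < e" for e
  proof -
    obtain \<rho> where \<rho>: "\<rho> < 1" "\<And>w. w \<in> unit_disc \<Longrightarrow> \<rho> \<le> cmod w \<Longrightarrow> cmod (g w) \<le> e"
      using null[OF e] by blast
    obtain t where t: "max \<rho> (cmod z) < t" "t < 1" using \<rho>(1) z dense[of "max \<rho> (cmod z)" 1] by auto
    have t0: "0 < t" using t norm_ge_zero[of z] by linarith
    show ?thesis
    proof (rule maximum_modulus_frontier[of g "ball 0 t"])
      show "g holomorphic_on interior (ball 0 t)" using t by (auto intro: holomorphic_on_subset[OF g])
      show "continuous_on (closure (ball 0 t)) g"
        using t t0 by (intro holomorphic_on_imp_continuous_on holomorphic_on_subset[OF g]) auto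
      show "cmod (g u) \<le> e" if "u \<in> frontier (ball 0 t)" for u
        using that t t0 by (intro \<rho>(2)) auto
    qed (use t in auto)
  qed
  from this[of "cmod (g z) / 2"] show ?thesis by (cases "g z = 0") auto
qed

section \<open>The vanishing Carleson condition\<close>

text \<open>
  For arcs of positive length the weight of the limit is a positive real number, the reciprocal of the
  gauge, so it can be moved to the other side of an inequality even if the measure is infinite.
\<close>

lemma small_arcs_tendsto_iff:
  "((\<lambda>I. ennreal (arc_length I powr (-p) * (ln (2 / arc_length I))\<^sup>2) * emeasure \<mu> (carleson_square I)) \<longlongrightarrow> 0) small_arcs \<longleftrightarrow>
   (\<forall>e>0. \<exists>\<delta>>0. \<forall>I\<in>subarcs. arc_length I < \<delta> \<longrightarrow>
      emeasure \<mu> (carleson_square I) \<le> ennreal (e * arc_gauge p (arc_length I)))" (is "(?F \<longlongrightarrow> 0) _ \<longleftrightarrow> ?R")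
proof -
  have len: "0 < arc_length I" "arc_length I \<le> 1" if "I \<in> subarcs" for I
    using that arc_length_le_1 by (auto simp: subarcs_def)
  have ev: "eventually P small_arcs \<longleftrightarrow> (\<exists>\<delta>>0. \<forall>I\<in>subarcs. arc_length I < \<delta> \<longrightarrow> P I)" for P
  proof
    assume "eventually P small_arcs"
    then have "eventually (\<lambda>I. I \<in> subarcs \<longrightarrow> P I) (filtercomap arc_length (at_right 0))"
      by (simp add: small_arcs_def eventually_inf_principal)
    then obtain Q where Q: "eventually Q (at_right 0)" "\<And>I. Q (arc_length I) \<Longrightarrow> I \<in> subarcs \<longrightarrow> P I"
      by (auto simp: eventually_filtercomap)
    then obtain \<delta> where "0 < \<delta>" "\<And>x. 0 < x \<Longrightarrow> x < \<delta> \<Longrightarrow> Q x"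
      by (auto simp: eventually_at_right_field)
    then show "\<exists>\<delta>>0. \<forall>I\<in>subarcs. arc_length I < \<delta> \<longrightarrow> P I" using Q(2) len by blast
  next
    assume "\<exists>\<delta>>0. \<forall>I\<in>subarcs. arc_length I < \<delta> \<longrightarrow> P I"
    then obtain \<delta> where d: "0 < \<delta>" "\<And>I. I \<in> subarcs \<Longrightarrow> arc_length I < \<delta> \<Longrightarrow> P I" by blast
    have "eventually (\<lambda>x. x < \<delta>) (at_right 0)" using d(1) by (auto simp: eventually_at_right_field)
    then have "eventually (\<lambda>I. arc_length I < \<delta>) (filtercomap arc_length (at_right 0))"
      by (rule eventually_filtercomapI)
    then show "eventually P small_arcs"
      unfolding small_arcs_def eventually_inf_principal by eventually_elim (use d(2) in blast)
  qed
  have weight: "?F I \<le> ennreal e \<longleftrightarrow> emeasure \<mu> (carleson_square I) \<le> ennreal (e * arc_gauge p (arc_length I))"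
    if I: "I \<in> subarcs" and e: "0 < e" for I e
  proof -
    define d where "d = arc_gauge p (arc_length I)"
    have d: "0 < d" unfolding d_def by (rule arc_gauge_pos[OF len[OF I]])
    have F: "?F I = ennreal (1 / d) * emeasure \<mu> (carleson_square I)"
      by (simp add: d_def arc_gauge_def powr_minus_divide)
    show ?thesis unfolding F d_def[symmetric] using d e
      by (cases "emeasure \<mu> (carleson_square I)")
         (auto simp: ennreal_mult[symmetric] field_simps ennreal_mult_top top_unique)
  qed
  show ?thesis
  proof
    assume lim: "(?F \<longlongrightarrow> 0) small_arcs"
    show ?R
    proof (intro allI impI)
      fix e :: real assume e: "0 < e"
      have "eventually (\<lambda>I. ?F I < ennreal e) small_arcs" using e by (intro order_tendstoD(2)[OF lim]) simp
      then obtain \<delta> where "0 < \<delta>" "\<And>I. I \<in> subarcs \<Longrightarrow> arc_length I < \<delta> \<Longrightarrow> ?F I < ennreal e"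
        unfolding ev by blast
      then show "\<exists>\<delta>>0. \<forall>I\<in>subarcs. arc_length I < \<delta> \<longrightarrow> emeasure \<mu> (carleson_square I) \<le> ennreal (e * arc_gauge p (arc_length I))"
        using weight[OF _ e] less_imp_le by blast
    qed
  next
    assume R: ?R
    show "(?F \<longlongrightarrow> 0) small_arcs"
    proof (rule order_tendstoI)
      fix a :: ennreal assume "0 < a"
      obtain e where e: "0 < e" "ennreal e < a"
      proof (cases a)
        case (real r)
        then show ?thesis using \<open>0 < a\<close> that[of "r / 2"] by (auto simp: ennreal_less_iff)
      qed (use that[of 1] in auto)
      obtain \<delta> where "0 < \<delta>" "\<And>I. I \<in> subarcs \<Longrightarrow> arc_length I < \<delta> \<Longrightarrow> emeasure \<mu> (carleson_square I) \<le> ennreal (e * arc_gauge p (arc_length I))"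
        using R e(1) by blast
      then show "eventually (\<lambda>I. ?F I < a) small_arcs"
        unfolding ev using weight[OF _ e(1)] e(2) order.strict_trans1 by blast
    qed simp
  qed
qed

text \<open>
  The gauge increases with the radius, so balls of radius at least \<open>\<delta>\<close> are controlled by the total
  mass.
\<close>

lemma log_carleson_from_small_balls:
  assumes p: "0 < p" and M: "sets \<nu> = sets borel" and \<delta>: "0 < \<delta>" "\<delta> \<le> 1"
    and small: "\<And>a t. \<lbrakk>a \<in> unit_disc; 0 < t; t < \<delta>\<rbrakk> \<Longrightarrow>
      emeasure \<nu> {z \<in> unit_disc. cmod (1 - cnj a * z) \<le> t} \<le> ennreal (A * arc_gauge p t)"
    and total: "emeasure \<nu> unit_disc \<le> ennreal (A * arc_gauge p \<delta>)" and A: "0 \<le> A"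
  shows "log_carleson p \<nu> A"
  unfolding log_carleson_gauge
proof (intro ballI allI impI)
  fix a t assume a: "a \<in> unit_disc" and t: "0 < t" "t \<le> (1::real)"
  show "emeasure \<nu> {z \<in> unit_disc. cmod (1 - cnj a * z) \<le> t} \<le> ennreal (A * arc_gauge p t)"
  proof (cases "t < \<delta>")
    case False
    have "emeasure \<nu> {z \<in> unit_disc. cmod (1 - cnj a * z) \<le> t} \<le> emeasure \<nu> unit_disc"
      by (rule emeasure_mono) (auto simp: M)
    also have "\<dots> \<le> ennreal (A * arc_gauge p t)"
      using False t by (intro order.trans[OF total] ennreal_leI mult_left_mono arc_gauge_mono p \<delta> A) auto
    finally show ?thesis .
  qed (use small a t in blast)
qed

text \<open>
  Finitely many small Carleson squares cover an annulus at the boundary, and the density is bounded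
  on the remaining compact disc.
\<close>

lemma plane_measure_finite:
  assumes g: "g holomorphic_on unit_disc"
    and small: "\<exists>\<delta>>0. \<forall>I\<in>subarcs. arc_length I < \<delta> \<longrightarrow>
      emeasure (mu_measure p g) (carleson_square I) \<le> ennreal (arc_gauge p (arc_length I))" and p: "0 < p"
  shows "emeasure (plane_measure p g) unit_disc < \<infinity>"
proof -
  obtain \<delta> where \<delta>: "0 < \<delta>" "\<And>I. I \<in> subarcs \<Longrightarrow> arc_length I < \<delta> \<Longrightarrow>
      emeasure (mu_measure p g) (carleson_square I) \<le> ennreal (arc_gauge p (arc_length I))" using small by blast
  obtain n where n: "1 / real (Suc n) < \<delta>" using \<delta>(1) nat_approx_posE by blast
  define N where "N = Suc n"
  have l: "0 < 1 / real N" "1 / real N \<le> 1" by (auto simp: N_def)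
  define \<rho> where "\<rho> = 1 - 1 / real N"
  have \<rho>: "0 \<le> \<rho>" "\<rho> < 1" using l by (auto simp: \<rho>_def)
  define Q where "Q = (\<lambda>j::nat. carleson_square (closed_arc ((2 * real j + 1) * pi / real N) (1 / real N)))"
  have Qb: "Q j \<in> sets borel" "Q j \<subseteq> unit_disc" for j
    unfolding Q_def using carleson_square_closed_arc_borel[OF l] by (auto simp: carleson_square_def)
  have Qfin: "emeasure (plane_measure p g) (Q j) < \<infinity>" for j
  proof -
    have "arc_length (closed_arc ((2 * real j + 1) * pi / real N) (1 / real N)) < \<delta>"
      using n unfolding arc_length_closed_arc[OF l] by (simp only: N_def)
    from \<delta>(2)[OF closed_arc_subarc[OF l] this]
    have "emeasure (mu_measure p g) (Q j) \<le> ennreal (arc_gauge p (1 / real N))"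
      unfolding Q_def arc_length_closed_arc[OF l] .
    then have "emeasure (plane_measure p g) (Q j) \<le> ennreal (arc_gauge p (1 / real N))"
      unfolding emeasure_mu_measure[OF g Qb] .
    then show ?thesis using order.strict_trans1 ennreal_less_top by fastforce
  qed
  have inner: "emeasure (plane_measure p g) (cball 0 \<rho>) < \<infinity>"
  proof -
    have "compact (deriv g ` cball 0 \<rho>)"
      using \<rho> by (intro compact_continuous_image holomorphic_on_imp_continuous_on
        holomorphic_on_subset[OF holomorphic_deriv[OF g open_ball]]) auto
    then obtain b where b: "\<And>z. z \<in> cball 0 \<rho> \<Longrightarrow> cmod (deriv g z) \<le> b"
      by (metis bounded_iff compact_imp_bounded imageI)
    have b0: "0 \<le> b" using b[of 0] \<rho> order.trans[OF norm_ge_zero] by auto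
    have "emeasure (plane_measure p g) (cball 0 \<rho>) = (\<integral>\<^sup>+z\<in>cball 0 \<rho>. weight_density p g z \<partial>lborel)"
      unfolding plane_measure_def using weight_density_measurable[OF g] by (intro emeasure_density) auto
    also have "\<dots> \<le> (\<integral>\<^sup>+(z::complex). ennreal (b\<^sup>2) * indicator (cball 0 \<rho>) z \<partial>lborel)"
    proof (rule nn_integral_mono)
      fix z :: complex
      show "weight_density p g z * indicator (cball 0 \<rho>) z \<le> ennreal (b\<^sup>2) * indicator (cball 0 \<rho>) z"
      proof (cases "z \<in> cball 0 \<rho>")
        case True
        then have zd: "z \<in> unit_disc" using \<rho> by auto
        have "(1 - (cmod z)\<^sup>2) powr p \<le> 1" using norm_sq_disc(1)[OF zd] p by (intro powr_le1) auto
        then have "(1 - (cmod z)\<^sup>2) powr p * (cmod (deriv g z))\<^sup>2 \<le> 1 * b\<^sup>2"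
          using b[OF True] by (intro mult_mono power_mono) auto
        then show ?thesis using True zd by (simp add: weight_density_def ennreal_leI)
      qed simp
    qed
    also have "\<dots> = ennreal (b\<^sup>2) * emeasure lborel (cball (0::complex) \<rho>)"
      by (rule nn_integral_cmult_indicator) simp
    also have "\<dots> < \<infinity>" using emeasure_bounded_finite[of "cball (0::complex) \<rho>"] by (simp add: ennreal_mult_less_top)
    finally show ?thesis .
  qed
  have "unit_disc \<subseteq> cball 0 \<rho> \<union> (\<Union>j<N. Q j)"
  proof
    fix z :: complex assume z: "z \<in> unit_disc"
    show "z \<in> cball 0 \<rho> \<union> (\<Union>j<N. Q j)"
    proof (cases "cmod z \<le> \<rho>")
      case False
      then have "\<exists>j<N. z \<in> Q j"
        unfolding Q_def by (intro annulus_covered_by_carleson_squares z) (auto simp: N_def \<rho>_def)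
      then show ?thesis by blast
    qed simp
  qed
  then have "emeasure (plane_measure p g) unit_disc \<le> emeasure (plane_measure p g) (cball 0 \<rho> \<union> (\<Union>j<N. Q j))"
    using Qb by (intro emeasure_mono) auto
  also have "\<dots> \<le> emeasure (plane_measure p g) (cball 0 \<rho>) + emeasure (plane_measure p g) (\<Union>j<N. Q j)"
    using Qb by (intro emeasure_subadditive) auto
  also have "\<dots> \<le> emeasure (plane_measure p g) (cball 0 \<rho>) + (\<Sum>j<N. emeasure (plane_measure p g) (Q j))"
    using Qb by (intro add_left_mono emeasure_subadditive_finite) auto
  also have "\<dots> < \<infinity>"
    using inner Qfin by (simp add: less_top)
  finally show ?thesis .
qed

definition vanishing_log_carleson :: "real \<Rightarrow> (complex \<Rightarrow> complex) \<Rightarrow> bool" where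
  "vanishing_log_carleson p g \<longleftrightarrow> (\<forall>e>0. \<exists>\<delta>>0. \<forall>I\<in>subarcs. arc_length I < \<delta> \<longrightarrow>
      emeasure (mu_measure p g) (carleson_square I) \<le> ennreal (e * arc_gauge p (arc_length I)))"

lemma vanishing_small_balls:
  assumes g: "g holomorphic_on unit_disc" and van: "vanishing_log_carleson p g" and e: "0 < e"
  obtains \<delta> where "0 < \<delta>" "\<delta> \<le> 1"
    "\<And>a t. \<lbrakk>a \<in> unit_disc; 0 < t; t < \<delta>\<rbrakk> \<Longrightarrow>
      emeasure (plane_measure p g) {z \<in> unit_disc. cmod (1 - cnj a * z) \<le> t} \<le> ennreal (e * arc_gauge p t)"
proof -
  obtain \<delta> where \<delta>: "0 < \<delta>" "\<And>I. I \<in> subarcs \<Longrightarrow> arc_length I < \<delta> \<Longrightarrow>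
      emeasure (mu_measure p g) (carleson_square I) \<le> ennreal (e * arc_gauge p (arc_length I))"
    using van e unfolding vanishing_log_carleson_def by blast
  show ?thesis
  proof (rule that[of "min \<delta> 1"])
    fix a t assume a: "a \<in> unit_disc" and t: "0 < t" "t < min \<delta> (1::real)"
    then have t1: "t \<le> 1" by simp
    show "emeasure (plane_measure p g) {z \<in> unit_disc. cmod (1 - cnj a * z) \<le> t} \<le> ennreal (e * arc_gauge p t)"
      using \<delta>(2)[OF closed_arc_subarc[OF t(1) t1, of "Arg a"]] t unfolding arc_length_closed_arc[OF t(1) t1]
      by (intro plane_measure_ball_le[OF g a t(1) t1]) simp
  qed (use \<delta> in auto)
qed

lemma vanishing_imp_log_carleson:
  assumes p: "0 < p" and g: "g holomorphic_on unit_disc" and van: "vanishing_log_carleson p g"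
  obtains A where "0 \<le> A" "log_carleson p (plane_measure p g) A"
proof -
  obtain \<delta> where \<delta>: "0 < \<delta>" "\<delta> \<le> 1" "\<And>a t. \<lbrakk>a \<in> unit_disc; 0 < t; t < \<delta>\<rbrakk> \<Longrightarrow>
      emeasure (plane_measure p g) {z \<in> unit_disc. cmod (1 - cnj a * z) \<le> t} \<le> ennreal (1 * arc_gauge p t)"
    using vanishing_small_balls[OF g van zero_less_one] by blast
  have "emeasure (plane_measure p g) unit_disc < \<infinity>"
    using van unfolding vanishing_log_carleson_def by (intro plane_measure_finite[OF g _ p]) (metis mult_1 zero_less_one)
  then obtain m where m: "emeasure (plane_measure p g) unit_disc = ennreal m" "0 \<le> m"
    by (metis ennreal_cases infinity_ennreal_def less_irrefl)
  define A where "A = max 1 (m / arc_gauge p \<delta>)"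
  have gp: "0 < arc_gauge p \<delta>" by (rule arc_gauge_pos[OF \<delta>(1,2)])
  have "log_carleson p (plane_measure p g) A"
  proof (rule log_carleson_from_small_balls[OF p sets_plane_measure \<delta>(1,2)])
    fix a t assume at: "a \<in> unit_disc" "0 < t" "t < \<delta>"
    have "1 * arc_gauge p t \<le> A * arc_gauge p t"
      using arc_gauge_pos[of t p] at \<delta>(2) by (intro mult_right_mono) (auto simp: A_def)
    then show "emeasure (plane_measure p g) {z \<in> unit_disc. cmod (1 - cnj a * z) \<le> t} \<le> ennreal (A * arc_gauge p t)"
      using order.trans[OF \<delta>(3)[OF at] ennreal_leI] by blast
  next
    have "m / arc_gauge p \<delta> \<le> A" by (simp add: A_def)
    then have "m \<le> A * arc_gauge p \<delta>" using gp by (simp add: field_simps)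
    then show "emeasure (plane_measure p g) unit_disc \<le> ennreal (A * arc_gauge p \<delta>)" unfolding m(1) by (rule ennreal_leI)
  qed (simp add: A_def)
  then show ?thesis using that[of A] by (simp add: A_def)
qed

text \<open>
  The vanishing condition makes small balls harmless. For large balls only the total mass matters, and the
  mass outside \<open>cball 0 \<rho>\<close> tends to \<open>0\<close> as \<open>\<rho> \<rightarrow> 1\<close> because the measure is finite.
\<close>

lemma vanishing_outer_part:
  assumes p: "0 < p" and g: "g holomorphic_on unit_disc" and van: "vanishing_log_carleson p g" and e: "0 < e"
  obtains \<rho> where "0 \<le> \<rho>" "\<rho> < 1"
    "log_carleson p (density (plane_measure p g) (indicator (- cball 0 \<rho>))) e"
proof -
  let ?\<nu> = "plane_measure p g"
  obtain \<delta> where \<delta>: "0 < \<delta>" "\<delta> \<le> 1" "\<And>a t. \<lbrakk>a \<in> unit_disc; 0 < t; t < \<delta>\<rbrakk> \<Longrightarrow>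
      emeasure ?\<nu> {z \<in> unit_disc. cmod (1 - cnj a * z) \<le> t} \<le> ennreal (e * arc_gauge p t)"
    using vanishing_small_balls[OF g van e] by blast
  have fin: "emeasure ?\<nu> unit_disc < \<infinity>"
    using van unfolding vanishing_log_carleson_def by (intro plane_measure_finite[OF g _ p]) (metis mult_1 zero_less_one)
  define \<rho> where "\<rho> = (\<lambda>k. 1 - 1 / real (Suc k))"
  have \<rho>: "0 \<le> \<rho> k" "\<rho> k < 1" for k by (simp_all add: \<rho>_def field_simps)
  have \<rho>_lim: "\<rho> \<longlonglongrightarrow> 1"
    unfolding \<rho>_def using tendsto_diff[OF tendsto_const[of "1::real"] LIMSEQ_inverse_real_of_nat] by (simp add: inverse_eq_divide)
  have \<rho>_mono: "\<rho> k \<le> \<rho> l" if "k \<le> l" for k l using that by (simp add: \<rho>_def field_simps)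
  define S where "S = (\<lambda>k. unit_disc - cball 0 (\<rho> k))"
  have "(\<lambda>k. emeasure ?\<nu> (S k)) \<longlonglongrightarrow> emeasure ?\<nu> (\<Inter>k. S k)"
  proof (rule Lim_emeasure_decseq)
    show "range S \<subseteq> sets ?\<nu>" by (auto simp: S_def)
    show "decseq S"
    proof (rule decseq_SucI)
      show "S (Suc n) \<subseteq> S n" for n using \<rho>_mono[of n "Suc n"] by (auto simp: S_def)
    qed
    fix k
    have "emeasure ?\<nu> (S k) \<le> emeasure ?\<nu> unit_disc" by (rule emeasure_mono) (auto simp: S_def)
    then show "emeasure ?\<nu> (S k) \<noteq> \<infinity>" using fin by auto
  qed
  also have "(\<Inter>k. S k) = {}"
  proof -
    have False if z: "z \<in> (\<Inter>k. S k)" for z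
    proof -
      have "cmod z < 1" "\<And>k. \<rho> k \<le> cmod z" using z by (auto simp: S_def not_le less_imp_le)
      then show False using LIMSEQ_le_const2[OF \<rho>_lim, of "cmod z"] by force
    qed
    then show ?thesis by blast
  qed
  finally have "(\<lambda>k. emeasure ?\<nu> (S k)) \<longlonglongrightarrow> 0" by simp
  moreover have "0 < ennreal (e * arc_gauge p \<delta>)" using e arc_gauge_pos[OF \<delta>(1,2)] by simp
  ultimately have "eventually (\<lambda>k. emeasure ?\<nu> (S k) < ennreal (e * arc_gauge p \<delta>)) sequentially"
    by (rule order_tendstoD)
  then obtain k where k: "emeasure ?\<nu> (S k) < ennreal (e * arc_gauge p \<delta>)"
    by (auto simp: eventually_sequentially)
  let ?\<nu>' = "density ?\<nu> (indicator (- cball 0 (\<rho> k)))"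
  have em: "emeasure ?\<nu>' B = emeasure ?\<nu> (B - cball 0 (\<rho> k))" if B: "B \<in> sets borel" for B
  proof -
    have "emeasure ?\<nu>' B = (\<integral>\<^sup>+z. indicator (- cball 0 (\<rho> k)) z * indicator B z \<partial>?\<nu>)"
      using B by (intro emeasure_density borel_measurable_indicator) auto
    also have "\<dots> = (\<integral>\<^sup>+z. indicator (B - cball 0 (\<rho> k)) z \<partial>?\<nu>)"
      by (intro nn_integral_cong) (auto split: split_indicator)
    also have "\<dots> = emeasure ?\<nu> (B - cball 0 (\<rho> k))" using B by (intro nn_integral_indicator) auto
    finally show ?thesis .
  qed
  have "log_carleson p ?\<nu>' e"
  proof (rule log_carleson_from_small_balls[OF p _ \<delta>(1,2)])
    fix a t assume at: "a \<in> unit_disc" "0 < t" "t < \<delta>"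
    have "emeasure ?\<nu>' {z \<in> unit_disc. cmod (1 - cnj a * z) \<le> t} \<le> emeasure ?\<nu> {z \<in> unit_disc. cmod (1 - cnj a * z) \<le> t}"
      unfolding em[OF nonisotropic_ball_borel] by (rule emeasure_mono) (use nonisotropic_ball_borel in auto)
    then show "emeasure ?\<nu>' {z \<in> unit_disc. cmod (1 - cnj a * z) \<le> t} \<le> ennreal (e * arc_gauge p t)"
      using \<delta>(3)[OF at] order.trans by blast
  next
    show "emeasure ?\<nu>' unit_disc \<le> ennreal (e * arc_gauge p \<delta>)"
      using k by (subst em) (auto simp: S_def)
  qed (use e in auto)
  with \<rho> that show ?thesis by blast
qed

section \<open>Compactness of the integral operator\<close>

lemma Qp_norm_diff_le:
  assumes "f \<in> Qp p" "h \<in> Qp p"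
  shows "Qp_norm p (\<lambda>z. f z - h z) \<le> Qp_norm p f + Qp_norm p h"
proof -
  have fin: "Qp_enorm p f < top" "Qp_enorm p h < top" using assms by (auto simp: Qp_def)
  have "Qp_enorm p (\<lambda>z. f z - h z) \<le> Qp_enorm p f + Qp_enorm p h"
    using assms by (intro Qp_enorm_diff_le) (auto simp: Qp_def)
  then show ?thesis unfolding Qp_norm_def using fin
    by (subst enn2real_plus[symmetric]) (auto intro!: enn2real_mono)
qed

text \<open>
  The growth estimate makes the sequence locally bounded, so Montel's theorem applies; the limit stays
  in the space by Fatou's lemma. Both summands of the norm of the limit are at most \<open>r\<close>.
\<close>

lemma Qp_bounded_sequence_subseq:
  assumes p: "0 < p" and f: "\<And>n. f n \<in> Qp p" "\<And>n. Qp_norm p (f n) \<le> r"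
  obtains s :: "nat \<Rightarrow> nat" and F where "strict_mono s" "F \<in> Qp p" "Qp_norm p F \<le> 2 * r"
    "\<And>K. \<lbrakk>compact K; K \<subseteq> unit_disc\<rbrakk> \<Longrightarrow> uniform_limit K (\<lambda>n. f (s n)) F sequentially"
proof -
  have r: "0 \<le> r" using f(2)[of 0] Qp_norm_nonneg order.trans by blast
  have bounded: "\<exists>B. \<forall>h\<in>range f. \<forall>z\<in>K. cmod (h z) \<le> B" if K: "compact K" "K \<subseteq> unit_disc" for K
  proof -
    have "continuous_on K (\<lambda>z. (1 + bloch_const p * ln (1 / (1 - cmod z))) * r)"
      using K(2) by (intro continuous_intros) force+
    then have "bounded ((\<lambda>z. (1 + bloch_const p * ln (1 / (1 - cmod z))) * r) ` K)"
      using K(1) compact_continuous_image compact_imp_bounded by blast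
    then obtain B where B: "\<And>z. z \<in> K \<Longrightarrow> \<bar>(1 + bloch_const p * ln (1 / (1 - cmod z))) * r\<bar> \<le> B"
      unfolding bounded_iff real_norm_def by blast
    have "cmod (f n z) \<le> B" if z: "z \<in> K" for n z
    proof -
      have zd: "z \<in> unit_disc" using z K(2) by blast
      have "0 \<le> ln (1 / (1 - cmod z))" using zd by (intro ln_ge_zero) (simp add: field_simps)
      then have "0 \<le> 1 + bloch_const p * ln (1 / (1 - cmod z))"
        using bloch_const_pos[OF p] by (intro add_nonneg_nonneg mult_nonneg_nonneg) auto
      then have "cmod (f n z) \<le> (1 + bloch_const p * ln (1 / (1 - cmod z))) * r"
        using order.trans[OF Qp_pointwise_bound[OF p f(1) zd] mult_left_mono[OF f(2)]] by blast
      also have "\<dots> \<le> B" using B[OF z] by linarith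
      finally show ?thesis .
    qed
    then show ?thesis by (intro exI[of _ B]) auto
  qed
  have hol: "h holomorphic_on unit_disc" if "h \<in> range f" for h
    using that Qp_holomorphic[OF f(1)] by auto
  obtain G s where G: "G holomorphic_on unit_disc" and s: "strict_mono (s :: nat \<Rightarrow> nat)"
    and lim: "\<And>z. z \<in> unit_disc \<Longrightarrow> (\<lambda>n. f (s n) z) \<longlonglongrightarrow> G z"
    and ulim: "\<And>K. \<lbrakk>compact K; K \<subseteq> unit_disc\<rbrakk> \<Longrightarrow> uniform_limit K (f \<circ> s) G sequentially"
  proof (rule Montel[OF open_ball hol bounded subset_refl])
    fix G s
    assume "G holomorphic_on unit_disc" "strict_mono (s :: nat \<Rightarrow> nat)"
      "\<And>z. z \<in> unit_disc \<Longrightarrow> (\<lambda>n. f (s n) z) \<longlonglongrightarrow> G z"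
      "\<And>K. \<lbrakk>compact K; K \<subseteq> unit_disc\<rbrakk> \<Longrightarrow> uniform_limit K (f \<circ> s) G sequentially"
    then show thesis by (rule that)
  qed
  define F where "F = (\<lambda>z. if z \<in> unit_disc then G z else 0)"
  have FG: "F z = G z" if "z \<in> unit_disc" for z using that by (simp add: F_def)
  have F: "F holomorphic_on unit_disc" using G by (rule holomorphic_transform) (simp add: F_def)
  have ulimF: "uniform_limit K (\<lambda>n. f (s n)) F sequentially" if "compact K" "K \<subseteq> unit_disc" for K
    using ulim[OF that] that(2) FG by (subst uniform_limit_cong'[where g = "f \<circ> s" and i = G]) (auto simp: o_def)
  have dlim: "(\<lambda>n. deriv (f (s n)) z) \<longlonglongrightarrow> deriv F z" if z: "z \<in> unit_disc" for z
  proof -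
    obtain t where t: "cmod z < t" "t < 1" using z dense[of "cmod z" 1] by auto
    have "uniform_limit (ball 0 t) (\<lambda>n. f (s n)) F sequentially"
      by (rule uniform_limit_on_subset[OF ulimF[of "cball 0 t"]]) (use t in auto)
    then show ?thesis
      by (rule deriv_complex_uniform_limit)
         (use t in \<open>auto intro!: always_eventually holomorphic_on_subset[OF Qp_holomorphic[OF f(1)]]\<close>)
  qed
  have E: "Qp_energy p F w \<le> ennreal (r\<^sup>2)" if w: "w \<in> unit_disc" for w
  proof -
    let ?I = "\<lambda>h z. ennreal ((cmod (deriv h z))\<^sup>2 * (1 - (cmod (disc_aut w z))\<^sup>2) powr p) * indicator unit_disc z"
    have "Qp_energy p F w \<le> (\<integral>\<^sup>+z. liminf (\<lambda>n. ?I (f (s n)) z) \<partial>lborel)"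
      unfolding Qp_energy_def
    proof (rule nn_integral_mono)
      fix z
      have "(\<lambda>n. ?I (f (s n)) z) \<longlonglongrightarrow> ?I F z"
      proof (cases "z \<in> unit_disc")
        case True
        then show ?thesis using dlim[OF True] by (auto intro!: tendsto_intros)
      qed simp
      then show "?I F z \<le> liminf (\<lambda>n. ?I (f (s n)) z)" by (simp add: lim_imp_Liminf)
    qed
    also have "\<dots> \<le> liminf (\<lambda>n. Qp_energy p (f (s n)) w)"
      unfolding Qp_energy_def by (rule nn_integral_liminf[OF Qp_integrand_measurable[OF Qp_holomorphic[OF f(1)] w]])
    also have "\<dots> \<le> ennreal (r\<^sup>2)"
    proof (rule order.trans[OF Liminf_mono Liminf_const[THEN eq_refl]])
      show "\<forall>\<^sub>F n in sequentially. Qp_energy p (f (s n)) w \<le> ennreal (r\<^sup>2)"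
        using order.trans[OF Qp_energy_le_norm[OF f(1) w] ennreal_leI[OF power_mono[OF f(2) Qp_norm_nonneg]]] by simp
    qed simp
    finally show ?thesis .
  qed
  have lim0: "(\<lambda>n. cmod (f (s n) 0)) \<longlonglongrightarrow> cmod (F 0)"
    using tendsto_norm[OF lim[of 0]] FG[of 0] by simp
  have "cmod (F 0) \<le> r"
  proof (rule LIMSEQ_le_const2[OF lim0])
    show "\<exists>N. \<forall>n\<ge>N. cmod (f (s n) 0) \<le> r" using order.trans[OF norm_0_le_Qp_norm[OF f(1)] f(2)] by blast
  qed
  then have "Qp_norm p F \<le> 2 * r" using Qp_norm_le[OF r E] by fastforce
  moreover have "F \<in> Qp p" by (rule QpI[OF F _ r E]) (auto simp: F_def)
  ultimately show ?thesis using that[OF s] ulimF by blast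
qed

text \<open>
  Inside \<open>cball 0 \<rho>\<close> the function is small and the Poisson-type integral bounded; outside, the
  measure is small and the embedding theorem applies.
\<close>

lemma V_op_energy_split:
  assumes p: "0 < p" and g: "g holomorphic_on unit_disc"
    and lc: "log_carleson p (plane_measure p g) A" "0 \<le> A"
    and outer: "log_carleson p (density (plane_measure p g) (indicator (- cball 0 \<rho>))) e" "0 \<le> e"
    and h: "h \<in> Qp p" "Qp_norm p h \<le> R" and \<eta>: "\<And>z. z \<in> cball 0 \<rho> \<Longrightarrow> cmod (h z) \<le> \<eta>" and w: "w \<in> unit_disc"
  shows "Qp_energy p (V_op g h) w \<le> ennreal (\<eta>\<^sup>2 * (poisson_const p * A / (ln 2)\<^sup>2) + embed_const p * e * R\<^sup>2)"
proof -
  let ?\<nu> = "plane_measure p g"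
  let ?\<nu>' = "density ?\<nu> (indicator (- cball 0 \<rho>))"
  let ?P = "\<lambda>z. poisson_kernel w z powr p"
  note hh = Qp_holomorphic[OF h(1)]
  have R: "0 \<le> R" using h(2) Qp_norm_nonneg order.trans by blast
  have [measurable]: "(\<lambda>z. indicator unit_disc z *\<^sub>R h z) \<in> borel_measurable borel"
    by (intro borel_measurable_continuous_on_indicator holomorphic_on_imp_continuous_on hh) auto
  have F_eq: "ennreal ((cmod (h z))\<^sup>2 * ?P z) * indicator unit_disc z =
      ennreal ((cmod (indicator unit_disc z *\<^sub>R h z))\<^sup>2 * ?P z) * indicator unit_disc z" for z
    by (auto split: split_indicator)
  have "(\<lambda>z. ennreal ((cmod (indicator unit_disc z *\<^sub>R h z))\<^sup>2 * ?P z) * indicator unit_disc z) \<in> borel_measurable borel"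
    by measurable
  then have F_meas: "(\<lambda>z. ennreal ((cmod (h z))\<^sup>2 * ?P z) * indicator unit_disc z) \<in> borel_measurable ?\<nu>"
    unfolding F_eq by (simp cong: measurable_cong_sets)
  have outer_eq: "(\<integral>\<^sup>+z\<in>unit_disc. ennreal ((cmod (h z))\<^sup>2 * ?P z) \<partial>?\<nu>') =
      (\<integral>\<^sup>+z. indicator (- cball 0 \<rho>) z * (ennreal ((cmod (h z))\<^sup>2 * ?P z) * indicator unit_disc z) \<partial>?\<nu>)"
    by (rule nn_integral_density[OF _ F_meas]) (intro borel_measurable_indicator, simp)
  have P_meas: "(\<lambda>z. ennreal (?P z) * indicator unit_disc z) \<in> borel_measurable ?\<nu>"
  proof -
    have "(\<lambda>z. ennreal (?P z) * indicator unit_disc z) \<in> borel_measurable borel" by measurable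
    then show ?thesis by (simp cong: measurable_cong_sets)
  qed
  have "Qp_energy p (V_op g h) w = (\<integral>\<^sup>+z\<in>unit_disc. ennreal ((cmod (h z))\<^sup>2 * ?P z) \<partial>?\<nu>)"
    by (rule Qp_energy_V_op[OF g hh w])
  also have "\<dots> \<le> (\<integral>\<^sup>+z. ennreal (\<eta>\<^sup>2) * (ennreal (?P z) * indicator unit_disc z) +
     indicator (- cball 0 \<rho>) z * (ennreal ((cmod (h z))\<^sup>2 * ?P z) * indicator unit_disc z) \<partial>?\<nu>)"
  proof (rule nn_integral_mono)
    fix z
    show "ennreal ((cmod (h z))\<^sup>2 * ?P z) * indicator unit_disc z \<le>
      ennreal (\<eta>\<^sup>2) * (ennreal (?P z) * indicator unit_disc z) +
      indicator (- cball 0 \<rho>) z * (ennreal ((cmod (h z))\<^sup>2 * ?P z) * indicator unit_disc z)"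
    proof (cases "z \<in> cball 0 \<rho>")
      case True
      have "(cmod (h z))\<^sup>2 * ?P z \<le> \<eta>\<^sup>2 * ?P z"
        by (intro mult_right_mono power_mono \<eta> True) auto
      then show ?thesis using True by (auto split: split_indicator simp: ennreal_leI simp flip: ennreal_mult)
    qed (simp add: add_increasing)
  qed
  also have "\<dots> = ennreal (\<eta>\<^sup>2) * (\<integral>\<^sup>+z\<in>unit_disc. ennreal (?P z) \<partial>?\<nu>) +
      (\<integral>\<^sup>+z\<in>unit_disc. ennreal ((cmod (h z))\<^sup>2 * ?P z) \<partial>?\<nu>')"
    unfolding outer_eq
  proof (subst nn_integral_add)
    show "(\<lambda>z. ennreal (\<eta>\<^sup>2) * (ennreal (?P z) * indicator unit_disc z)) \<in> borel_measurable ?\<nu>"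
      using P_meas by measurable
    show "(\<lambda>z. indicator (- cball 0 \<rho>) z * (ennreal ((cmod (h z))\<^sup>2 * ?P z) * indicator unit_disc z)) \<in> borel_measurable ?\<nu>"
      by (intro borel_measurable_times_ennreal F_meas borel_measurable_indicator) simp
  qed (simp only: nn_integral_cmult[OF P_meas])
  also have "\<dots> \<le> ennreal (\<eta>\<^sup>2) * ennreal (poisson_const p * A / (ln 2)\<^sup>2) + ennreal (embed_const p * e * R\<^sup>2)"
  proof (intro add_mono mult_left_mono)
    have w1: "0 < 1 - cmod w" "1 - cmod w \<le> 1" using w by auto
    have "ln 2 \<le> ln (2 / (1 - cmod w))" using w1 by (subst ln_le_cancel_iff) (auto simp: field_simps)
    then have "poisson_const p * A / (ln (2 / (1 - cmod w)))\<^sup>2 \<le> poisson_const p * A / (ln 2)\<^sup>2"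
      using poisson_const_nonneg[OF p] lc(2) by (intro divide_left_mono power_mono mult_pos_pos) auto
    then show "(\<integral>\<^sup>+z\<in>unit_disc. ennreal (?P z) \<partial>?\<nu>) \<le> ennreal (poisson_const p * A / (ln 2)\<^sup>2)"
      using order.trans[OF log_carleson_poisson[OF p sets_plane_measure lc w] ennreal_leI] by blast
    show "(\<integral>\<^sup>+z\<in>unit_disc. ennreal ((cmod (h z))\<^sup>2 * ?P z) \<partial>?\<nu>') \<le> ennreal (embed_const p * e * R\<^sup>2)"
    proof (rule log_carleson_embedding[OF p _ outer hh _ _ w])
      show "cmod (h 0) \<le> R" using norm_0_le_Qp_norm[OF h(1)] h(2) by linarith
      show "Qp_energy p h v \<le> ennreal (R\<^sup>2)" if "v \<in> unit_disc" for v
        using order.trans[OF Qp_energy_le_norm[OF h(1) that] ennreal_leI[OF power_mono[OF h(2) Qp_norm_nonneg]]] .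
    qed simp
  qed auto
  also have "\<dots> = ennreal (\<eta>\<^sup>2 * (poisson_const p * A / (ln 2)\<^sup>2) + embed_const p * e * R\<^sup>2)"
    using poisson_const_nonneg[OF p] lc(2) outer(2) embed_const_nonneg[OF p]
    by (subst ennreal_mult[symmetric], simp, simp, subst ennreal_plus) auto
  finally show ?thesis .
qed

text \<open>
  Along a locally uniformly convergent subsequence the differences to the limit are bounded in norm
  and small on compact discs, so splitting the energy makes both parts small.
\<close>

lemma V_op_compact:
  assumes p: "0 < p" and g: "g holomorphic_on unit_disc" and van: "vanishing_log_carleson p g"
  shows "compact_on_Qp p (V_op g)"
proof -
  obtain A where A: "0 \<le> A" and lc: "log_carleson p (plane_measure p g) A"
    using vanishing_imp_log_carleson[OF p g van] .
  show ?thesis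
  proof (rule compact_on_Qp_I)
    show "V_op g \<in> Qp p \<rightarrow> Qp p" using V_op_bound(1)[OF p g lc A] by blast
    fix f :: "nat \<Rightarrow> complex \<Rightarrow> complex" and r
    assume f: "\<And>n. f n \<in> Qp p" "\<And>n. Qp_norm p (f n) \<le> r"
    obtain s F where s: "strict_mono (s :: nat \<Rightarrow> nat)" and F: "F \<in> Qp p" "Qp_norm p F \<le> 2 * r"
      and ulim: "\<And>K. \<lbrakk>compact K; K \<subseteq> unit_disc\<rbrakk> \<Longrightarrow> uniform_limit K (\<lambda>n. f (s n)) F sequentially"
      by (rule Qp_bounded_sequence_subseq[of p f r, OF p f]) (rule that)
    define h where "h = (\<lambda>n z. f (s n) z - F z)"
    \<comment> \<open>\<open>r\<close> for the sequence and \<open>2 * r\<close> for its limit\<close>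
    define R where "R = 3 * r"
    have h: "h n \<in> Qp p" "Qp_norm p (h n) \<le> R" for n
      unfolding h_def R_def using Qp_diff[OF f(1) F(1)] Qp_norm_diff_le[OF f(1) F(1), of "s n"] f(2)[of "s n"] F(2) by auto
    define V where "V = (\<lambda>n z. V_op g (f (s n)) z - V_op g F z)"
    note fh = Qp_holomorphic[OF f(1)] and Fh = Qp_holomorphic[OF F(1)] and hh = Qp_holomorphic[OF h(1)]
    have V_energy: "Qp_energy p (V n) w = Qp_energy p (V_op g (h n)) w" for n w
    proof (rule Qp_energy_cong)
      fix z assume z: "z \<in> unit_disc"
      have "deriv (V n) z = deriv (V_op g (f (s n))) z - deriv (V_op g F) z"
        unfolding V_def using z V_op_props(1)[OF g fh] V_op_props(1)[OF g Fh]
        by (intro deriv_diff holomorphic_on_imp_differentiable_at[OF _ open_ball]) auto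
      also have "\<dots> = deriv (V_op g (h n)) z"
        using V_op_props(2)[OF g _ z] fh Fh hh by (simp add: h_def algebra_simps)
      finally show "cmod (deriv (V n) z) = cmod (deriv (V_op g (h n)) z)" by simp
    qed
    define C1 where "C1 = poisson_const p * A / (ln 2)\<^sup>2"
    define C2 where "C2 = embed_const p * R\<^sup>2"
    have C: "0 \<le> C1" "0 \<le> C2" unfolding C1_def C2_def
      using poisson_const_nonneg[OF p] embed_const_nonneg[OF p] A by auto
    have "(\<lambda>n. Qp_norm p (V n)) \<longlonglongrightarrow> 0"
    proof (rule LIMSEQ_I)
      fix \<epsilon> :: real assume \<epsilon>: "0 < \<epsilon>"
      \<comment> \<open>Each of the two parts of the energy is allotted half of \<open>(\<epsilon> / 2)\<^sup>2\<close>.\<close>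
      define e where "e = (\<epsilon> / 2)\<^sup>2 / 2 / (C2 + 1)"
      define \<eta> where "\<eta> = \<epsilon> / 2 / sqrt (2 * (C1 + 1))"
      have e: "0 < e" and \<eta>: "0 < \<eta>" unfolding e_def \<eta>_def using \<epsilon> C by (auto intro!: divide_pos_pos add_nonneg_pos)
      have small: "\<eta>\<^sup>2 * C1 + C2 * e \<le> (\<epsilon> / 2)\<^sup>2"
      proof -
        define q where "q = (\<epsilon> / 2)\<^sup>2 / 2"
        have q: "0 \<le> q" by (simp add: q_def)
        have "\<eta>\<^sup>2 = q / (C1 + 1)"
          unfolding \<eta>_def q_def power_divide using C by simp
        then have "\<eta>\<^sup>2 * C1 = q * (C1 / (C1 + 1))" by simp
        also have "\<dots> \<le> q * 1" using C q by (intro mult_left_mono) auto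
        finally have "\<eta>\<^sup>2 * C1 \<le> q" by simp
        moreover have "C2 * e = q * (C2 / (C2 + 1))" unfolding e_def q_def by simp
        moreover have "\<dots> \<le> q * 1" using C q by (intro mult_left_mono) auto
        ultimately show ?thesis unfolding q_def by linarith
      qed
      obtain \<rho> where \<rho>: "0 \<le> \<rho>" "\<rho> < 1"
        and outer: "log_carleson p (density (plane_measure p g) (indicator (- cball 0 \<rho>))) e"
        using vanishing_outer_part[OF p g van e] .
      have "uniform_limit (cball 0 \<rho>) (\<lambda>n. f (s n)) F sequentially" using \<rho> by (intro ulim) auto
      then obtain N where N: "\<And>n z. N \<le> n \<Longrightarrow> z \<in> cball 0 \<rho> \<Longrightarrow> dist (f (s n) z) (F z) < \<eta>"
        using \<eta> unfolding uniform_limit_iff eventually_sequentially by blast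
      show "\<exists>N. \<forall>n\<ge>N. norm (Qp_norm p (V n) - 0) < \<epsilon>"
      proof (intro exI[of _ N] allI impI)
        fix n assume n: "N \<le> n"
        have E: "Qp_energy p (V n) w \<le> ennreal ((\<epsilon> / 2)\<^sup>2)" if w: "w \<in> unit_disc" for w
        proof -
          have "Qp_energy p (V n) w \<le> ennreal (\<eta>\<^sup>2 * (poisson_const p * A / (ln 2)\<^sup>2) + embed_const p * e * R\<^sup>2)"
            unfolding V_energy
          proof (rule V_op_energy_split[OF p g lc A outer _ h])
            show "cmod (h n z) \<le> \<eta>" if "z \<in> cball 0 \<rho>" for z
              using N[OF n that] by (simp add: h_def dist_norm)
          qed (use e w in auto)
          also have "\<eta>\<^sup>2 * (poisson_const p * A / (ln 2)\<^sup>2) + embed_const p * e * R\<^sup>2 = \<eta>\<^sup>2 * C1 + C2 * e"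
            by (simp add: C1_def C2_def mult_ac)
          finally show ?thesis using small ennreal_leI order.trans by blast
        qed
        have "Qp_norm p (V n) \<le> 0 + \<epsilon> / 2"
          using \<epsilon> V_op_props(3)[OF g fh] V_op_props(3)[OF g Fh] by (intro Qp_norm_le[OF _ E]) (auto simp: V_def)
        then show "norm (Qp_norm p (V n) - 0) < \<epsilon>" using \<epsilon> Qp_norm_nonneg[of p "V n"] by simp
      qed
    qed
    then show "\<exists>s G. strict_mono (s :: nat \<Rightarrow> nat) \<and> G \<in> Qp p \<and> (\<lambda>n. Qp_norm p (\<lambda>z. V_op g (f (s n)) z - G z)) \<longlonglongrightarrow> 0"
      using s V_op_bound(1)[OF p g lc A F(1)] unfolding V_def by blast
  qed
qed

section \<open>The characterizations\<close>

lemma Hinf_norm_finite_iff: "Hinf_norm g < \<infinity> \<longleftrightarrow> (\<exists>G. \<forall>z\<in>unit_disc. cmod (g z) \<le> G)"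
proof
  assume fin: "Hinf_norm g < \<infinity>"
  define G where "G = enn2real (Hinf_norm g)"
  have G: "Hinf_norm g = ennreal G" "0 \<le> G" using fin by (auto simp: G_def)
  have "cmod (g z) \<le> G" if "z \<in> unit_disc" for z
  proof -
    have "ennreal (cmod (g z)) \<le> ennreal G"
      unfolding G(1)[symmetric] Hinf_norm_def by (rule SUP_upper[OF that])
    then show ?thesis using G(2) by (simp add: ennreal_le_iff)
  qed
  then show "\<exists>G. \<forall>z\<in>unit_disc. cmod (g z) \<le> G" by blast
next
  assume "\<exists>G. \<forall>z\<in>unit_disc. cmod (g z) \<le> G"
  then obtain G where "\<And>z. z \<in> unit_disc \<Longrightarrow> cmod (g z) \<le> G" by blast
  then have "Hinf_norm g \<le> ennreal G" unfolding Hinf_norm_def by (intro SUP_least ennreal_leI) auto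
  then show "Hinf_norm g < \<infinity>" using order.strict_trans1 ennreal_less_top by fastforce
qed

lemma bounded_on_QpD:
  assumes "bounded_on_Qp p T"
  obtains C where "0 \<le> C" "\<And>f. f \<in> Qp p \<Longrightarrow> T f \<in> Qp p" "\<And>f. f \<in> Qp p \<Longrightarrow> Qp_norm p (T f) \<le> C * Qp_norm p f"
proof -
  obtain C where C: "\<And>f. f \<in> Qp p \<Longrightarrow> Qp_norm p (T f) \<le> C * Qp_norm p f"
    using assms unfolding bounded_on_Qp_def by blast
  show ?thesis
  proof (rule that[of "max 0 C"])
    show "T f \<in> Qp p" if "f \<in> Qp p" for f using assms that unfolding bounded_on_Qp_def by blast
    show "Qp_norm p (T f) \<le> max 0 C * Qp_norm p f" if "f \<in> Qp p" for f
      using order.trans[OF C[OF that] mult_right_mono[of C "max 0 C", OF _ Qp_norm_nonneg]] by simp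
  qed simp
qed

lemma bounded_on_test_fn:
  assumes p: "0 < p" and T: "bounded_on_Qp p T"
  obtains N where "0 \<le> N" "\<And>w. w \<in> unit_disc \<Longrightarrow> T (test_fn w) \<in> Qp p" "\<And>w. w \<in> unit_disc \<Longrightarrow> Qp_norm p (T (test_fn w)) \<le> N"
proof -
  obtain C where C: "0 \<le> C" "\<And>f. f \<in> Qp p \<Longrightarrow> T f \<in> Qp p" "\<And>f. f \<in> Qp p \<Longrightarrow> Qp_norm p (T f) \<le> C * Qp_norm p f"
    by (rule bounded_on_QpD[OF T]) (rule that)
  have le: "Qp_norm p (T (test_fn w)) \<le> C * test_const p" if w: "w \<in> unit_disc" for w
    using order.trans[OF C(3)[OF test_fn_Qp(1)[OF p w]] mult_left_mono[OF test_fn_Qp(2)[OF p w] C(1)]] .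
  have "0 \<le> C * test_const p" using order.trans[OF Qp_norm_nonneg le[of 0]] by simp
  with le C(2)[OF test_fn_Qp(1)[OF p]] that show ?thesis by blast
qed

lemma holomorphic_bounded_if_bounded_near_boundary:
  assumes g: "g holomorphic_on unit_disc" and b: "\<And>w. \<lbrakk>w \<in> unit_disc; 1/2 \<le> cmod w\<rbrakk> \<Longrightarrow> cmod (g w) \<le> b"
  shows "\<exists>G. \<forall>z\<in>unit_disc. cmod (g z) \<le> G"
proof -
  have "compact (g ` cball 0 (1/2))"
    by (intro compact_continuous_image holomorphic_on_imp_continuous_on holomorphic_on_subset[OF g]) auto
  then obtain c where c: "\<And>z. z \<in> cball 0 (1/2) \<Longrightarrow> cmod (g z) \<le> c"
    by (metis bounded_iff compact_imp_bounded imageI)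
  have "cmod (g z) \<le> max b c" if z: "z \<in> unit_disc" for z
  proof (cases "cmod z \<le> 1/2")
    case True
    then show ?thesis using c[of z] by simp
  next
    case False
    then show ?thesis using b[OF z] by simp
  qed
  then show ?thesis by blast
qed

lemma V_op_bounded_iff:
  assumes p: "0 < p" and g: "g holomorphic_on unit_disc"
  shows "bounded_on_Qp p (V_op g) \<longleftrightarrow> LCM_norm p (mu_measure p g) < \<infinity>"
proof
  assume T: "bounded_on_Qp p (V_op g)"
  obtain N where N: "0 \<le> N" "\<And>w. w \<in> unit_disc \<Longrightarrow> V_op g (test_fn w) \<in> Qp p"
      "\<And>w. w \<in> unit_disc \<Longrightarrow> Qp_norm p (V_op g (test_fn w)) \<le> N"
    by (rule bounded_on_test_fn[OF p T]) (rule that)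
  show "LCM_norm p (mu_measure p g) < \<infinity>"
    unfolding LCM_norm_finite_iff
  proof (intro exI[of _ "16 * 100 powr p * N\<^sup>2"] conjI ballI)
    fix I assume I: "I \<in> subarcs"
    obtain w where w: "w \<in> unit_disc"
      "\<And>N. Qp_energy p (V_op g (test_fn w)) w \<le> ennreal (N\<^sup>2) \<Longrightarrow>
       emeasure (mu_measure p g) (carleson_square I) \<le> ennreal (16 * 100 powr p * N\<^sup>2 * arc_gauge p (arc_length I))"
      by (rule V_op_lower[OF p g I]) (rule that)
    show "emeasure (mu_measure p g) (carleson_square I) \<le> ennreal (16 * 100 powr p * N\<^sup>2 * arc_gauge p (arc_length I))"
      by (rule w(2), rule order.trans[OF Qp_energy_le_norm[OF N(2)[OF w(1)] w(1)]])
         (intro ennreal_leI power_mono N(3) w(1) Qp_norm_nonneg)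
  qed simp
next
  assume "LCM_norm p (mu_measure p g) < \<infinity>"
  then obtain A where A: "0 \<le> A" "log_carleson p (plane_measure p g) A"
    using LCM_imp_log_carleson[OF g] by blast
  show "bounded_on_Qp p (V_op g)"
    unfolding bounded_on_Qp_def using V_op_bound(1,2)[OF p g A(2,1)] by blast
qed

lemma V_op_compact_iff:
  assumes p: "0 < p" and g: "g holomorphic_on unit_disc"
  shows "compact_on_Qp p (V_op g) \<longleftrightarrow> vanishing_log_carleson p g"
proof
  assume T: "compact_on_Qp p (V_op g)"
  show "vanishing_log_carleson p g"
    unfolding vanishing_log_carleson_def
  proof (intro allI impI)
    fix e :: real assume e: "0 < e"
    define N where "N = sqrt (e / (16 * 100 powr p))"
    have N: "0 < N" "16 * 100 powr p * N\<^sup>2 = e" using e by (auto simp: N_def)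
    obtain \<rho> where \<rho>: "0 \<le> \<rho>" "\<rho> < 1"
      and small: "\<And>w. \<lbrakk>w \<in> unit_disc; \<rho> \<le> cmod w\<rbrakk> \<Longrightarrow> Qp_norm p (V_op g (test_fn w)) < N"
      by (rule compact_test_fn_null[OF p T test_fn_sequence_ops_null(1)[OF g] N(1)]) (assumption | rule that)+
    show "\<exists>\<delta>>0. \<forall>I\<in>subarcs. arc_length I < \<delta> \<longrightarrow>
      emeasure (mu_measure p g) (carleson_square I) \<le> ennreal (e * arc_gauge p (arc_length I))"
    proof (intro exI[of _ "1 - \<rho>"] conjI ballI impI)
      fix I assume I: "I \<in> subarcs" and len: "arc_length I < 1 - \<rho>"
      obtain w where w: "w \<in> unit_disc" "cmod w = 1 - arc_length I"
        "\<And>N. Qp_energy p (V_op g (test_fn w)) w \<le> ennreal (N\<^sup>2) \<Longrightarrow>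
         emeasure (mu_measure p g) (carleson_square I) \<le> ennreal (16 * 100 powr p * N\<^sup>2 * arc_gauge p (arc_length I))"
        by (rule V_op_lower[OF p g I]) (rule that)
      have VQ: "V_op g (test_fn w) \<in> Qp p" using T test_fn_Qp(1)[OF p w(1)] by (auto simp: compact_on_Qp_def)
      have "Qp_norm p (V_op g (test_fn w)) \<le> N" using small[OF w(1)] w(2) len by simp
      then have "Qp_energy p (V_op g (test_fn w)) w \<le> ennreal (N\<^sup>2)"
        by (intro order.trans[OF Qp_energy_le_norm[OF VQ w(1)]] ennreal_leI power_mono Qp_norm_nonneg)
      from w(3)[OF this] show "emeasure (mu_measure p g) (carleson_square I) \<le> ennreal (e * arc_gauge p (arc_length I))"
        unfolding N(2) .
    qed (use \<rho> in simp)
  qed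
next
  assume "vanishing_log_carleson p g"
  then show "compact_on_Qp p (V_op g)" by (rule V_op_compact[OF p g])
qed

lemma U_op_bounded:
  assumes p: "0 < p" and g: "g holomorphic_on unit_disc" and G: "\<And>z. z \<in> unit_disc \<Longrightarrow> cmod (g z) \<le> G"
    and f: "f \<in> Qp p"
  shows "U_op g f \<in> Qp p" "Qp_norm p (U_op g f) \<le> G * Qp_norm p f"
    "w \<in> unit_disc \<Longrightarrow> Qp_energy p (U_op g f) w \<le> ennreal ((G * Qp_norm p f)\<^sup>2)"
proof -
  note fh = Qp_holomorphic[OF f]
  have G0: "0 \<le> G" using G[of 0] order.trans[OF norm_ge_zero] by auto
  have E: "Qp_energy p (U_op g f) w \<le> ennreal ((G * Qp_norm p f)\<^sup>2)" if "w \<in> unit_disc" for w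
    by (rule Qp_energy_U_op_le[OF g fh that G Qp_energy_le_norm[OF f that]])
  have n0: "0 \<le> G * Qp_norm p f" using G0 Qp_norm_nonneg by simp
  show "U_op g f \<in> Qp p" by (rule QpI[OF U_op_props(1)[OF g fh] U_op_props(4)[OF g fh] n0 E])
  show "Qp_norm p (U_op g f) \<le> G * Qp_norm p f"
    using Qp_norm_le[OF n0 E, of 0] U_op_props(3)[OF g fh] by simp
  show "w \<in> unit_disc \<Longrightarrow> Qp_energy p (U_op g f) w \<le> ennreal ((G * Qp_norm p f)\<^sup>2)" by (rule E)
qed

lemma U_op_bounded_iff:
  assumes p: "0 < p" and g: "g holomorphic_on unit_disc"
  shows "bounded_on_Qp p (U_op g) \<longleftrightarrow> Hinf_norm g < \<infinity>"
proof
  assume T: "bounded_on_Qp p (U_op g)"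
  obtain N where N: "0 \<le> N" "\<And>w. w \<in> unit_disc \<Longrightarrow> U_op g (test_fn w) \<in> Qp p"
      "\<And>w. w \<in> unit_disc \<Longrightarrow> Qp_norm p (U_op g (test_fn w)) \<le> N"
    by (rule bounded_on_test_fn[OF p T]) (rule that)
  have "cmod (g w) \<le> bloch_const p * N" if w: "w \<in> unit_disc" "1/2 \<le> cmod w" for w
  proof -
    have "1 * cmod (g w) \<le> 2 * cmod w * cmod (g w)" using w by (intro mult_right_mono) auto
    also have "\<dots> \<le> bloch_const p * Qp_norm p (U_op g (test_fn w))" by (rule U_op_lower[OF p g w(1) N(2)[OF w(1)]])
    also have "\<dots> \<le> bloch_const p * N" using bloch_const_pos[OF p] N(3)[OF w(1)] by (intro mult_left_mono) auto
    finally show ?thesis by simp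
  qed
  then show "Hinf_norm g < \<infinity>"
    unfolding Hinf_norm_finite_iff by (rule holomorphic_bounded_if_bounded_near_boundary[OF g])
next
  assume "Hinf_norm g < \<infinity>"
  then obtain G where "\<And>z. z \<in> unit_disc \<Longrightarrow> cmod (g z) \<le> G" unfolding Hinf_norm_finite_iff by blast
  from U_op_bounded(1,2)[OF p g this] show "bounded_on_Qp p (U_op g)"
    unfolding bounded_on_Qp_def by blast
qed

lemma compact_on_Qp_zero:
  assumes "\<And>f. f \<in> Qp p \<Longrightarrow> T f = (\<lambda>_. 0)"
  shows "compact_on_Qp p T"
proof (rule compact_on_Qp_I)
  show "T \<in> Qp p \<rightarrow> Qp p" using assms zero_in_Qp by auto
  fix f :: "nat \<Rightarrow> complex \<Rightarrow> complex" and r assume "\<And>n. f n \<in> Qp p"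
  then show "\<exists>s F. strict_mono (s :: nat \<Rightarrow> nat) \<and> F \<in> Qp p \<and> (\<lambda>n. Qp_norm p (\<lambda>z. T (f (s n)) z - F z)) \<longlonglongrightarrow> 0"
    using assms zero_in_Qp Qp_norm_zero by (intro exI[of _ id] exI[of _ "\<lambda>_. 0"]) (auto simp: strict_mono_id)
qed

lemma U_op_compact_iff:
  assumes p: "0 < p" and g: "g holomorphic_on unit_disc"
  shows "compact_on_Qp p (U_op g) \<longleftrightarrow> (\<forall>z\<in>unit_disc. g z = 0)"
proof
  assume T: "compact_on_Qp p (U_op g)"
  have "\<exists>\<rho><1. \<forall>w\<in>unit_disc. \<rho> \<le> cmod w \<longrightarrow> cmod (g w) \<le> e" if e: "0 < e" for e
  proof -
    have e': "0 < e / bloch_const p" using e bloch_const_pos[OF p] by simp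
    obtain \<rho> where \<rho>: "0 \<le> \<rho>" "\<rho> < 1"
      and small: "\<And>w. \<lbrakk>w \<in> unit_disc; \<rho> \<le> cmod w\<rbrakk> \<Longrightarrow> Qp_norm p (U_op g (test_fn w)) < e / bloch_const p"
      by (rule compact_test_fn_null[OF p T test_fn_sequence_ops_null(2)[OF g] e']) (assumption | rule that)+
    have "cmod (g w) \<le> e" if w: "w \<in> unit_disc" "max \<rho> (1/2) \<le> cmod w" for w
    proof -
      have UQ: "U_op g (test_fn w) \<in> Qp p" using T test_fn_Qp(1)[OF p w(1)] by (auto simp: compact_on_Qp_def)
      have "1 * cmod (g w) \<le> 2 * cmod w * cmod (g w)" using w by (intro mult_right_mono) auto
      also have "\<dots> \<le> bloch_const p * Qp_norm p (U_op g (test_fn w))" by (rule U_op_lower[OF p g w(1) UQ])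
      also have "\<dots> \<le> bloch_const p * (e / bloch_const p)"
        using bloch_const_pos[OF p] small[OF w(1)] w(2) by (intro mult_left_mono) auto
      finally show ?thesis using bloch_const_pos[OF p] by simp
    qed
    then show ?thesis using \<rho> by (intro exI[of _ "max \<rho> (1/2)"]) auto
  qed
  then show "\<forall>z\<in>unit_disc. g z = 0" using holomorphic_zero_if_null_at_boundary[OF g] by blast
next
  assume 0: "\<forall>z\<in>unit_disc. g z = 0"
  have "U_op g f = (\<lambda>_. 0)" if "f \<in> Qp p" for f
  proof
    fix z
    show "U_op g f z = 0"
    proof (cases "z \<in> unit_disc")
      case True
      then have "closed_segment 0 z \<subseteq> unit_disc" by (simp add: closed_segment_subset)
      then have "contour_integral (linepath 0 z) (\<lambda>w. g w * deriv f w) = contour_integral (linepath 0 z) (\<lambda>_. 0)"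
        using 0 by (intro contour_integral_eq) auto
      then show ?thesis by (simp add: U_op_def)
    qed (simp add: U_op_def)
  qed
  then show "compact_on_Qp p (U_op g)" by (rule compact_on_Qp_zero)
qed

text \<open>
  The test functions show directly that \<open>g\<close> is bounded, so \<open>U\<^sub>g\<close> is bounded; then \<open>V\<^sub>g\<close> differs from
  \<open>M\<^sub>g\<close> by a bounded operator, up to the constant \<open>f 0 * g 0\<close>.
\<close>

lemma M_op_bounded_iff:
  assumes p: "0 < p" and g: "g holomorphic_on unit_disc"
  shows "bounded_on_Qp p (M_op g) \<longleftrightarrow> LCM_norm p (mu_measure p g) < \<infinity> \<and> Hinf_norm g < \<infinity>"
proof
  assume M: "bounded_on_Qp p (M_op g)"
  obtain N where N: "0 \<le> N" "\<And>w. w \<in> unit_disc \<Longrightarrow> M_op g (test_fn w) \<in> Qp p"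
      "\<And>w. w \<in> unit_disc \<Longrightarrow> Qp_norm p (M_op g (test_fn w)) \<le> N"
    by (rule bounded_on_test_fn[OF p M]) (rule that)
  have gb: "cmod (g w) \<le> (1 + bloch_const p) * N" if w: "w \<in> unit_disc" for w
    using bloch_const_pos[OF p] N(3)[OF w]
    by (intro order.trans[OF M_op_lower[OF p g w N(2)[OF w]]] mult_left_mono) auto
  then have H: "Hinf_norm g < \<infinity>" unfolding Hinf_norm_finite_iff by blast
  define G where "G = (1 + bloch_const p) * N"
  obtain C where C: "0 \<le> C" "\<And>f. f \<in> Qp p \<Longrightarrow> M_op g f \<in> Qp p" "\<And>f. f \<in> Qp p \<Longrightarrow> Qp_norm p (M_op g f) \<le> C * Qp_norm p f"
    by (rule bounded_on_QpD[OF M]) (rule that)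
  have G0: "0 \<le> G" unfolding G_def using bloch_const_pos[OF p] N(1) by simp
  have V: "V_op g f \<in> Qp p \<and> Qp_norm p (V_op g f) \<le> (2 * (C + G)) * Qp_norm p f" if f: "f \<in> Qp p" for f
  proof -
    note fh = Qp_holomorphic[OF f]
    define q where "q = Qp_norm p f"
    have q: "0 \<le> q" by (simp add: q_def Qp_norm_nonneg)
    have E: "Qp_energy p (V_op g f) w \<le> ennreal ((2 * (C * q + G * q))\<^sup>2)" if w: "w \<in> unit_disc" for w
    proof (rule Qp_energy_sum_le[OF M_op_props(1)[OF g fh] U_op_props(1)[OF g fh] w])
      show "cmod (deriv (V_op g f) z) \<le> cmod (deriv (M_op g f) z) + cmod (deriv (U_op g f) z)" if z: "z \<in> unit_disc" for z
        unfolding V_op_props(2)[OF g fh z] M_op_props(2)[OF g fh z] U_op_props(2)[OF g fh z]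
        using norm_triangle_ineq4[of "deriv g z * f z + g z * deriv f z" "g z * deriv f z"] by simp
      show "Qp_energy p (M_op g f) w \<le> ennreal ((C * q)\<^sup>2)"
        using C(3)[OF f] unfolding q_def
        by (intro order.trans[OF Qp_energy_le_norm[OF C(2)[OF f] w]] ennreal_leI power_mono Qp_norm_nonneg)
      show "Qp_energy p (U_op g f) w \<le> ennreal ((G * q)\<^sup>2)"
        unfolding q_def by (rule U_op_bounded(3)[OF p g _ f w]) (use gb in \<open>simp add: G_def\<close>)
    qed (use C q G0 in auto)
    have s0: "0 \<le> 2 * (C * q + G * q)" using C q G0 by simp
    have "V_op g f \<in> Qp p" by (rule QpI[OF V_op_props(1)[OF g fh] V_op_props(4)[OF g fh] s0 E])
    moreover have "Qp_norm p (V_op g f) \<le> 0 + 2 * (C * q + G * q)"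
      by (rule Qp_norm_le[OF s0 E]) (simp_all add: V_op_props(3)[OF g fh])
    ultimately show ?thesis by (simp add: q_def algebra_simps)
  qed
  then have "bounded_on_Qp p (V_op g)" unfolding bounded_on_Qp_def by blast
  then show "LCM_norm p (mu_measure p g) < \<infinity> \<and> Hinf_norm g < \<infinity>"
    using V_op_bounded_iff[OF p g] H by blast
next
  assume a: "LCM_norm p (mu_measure p g) < \<infinity> \<and> Hinf_norm g < \<infinity>"
  then obtain A where A: "0 \<le> A" "log_carleson p (plane_measure p g) A"
    using LCM_imp_log_carleson[OF g] by blast
  obtain G where G: "\<And>z. z \<in> unit_disc \<Longrightarrow> cmod (g z) \<le> G" using a unfolding Hinf_norm_finite_iff by blast
  have G0: "0 \<le> G" using G[of 0] order.trans[OF norm_ge_zero] by auto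
  define D where "D = sqrt (embed_const p * A)"
  have D: "0 \<le> D" unfolding D_def using embed_const_nonneg[OF p] A by simp
  have "M_op g f \<in> Qp p \<and> Qp_norm p (M_op g f) \<le> (G + 2 * (D + G)) * Qp_norm p f" if f: "f \<in> Qp p" for f
  proof -
    note fh = Qp_holomorphic[OF f]
    define q where "q = Qp_norm p f"
    have q: "0 \<le> q" by (simp add: q_def Qp_norm_nonneg)
    have E: "Qp_energy p (M_op g f) w \<le> ennreal ((2 * (D * q + G * q))\<^sup>2)" if w: "w \<in> unit_disc" for w
    proof (rule Qp_energy_sum_le[OF V_op_props(1)[OF g fh] U_op_props(1)[OF g fh] w])
      show "cmod (deriv (M_op g f) z) \<le> cmod (deriv (V_op g f) z) + cmod (deriv (U_op g f) z)" if z: "z \<in> unit_disc" for z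
        unfolding V_op_props(2)[OF g fh z] M_op_props(2)[OF g fh z] U_op_props(2)[OF g fh z]
        by (rule norm_triangle_ineq)
      show "Qp_energy p (V_op g f) w \<le> ennreal ((D * q)\<^sup>2)"
        unfolding q_def D_def by (rule V_op_bound(3)[OF p g A(2,1) f w])
      show "Qp_energy p (U_op g f) w \<le> ennreal ((G * q)\<^sup>2)"
        unfolding q_def by (rule U_op_bounded(3)[OF p g G f w])
    qed (use D q G0 in auto)
    have s0: "0 \<le> 2 * (D * q + G * q)" using D q G0 by simp
    have "M_op g f \<in> Qp p" by (rule QpI[OF M_op_props(1)[OF g fh] M_op_props(3)[OF g fh] s0 E])
    moreover have "Qp_norm p (M_op g f) \<le> G * q + 2 * (D * q + G * q)"
    proof (rule Qp_norm_le[OF s0 E])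
      have "cmod (f 0) * cmod (g 0) \<le> q * G"
        unfolding q_def by (intro mult_mono norm_0_le_Qp_norm f G Qp_norm_nonneg) auto
      then show "cmod (M_op g f 0) \<le> G * q" by (simp add: M_op_def norm_mult mult.commute)
    qed
    ultimately show ?thesis by (simp add: q_def algebra_simps)
  qed
  then show "bounded_on_Qp p (M_op g)" unfolding bounded_on_Qp_def by blast
qed

lemma M_op_compact_iff:
  assumes p: "0 < p" and g: "g holomorphic_on unit_disc"
  shows "compact_on_Qp p (M_op g) \<longleftrightarrow> (\<forall>z\<in>unit_disc. g z = 0)"
proof
  assume T: "compact_on_Qp p (M_op g)"
  have "\<exists>\<rho><1. \<forall>w\<in>unit_disc. \<rho> \<le> cmod w \<longrightarrow> cmod (g w) \<le> e" if e: "0 < e" for e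
  proof -
    have b: "0 < 1 + bloch_const p" using bloch_const_pos[OF p] by simp
    then have e': "0 < e / (1 + bloch_const p)" using e by simp
    obtain \<rho> where \<rho>: "0 \<le> \<rho>" "\<rho> < 1"
      and small: "\<And>w. \<lbrakk>w \<in> unit_disc; \<rho> \<le> cmod w\<rbrakk> \<Longrightarrow> Qp_norm p (M_op g (test_fn w)) < e / (1 + bloch_const p)"
      by (rule compact_test_fn_null[OF p T test_fn_sequence_ops_null(3)[OF g] e']) (assumption | rule that)+
    have "cmod (g w) \<le> e" if w: "w \<in> unit_disc" "\<rho> \<le> cmod w" for w
    proof -
      have MQ: "M_op g (test_fn w) \<in> Qp p" using T test_fn_Qp(1)[OF p w(1)] by (auto simp: compact_on_Qp_def)
      have "cmod (g w) \<le> (1 + bloch_const p) * Qp_norm p (M_op g (test_fn w))" by (rule M_op_lower[OF p g w(1) MQ])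
      also have "\<dots> \<le> (1 + bloch_const p) * (e / (1 + bloch_const p))"
        using b small[OF w] by (intro mult_left_mono) auto
      finally show ?thesis using b by simp
    qed
    then show ?thesis using \<rho> by blast
  qed
  then show "\<forall>z\<in>unit_disc. g z = 0" using holomorphic_zero_if_null_at_boundary[OF g] by blast
next
  assume 0: "\<forall>z\<in>unit_disc. g z = 0"
  then have "M_op g f = (\<lambda>_. 0)" for f by (auto simp: M_op_def fun_eq_iff)
  then show "compact_on_Qp p (M_op g)" by (intro compact_on_Qp_zero)
qed

theorem theorem1p2:
  fixes p :: real and g :: "complex \<Rightarrow> complex"
  assumes "0 < p" and "g holomorphic_on unit_disc"
  shows
    "(bounded_on_Qp p (V_op g) \<longleftrightarrow> LCM_norm p (mu_measure p g) < \<infinity>) \<and>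
     (compact_on_Qp p (V_op g) \<longleftrightarrow>
       ((\<lambda>I. ennreal (arc_length I powr (-p) * (ln (2 / arc_length I))\<^sup>2) *
              emeasure (mu_measure p g) (carleson_square I)) \<longlongrightarrow> 0) small_arcs) \<and>
     (bounded_on_Qp p (U_op g) \<longleftrightarrow> Hinf_norm g < \<infinity>) \<and>
     (compact_on_Qp p (U_op g) \<longleftrightarrow> (\<forall>z\<in>unit_disc. g z = 0)) \<and>
     (bounded_on_Qp p (M_op g) \<longleftrightarrow> LCM_norm p (mu_measure p g) < \<infinity> \<and> Hinf_norm g < \<infinity>) \<and>
     (compact_on_Qp p (M_op g) \<longleftrightarrow> (\<forall>z\<in>unit_disc. g z = 0))"
  unfolding small_arcs_tendsto_iff vanishing_log_carleson_def[symmetric]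
  by (intro conjI V_op_bounded_iff V_op_compact_iff U_op_bounded_iff U_op_compact_iff
      M_op_bounded_iff M_op_compact_iff assms)

end
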